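(* Let $\sigma$ be a signature and $\Gamma\cup\{\varphi\}\subseteq \mathcal{PCO}_{\sigma}$. Then $\Gamma \models \varphi$ implies $\Gamma\vdash \varphi$, where $\vdash$ is derivability in the infinitary deduction system described in the context.
   Context: Setting. A signature $\sigma=(\mathrm{Dom},\mathrm{Ran})$ consists of a finite nonempty set $\mathrm{Dom}$ of variables, each $X$ with a finite nonempty range $\mathrm{Ran}(X)$. For a variable $V$, $\mathbf W_V$ lists $\mathrm{Dom}\setminus\{V\}$; $\mathbf W_{XY}$ lists $\mathrm{Dom}\setminus\{X,Y\}$. A causal multiteam $T=(T^-,\mathcal F)$ consists of a finite multiset $T^-$ of assignments over $\mathrm{Dom}$ and a function $\mathcal F$ assigning to each endogenous variable $V$ a non-constant function $\mathcal F_V:\mathrm{Ran}(\mathbf W_V)\to\mathrm{Ran}(V)$ with $\mathcal F_V(s(\mathbf W_V))=s(V)$ for all $s\in T^-$ (other variables are exogenous). Observation: $T^\alpha$ keeps the assignments $s\in T^-$ with $(\{s\},\mathcal F)\models\alpha$. Intervention $T_{\mathbf X=\mathbf x}$ (for consistent $\mathbf X=\mathbf x$): set $\mathbf X$ to $\mathbf x$, drop $\mathcal F_X$ for $X\in\mathbf X$, and recompute the other endogenous variables via their structural equations. $P_T(\alpha)=|(T^\alpha)^-|/|T^-|$. Language $\mathcal{CO}$: $\alpha ::= Y=y \mid Y\neq y \mid \alpha\land\alpha \mid \alpha\supset\alpha \mid \mathbf X=\mathbf x\,\Box\!\!\rightarrow\alpha$, with $T\models Y=y$ iff all $s\in T^-$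 have $s(Y)=y$ (similarly $\neq$), $\land$ classical, $T\models\alpha\supset\beta$ iff $T^\alpha\models\beta$, $T\models \mathbf X=\mathbf x\,\Box\!\!\rightarrow\psi$ iff $T_{\mathbf X=\mathbf x}\models\psi$ or $\mathbf X=\mathbf x$ is inconsistent. Abbreviations: $\top:=X=x\,\Box\!\!\rightarrow X=x$, $\bot:=X=x\,\Box\!\!\rightarrow X\neq x$, $\neg\alpha:=\alpha\supset\bot$, $\alpha\lor\beta:=\neg(\neg\alpha\land\neg\beta)$, $\alpha\equiv\beta:=(\alpha\supset\beta)\land(\beta\supset\alpha)$. Language $\mathcal{PCO}$: $\varphi ::= \eta \mid \varphi\land\varphi\mid\varphi\sqcup\varphi\mid \alpha\supset\varphi\mid \mathbf X=\mathbf x\,\Box\!\!\rightarrow\varphi$ ($\alpha\in\mathcal{CO}$), where atoms $\eta$ are $\mathcal{CO}$ literals or $\Pr(\alpha)\rhd\epsilon$, $\Pr(\alpha)\rhd\Pr(\beta)$ with $\rhd\in\{\geq,>\}$, $\epsilon\in[0,1]\cap\mathbb Q$. $\sqcup$ is classical disjunction; probabilistic atoms hold in $T$ iff $T^-=\emptyset$ or the inequality holds for $P_T$. Abbreviations: $\Pr(\alpha)\le\epsilon:=\Pr(\neg\alpha)\ge1-\epsilon$, $\Pr(\alpha)<\epsilon:=\Pr(\neg\alpha)>1-\epsilon$, $\Pr(\alpha)=\epsilon$ as conjunction of $\ge,\le$, $\Pr(\alpha)\ne\epsilon:=\Pr(\alpha)>\epsilon\sqcup\Pr(\alpha)<\epsilon$.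 The weak contradictory negation $\varphi^C$ is defined inductively: $(\Pr(\alpha)\ge\epsilon)^C=\Pr(\alpha)<\epsilon$, $(\Pr(\alpha)>\epsilon)^C=\Pr(\alpha)\le\epsilon$, $(\Pr(\alpha)\ge\Pr(\beta))^C=\Pr(\beta)>\Pr(\alpha)$ (and vice versa), $\bot^C=\top$, $(X=x)^C=\Pr(X=x)<1$, $(X\ne x)^C=\Pr(X\ne x)<1$, $(\psi\land\chi)^C=\psi^C\sqcup\chi^C$, $(\psi\sqcup\chi)^C=\psi^C\land\chi^C$, $(\alpha\supset\chi)^C=\Pr(\alpha)>0\land\alpha\supset\chi^C$, $(\mathbf X=\mathbf x\,\Box\!\!\rightarrow\chi)^C=\mathbf X=\mathbf x\,\Box\!\!\rightarrow\chi^C$. Then $\psi\rightarrow\chi:=\psi^C\sqcup\chi$ (material conditional), $\leftrightarrow$ accordingly. $\Gamma\models\varphi$ iff every causal multiteam of signature $\sigma$ satisfying $\Gamma$ satisfies $\varphi$. Auxiliary formulas: $X\rightsquigarrow Y$ is the disjunction ($\lor$) over $\mathbf Z\subseteq\mathrm{Dom}$, $x\ne x'$, $y\ne y'$, $\mathbf z$ of $((\mathbf Z=\mathbf z\land X=x)\,\Box\!\!\rightarrow Y=y)\land((\mathbf Z=\mathbf z\land X=x')\,\Box\!\!\rightarrow Y=y')$; $\varphi_{DC(X,Y)}$ is the same with $\mathbf Z=\mathbf W_{XY}$; $\varphi_{End(Y)}:=\bigsqcup_{X\in\mathbf W_Y}\varphi_{DC(X,Y)}$. Deduction system ($\alpha,\beta\in\mathcal{CO}$):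 T1 classical tautologies in $\land,\sqcup,\rightarrow,{}^C,\top,\bot$; T2 $\mathcal{CO}$ instances of classical tautologies in $\land,\lor,\supset,\neg,\top,\bot$; MP (from $\psi,\psi\rightarrow\chi$ infer $\chi$); Rep (from $\vdash\varphi$, $\vdash\theta\leftrightarrow\theta'$ infer $\vdash\varphi[\theta'/\theta]$). P1 $\alpha\leftrightarrow\Pr(\alpha)=1$; P2 $\Pr(\alpha)\ge0$; P3 $(\Pr(\alpha)=\delta\land\Pr(\beta)=\epsilon\land\Pr(\alpha\land\beta)=0)\rightarrow\Pr(\alpha\lor\beta)=\delta+\epsilon$ ($\delta+\epsilon\le1$); P3b $\Pr(\alpha)\ge\epsilon\land\Pr(\alpha\land\beta)=0\rightarrow\Pr(\beta)\le1-\epsilon$; P4 $\Pr(\alpha)\le\epsilon\rightarrow\Pr(\alpha)<\delta$ ($\delta>\epsilon$); P5 $\Pr(\alpha)<\epsilon\rightarrow\Pr(\alpha)\le\epsilon$; P6 $\Pr(\alpha\equiv\beta)=1\rightarrow(\Pr(\alpha)=\epsilon\rightarrow\Pr(\beta)=\epsilon)$; P6b $\Pr(\alpha\supset\beta)=1\rightarrow(\Pr(\alpha)=\epsilon\rightarrow\Pr(\beta)\ge\epsilon)$; rule $\bot^\omega$: from $\psi\rightarrow\Pr(\alpha)\ne\epsilon$ for all $\epsilon\in[0,1]\cap\mathbb Q$ infer $\psi\rightarrow\bot$. CP1/CP2: $(\Pr(\alpha)=\delta\land\Pr(\beta)=\epsilon)\rightarrow\Pr(\alpha)\ge\Pr(\beta)$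 if $\delta\ge\epsilon$, resp. $>$ if $\delta>\epsilon$. O1 $\Pr(\alpha)=0\rightarrow(\alpha\supset\psi)$; O1b $(\alpha\supset\bot)\rightarrow\Pr(\alpha)=0$; O2 $(\Pr(\alpha)=\delta\land\Pr(\alpha\land\beta)=\epsilon)\rightarrow(\alpha\supset\Pr(\beta)=\epsilon/\delta)$ ($\delta\ne0$); O3 $(\alpha\supset\Pr(\beta)=\epsilon)\rightarrow(\Pr(\alpha)=\delta\leftrightarrow\Pr(\alpha\land\beta)=\epsilon\delta)$ ($\epsilon\ne0$); O4 $(\alpha\supset\psi)\rightarrow(\alpha\rightarrow\psi)$; O5: $\alpha\supset$ distributes over $\land$ and $\sqcup$, and $\alpha\supset(\beta\supset\chi)\leftrightarrow(\alpha\land\beta)\supset\chi$; rule Mon$_\supset$ (from $\vdash\psi\rightarrow\chi$ infer $\vdash(\alpha\supset\psi)\rightarrow(\alpha\supset\chi)$); rule $\rightarrow$to$\supset$ (from $\vdash\alpha\rightarrow\psi$ infer $\vdash\alpha\supset\psi$); rule $\supset^\omega$: from $\psi\rightarrow(\Pr(\alpha\land\beta)=\delta\epsilon\leftrightarrow\Pr(\alpha)=\epsilon)$ for all $\epsilon\in(0,1]\cap\mathbb Q$ infer $\psi\rightarrow(\alpha\supset\Pr(\beta)=\delta)$. A1 $\mathbf Y=\mathbf y\rightarrow\mathbf Y\ne\mathbf y'$ ($\mathbf y\ne\mathbf y'$); A2 $X\ne x\leftrightarrow(X=x\supset\bot)$; A3 $\bigvee_{\mathbf y}\mathbf Y=\mathbf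 y$. C1–C3: $\mathbf X=\mathbf x\,\Box\!\!\rightarrow$ distributes over $\land$, $\sqcup$, and over $\supset$ as $(\mathbf X=\mathbf x\,\Box\!\!\rightarrow\alpha)\supset(\mathbf X=\mathbf x\,\Box\!\!\rightarrow\chi)$; C4/C4b: nested interventions $\mathbf X=\mathbf x\,\Box\!\!\rightarrow(\mathbf Y=\mathbf y\,\Box\!\!\rightarrow\chi)$ vs. $(\mathbf X'=\mathbf x'\land\mathbf Y=\mathbf y)\,\Box\!\!\rightarrow\chi$ with $\mathbf X'=\mathbf X\setminus\mathbf Y$ (C4, for consistent $\mathbf X=\mathbf x$) and $((\mathbf X=\mathbf x\land\mathbf Y=\mathbf y)\,\Box\!\!\rightarrow\chi)\rightarrow(\mathbf X=\mathbf x\,\Box\!\!\rightarrow(\mathbf Y=\mathbf y\,\Box\!\!\rightarrow\chi))$ (C4b); C5 $(\mathbf X=\mathbf x\,\Box\!\!\rightarrow\bot)\rightarrow\psi$ (consistent $\mathbf X=\mathbf x$); C6 $(\mathbf X=\mathbf x\land Y=y)\,\Box\!\!\rightarrow Y=y$; C7 $(\mathbf X=\mathbf x\land\gamma)\rightarrow(\mathbf X=\mathbf x\,\Box\!\!\rightarrow\gamma)$ for $\gamma$ without $\Box\!\!\rightarrow$; C8/C8b $(\mathbf X=\mathbf x\,\Box\!\!\rightarrow\Pr(\alpha)\rhd\epsilon)\leftrightarrow\Pr(\mathbf X=\mathbf x\,\Box\!\!\rightarrow\alpha)\rhd\epsilon$ and analogously for comparison atoms; C9 $\varphi_{End(Y)}\rightarrow(\mathbf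 W_Y=\mathbf w\,\Box\!\!\rightarrow\bigsqcup_{y}Y=y)$; C10 $(\varphi_{End(Y)})^C\rightarrow(Y=y\supset(\mathbf W_Y=\mathbf w\,\Box\!\!\rightarrow Y=y))$; C11 $(X_1\rightsquigarrow X_2\land\dots\land X_{n-1}\rightsquigarrow X_n)\rightarrow(X_n\rightsquigarrow X_1)^C$ ($n>1$); rule Mon$_{\Box\!\!\rightarrow}$ (from $\vdash\psi\rightarrow\chi$ infer $\vdash(\mathbf X=\mathbf x\,\Box\!\!\rightarrow\psi)\rightarrow(\mathbf X=\mathbf x\,\Box\!\!\rightarrow\chi)$). $\Gamma\vdash\varphi$ iff there is a countable ordinal-indexed sequence ending in $\varphi$ of axioms, members of $\Gamma$, or consequences of earlier items by rules (Rep, Mon, $\rightarrow$to$\supset$ apply only to theorems).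
   Formalization: As stated the calculus derives ⊥; here the negation ^C of a counterfactual with inconsistent antecedent is ⊥, C4b (jointly) and C8/C8b require consistent antecedents, C11 requires distinct variables, and X⇝Y ranges over Z not containing X. *)

theory Defs
  imports Complex_Main "HOL-Library.Multiset" "HOL-Library.FuncSet"
begin

section \<open>Signatures and causal multiteams\<close>

record ('v, 'a) signature =
  Dom :: "'v set"
  Ran :: "'v \<Rightarrow> 'a set"

definition is_signature :: "('v, 'a) signature \<Rightarrow> bool" where
  "is_signature \<sigma> \<longleftrightarrow>
     finite (Dom \<sigma>) \<and> Dom \<sigma> \<noteq> {} \<and>
     (\<forall>X\<in>Dom \<sigma>. finite (Ran \<sigma> X) \<and> Ran \<sigma> X \<noteq> {})"

text \<open>Assignments to a set of variables are extensional functions (\<^term>\<open>undefined\<close> elsewhere),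
  so that equality of assignments is equality of functions.\<close>

definition assigns :: "('v, 'a) signature \<Rightarrow> 'v set \<Rightarrow> ('v \<Rightarrow> 'a) set" where
  "assigns \<sigma> A = Pi\<^sub>E A (Ran \<sigma>)"

abbreviation others :: "('v, 'a) signature \<Rightarrow> 'v \<Rightarrow> 'v set" where
  "others \<sigma> V \<equiv> Dom \<sigma> - {V}"

text \<open>The second component of a causal multiteam sends each endogenous variable to its
  structural function and each exogenous variable to \<^term>\<open>None\<close>.\<close>

type_synonym ('v, 'a) func = "'v \<Rightarrow> (('v \<Rightarrow> 'a) \<Rightarrow> 'a) option"
type_synonym ('v, 'a) cmt = "('v \<Rightarrow> 'a) multiset \<times> ('v, 'a) func"

definition parent_rel :: "('v, 'a) signature \<Rightarrow> ('v, 'a) func \<Rightarrow> ('v \<times> 'v) set" where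
  "parent_rel \<sigma> F = {(X, V). \<exists>f. F V = Some f \<and> X \<in> others \<sigma> V \<and>
     (\<exists>w\<in>assigns \<sigma> (others \<sigma> V). \<exists>x\<in>Ran \<sigma> X. f (w(X := x)) \<noteq> f w)}"

text \<open>Acyclicity of the causal graph is what makes the recursive recomputation of the endogenous
  variables in an intervention well defined.\<close>

definition causal_multiteam :: "('v, 'a) signature \<Rightarrow> ('v, 'a) cmt \<Rightarrow> bool" where
  "causal_multiteam \<sigma> T \<longleftrightarrow>
     set_mset (fst T) \<subseteq> assigns \<sigma> (Dom \<sigma>) \<and>
     dom (snd T) \<subseteq> Dom \<sigma> \<and>
     (\<forall>V f. snd T V = Some f \<longrightarrow>
        f \<in> assigns \<sigma> (others \<sigma> V) \<rightarrow> Ran \<sigma> V \<and>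
        (\<exists>w\<in>assigns \<sigma> (others \<sigma> V). \<exists>w'\<in>assigns \<sigma> (others \<sigma> V). f w \<noteq> f w') \<and>
        (\<forall>s\<in>#fst T. f (restrict s (others \<sigma> V)) = s V)) \<and>
     acyclic (parent_rel \<sigma> (snd T))"

text \<open>The antecedent of a counterfactual is represented by its set of equations
  \<open>(X, x)\<close>, i.e. modulo order and repetition of the conjuncts.\<close>

type_synonym ('v, 'a) eqs = "('v \<times> 'a) set"

definition is_eqs :: "('v, 'a) signature \<Rightarrow> ('v, 'a) eqs \<Rightarrow> bool" where
  "is_eqs \<sigma> E \<longleftrightarrow> E \<subseteq> (SIGMA X:Dom \<sigma>. Ran \<sigma> X)"

abbreviation consistent :: "('v, 'a) eqs \<Rightarrow> bool" where
  "consistent E \<equiv> single_valued E"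

definition eqs_of :: "('v \<Rightarrow> 'a) \<Rightarrow> 'v set \<Rightarrow> ('v, 'a) eqs" where
  "eqs_of w A = (\<lambda>X. (X, w X)) ` A"

definition intervene_asg ::
  "('v, 'a) signature \<Rightarrow> ('v, 'a) func \<Rightarrow> ('v, 'a) eqs \<Rightarrow> ('v \<Rightarrow> 'a) \<Rightarrow> ('v \<Rightarrow> 'a)" where
  "intervene_asg \<sigma> F E s = (THE t. t \<in> assigns \<sigma> (Dom \<sigma>) \<and>
     (\<forall>(X, x)\<in>E. t X = x) \<and>
     (\<forall>V\<in>Dom \<sigma> - fst ` E.
        t V = (case F V of None \<Rightarrow> s V | Some f \<Rightarrow> f (restrict t (others \<sigma> V)))))"

definition intervene ::
  "('v, 'a) signature \<Rightarrow> ('v, 'a) eqs \<Rightarrow> ('v, 'a) cmt \<Rightarrow> ('v, 'a) cmt" where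
  "intervene \<sigma> E T =
     (image_mset (intervene_asg \<sigma> (snd T) E) (fst T), snd T |` (- fst ` E))"

definition observe :: "(('v, 'a) cmt \<Rightarrow> bool) \<Rightarrow> ('v, 'a) cmt \<Rightarrow> ('v, 'a) cmt" where
  "observe P T = (filter_mset (\<lambda>s. P ({#s#}, snd T)) (fst T), snd T)"

definition prob :: "(('v, 'a) cmt \<Rightarrow> bool) \<Rightarrow> ('v, 'a) cmt \<Rightarrow> rat" where
  "prob P T = of_nat (size (fst (observe P T))) / of_nat (size (fst T))"


section \<open>Syntax and semantics\<close>

text \<open>\<open>Or\<close> is the global (classical) disjunction \<open>\<squnion>\<close>, \<open>Imp\<close> is \<open>\<supset>\<close>, \<open>Cf\<close> is the
  counterfactual. Both languages are carved out of this type of raw formulas.\<close>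

datatype ('v, 'a) fm =
    Eq 'v 'a
  | Neq 'v 'a
  | PrGe "('v, 'a) fm" rat
  | PrGt "('v, 'a) fm" rat
  | PrGeP "('v, 'a) fm" "('v, 'a) fm"
  | PrGtP "('v, 'a) fm" "('v, 'a) fm"
  | And "('v, 'a) fm" "('v, 'a) fm"
  | Or "('v, 'a) fm" "('v, 'a) fm"
  | Imp "('v, 'a) fm" "('v, 'a) fm"
  | Cf "('v, 'a) eqs" "('v, 'a) fm"

inductive_set CO :: "('v, 'a) signature \<Rightarrow> ('v, 'a) fm set" for \<sigma> where
  "X \<in> Dom \<sigma> \<Longrightarrow> x \<in> Ran \<sigma> X \<Longrightarrow> Eq X x \<in> CO \<sigma>"
| "X \<in> Dom \<sigma> \<Longrightarrow> x \<in> Ran \<sigma> X \<Longrightarrow> Neq X x \<in> CO \<sigma>"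
| "\<alpha> \<in> CO \<sigma> \<Longrightarrow> \<beta> \<in> CO \<sigma> \<Longrightarrow> And \<alpha> \<beta> \<in> CO \<sigma>"
| "\<alpha> \<in> CO \<sigma> \<Longrightarrow> \<beta> \<in> CO \<sigma> \<Longrightarrow> Imp \<alpha> \<beta> \<in> CO \<sigma>"
| "is_eqs \<sigma> E \<Longrightarrow> \<alpha> \<in> CO \<sigma> \<Longrightarrow> Cf E \<alpha> \<in> CO \<sigma>"

inductive_set PCO :: "('v, 'a) signature \<Rightarrow> ('v, 'a) fm set" for \<sigma> where
  "X \<in> Dom \<sigma> \<Longrightarrow> x \<in> Ran \<sigma> X \<Longrightarrow> Eq X x \<in> PCO \<sigma>"
| "X \<in> Dom \<sigma> \<Longrightarrow> x \<in> Ran \<sigma> X \<Longrightarrow> Neq X x \<in> PCO \<sigma>"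
| "\<alpha> \<in> CO \<sigma> \<Longrightarrow> 0 \<le> \<epsilon> \<Longrightarrow> \<epsilon> \<le> 1 \<Longrightarrow> PrGe \<alpha> \<epsilon> \<in> PCO \<sigma>"
| "\<alpha> \<in> CO \<sigma> \<Longrightarrow> 0 \<le> \<epsilon> \<Longrightarrow> \<epsilon> \<le> 1 \<Longrightarrow> PrGt \<alpha> \<epsilon> \<in> PCO \<sigma>"
| "\<alpha> \<in> CO \<sigma> \<Longrightarrow> \<beta> \<in> CO \<sigma> \<Longrightarrow> PrGeP \<alpha> \<beta> \<in> PCO \<sigma>"
| "\<alpha> \<in> CO \<sigma> \<Longrightarrow> \<beta> \<in> CO \<sigma> \<Longrightarrow> PrGtP \<alpha> \<beta> \<in> PCO \<sigma>"
| "\<phi> \<in> PCO \<sigma> \<Longrightarrow> \<psi> \<in> PCO \<sigma> \<Longrightarrow> And \<phi> \<psi> \<in> PCO \<sigma>"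
| "\<phi> \<in> PCO \<sigma> \<Longrightarrow> \<psi> \<in> PCO \<sigma> \<Longrightarrow> Or \<phi> \<psi> \<in> PCO \<sigma>"
| "\<alpha> \<in> CO \<sigma> \<Longrightarrow> \<phi> \<in> PCO \<sigma> \<Longrightarrow> Imp \<alpha> \<phi> \<in> PCO \<sigma>"
| "is_eqs \<sigma> E \<Longrightarrow> \<phi> \<in> PCO \<sigma> \<Longrightarrow> Cf E \<phi> \<in> PCO \<sigma>"

primrec sat :: "('v, 'a) signature \<Rightarrow> ('v, 'a) fm \<Rightarrow> ('v, 'a) cmt \<Rightarrow> bool" where
  "sat \<sigma> (Eq X x) T \<longleftrightarrow> (\<forall>s\<in>#fst T. s X = x)"
| "sat \<sigma> (Neq X x) T \<longleftrightarrow> (\<forall>s\<in>#fst T. s X \<noteq> x)"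
| "sat \<sigma> (PrGe \<alpha> \<epsilon>) T \<longleftrightarrow> fst T = {#} \<or> prob (sat \<sigma> \<alpha>) T \<ge> \<epsilon>"
| "sat \<sigma> (PrGt \<alpha> \<epsilon>) T \<longleftrightarrow> fst T = {#} \<or> prob (sat \<sigma> \<alpha>) T > \<epsilon>"
| "sat \<sigma> (PrGeP \<alpha> \<beta>) T \<longleftrightarrow> fst T = {#} \<or> prob (sat \<sigma> \<alpha>) T \<ge> prob (sat \<sigma> \<beta>) T"
| "sat \<sigma> (PrGtP \<alpha> \<beta>) T \<longleftrightarrow> fst T = {#} \<or> prob (sat \<sigma> \<alpha>) T > prob (sat \<sigma> \<beta>) T"
| "sat \<sigma> (And \<phi> \<psi>) T \<longleftrightarrow> sat \<sigma> \<phi> T \<and> sat \<sigma> \<psi> T"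
| "sat \<sigma> (Or \<phi> \<psi>) T \<longleftrightarrow> sat \<sigma> \<phi> T \<or> sat \<sigma> \<psi> T"
| "sat \<sigma> (Imp \<alpha> \<phi>) T \<longleftrightarrow> sat \<sigma> \<phi> (observe (sat \<sigma> \<alpha>) T)"
| "sat \<sigma> (Cf E \<phi>) T \<longleftrightarrow> sat \<sigma> \<phi> (intervene \<sigma> E T) \<or> \<not> consistent E"

definition entails :: "('v, 'a) signature \<Rightarrow> ('v, 'a) fm set \<Rightarrow> ('v, 'a) fm \<Rightarrow> bool" where
  "entails \<sigma> \<Gamma> \<phi> \<longleftrightarrow>
     (\<forall>T. causal_multiteam \<sigma> T \<longrightarrow> (\<forall>\<gamma>\<in>\<Gamma>. sat \<sigma> \<gamma> T) \<longrightarrow> sat \<sigma> \<phi> T)"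


section \<open>Abbreviated formulas\<close>

text \<open>An arbitrary but fixed ordering of the variables and of each range, used to write
  finite conjunctions and disjunctions.\<close>

definition enum :: "'b set \<Rightarrow> 'b list" where
  "enum A = (SOME xs. set xs = A \<and> distinct xs)"

definition vars :: "('v, 'a) signature \<Rightarrow> 'v list" where
  "vars \<sigma> = enum (Dom \<sigma>)"

definition vals :: "('v, 'a) signature \<Rightarrow> 'v \<Rightarrow> 'a list" where
  "vals \<sigma> X = enum (Ran \<sigma> X)"

definition tuples :: "('v, 'a) signature \<Rightarrow> 'v list \<Rightarrow> 'a list list" where
  "tuples \<sigma> Xs = product_lists (map (vals \<sigma>) Xs)"

fun big :: "('b \<Rightarrow> 'b \<Rightarrow> 'b) \<Rightarrow> 'b \<Rightarrow> 'b list \<Rightarrow> 'b" where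
  "big f e [] = e"
| "big f e [a] = a"
| "big f e (a # b # cs) = f a (big f e (b # cs))"

context
  fixes \<sigma> :: "('v, 'a) signature"
begin

definition falsum :: "('v, 'a) fm" where
  "falsum = (let X = hd (vars \<sigma>); x = hd (vals \<sigma> X) in Cf {(X, x)} (Neq X x))"

definition verum :: "('v, 'a) fm" where
  "verum = (let X = hd (vars \<sigma>); x = hd (vals \<sigma> X) in Cf {(X, x)} (Eq X x))"

definition neg :: "('v, 'a) fm \<Rightarrow> ('v, 'a) fm" where
  "neg \<alpha> = Imp \<alpha> falsum"

definition disj :: "('v, 'a) fm \<Rightarrow> ('v, 'a) fm \<Rightarrow> ('v, 'a) fm" where
  "disj \<alpha> \<beta> = neg (And (neg \<alpha>) (neg \<beta>))"

definition equi :: "('v, 'a) fm \<Rightarrow> ('v, 'a) fm \<Rightarrow> ('v, 'a) fm" where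
  "equi \<alpha> \<beta> = And (Imp \<alpha> \<beta>) (Imp \<beta> \<alpha>)"

definition PrLe :: "('v, 'a) fm \<Rightarrow> rat \<Rightarrow> ('v, 'a) fm" where
  "PrLe \<alpha> \<epsilon> = PrGe (neg \<alpha>) (1 - \<epsilon>)"

definition PrLt :: "('v, 'a) fm \<Rightarrow> rat \<Rightarrow> ('v, 'a) fm" where
  "PrLt \<alpha> \<epsilon> = PrGt (neg \<alpha>) (1 - \<epsilon>)"

definition PrEq :: "('v, 'a) fm \<Rightarrow> rat \<Rightarrow> ('v, 'a) fm" where
  "PrEq \<alpha> \<epsilon> = And (PrGe \<alpha> \<epsilon>) (PrLe \<alpha> \<epsilon>)"

definition PrNe :: "('v, 'a) fm \<Rightarrow> rat \<Rightarrow> ('v, 'a) fm" where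
  "PrNe \<alpha> \<epsilon> = Or (PrGt \<alpha> \<epsilon>) (PrLt \<alpha> \<epsilon>)"

text \<open>Weak contradictory negation. A counterfactual with inconsistent antecedent is vacuously
  true, and so would be the result of pushing the negation to its consequent; to remain a
  negation on nonempty causal multiteams it has to be sent to \<^term>\<open>falsum\<close> instead.\<close>

primrec wneg :: "('v, 'a) fm \<Rightarrow> ('v, 'a) fm" where
  "wneg (Eq X x) = PrLt (Eq X x) 1"
| "wneg (Neq X x) = PrLt (Neq X x) 1"
| "wneg (PrGe \<alpha> \<epsilon>) = PrLt \<alpha> \<epsilon>"
| "wneg (PrGt \<alpha> \<epsilon>) = PrLe \<alpha> \<epsilon>"
| "wneg (PrGeP \<alpha> \<beta>) = PrGtP \<beta> \<alpha>"
| "wneg (PrGtP \<alpha> \<beta>) = PrGeP \<beta> \<alpha>"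
| "wneg (And \<phi> \<psi>) = Or (wneg \<phi>) (wneg \<psi>)"
| "wneg (Or \<phi> \<psi>) = And (wneg \<phi>) (wneg \<psi>)"
| "wneg (Imp \<alpha> \<phi>) = And (PrGt \<alpha> 0) (Imp \<alpha> (wneg \<phi>))"
| "wneg (Cf E \<phi>) =
     (if Cf E \<phi> = falsum then verum else if consistent E then Cf E (wneg \<phi>) else falsum)"

definition imp :: "('v, 'a) fm \<Rightarrow> ('v, 'a) fm \<Rightarrow> ('v, 'a) fm" where
  "imp \<phi> \<psi> = Or (wneg \<phi>) \<psi>"

definition iff :: "('v, 'a) fm \<Rightarrow> ('v, 'a) fm \<Rightarrow> ('v, 'a) fm" where
  "iff \<phi> \<psi> = And (imp \<phi> \<psi>) (imp \<psi> \<phi>)"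

definition eqs_fm :: "('v \<times> 'a) list \<Rightarrow> ('v, 'a) fm" where
  "eqs_fm xs = big And verum (map (\<lambda>(X, x). Eq X x) xs)"

definition neqs_fm :: "('v \<times> 'a) list \<Rightarrow> ('v, 'a) fm" where
  "neqs_fm xs = big disj falsum (map (\<lambda>(X, x). Neq X x) xs)"

text \<open>\<open>dep Zs X Y\<close> is the part for fixed \<open>Z\<close> of both \<open>X \<leadsto> Y\<close> and
  \<open>\<phi>_DC(X,Y)\<close>: a list of disjuncts. In \<open>affects\<close>, the set \<open>Z\<close> must not contain \<open>X\<close>, since
  otherwise \<open>Z = z \<and> X = x\<close> and \<open>Z = z \<and> X = x'\<close> could not both be consistent.\<close>

definition dep :: "'v list \<Rightarrow> 'v \<Rightarrow> 'v \<Rightarrow> ('v, 'a) fm list" where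
  "dep Zs X Y =
     [And (Cf (set (zip Zs zs) \<union> {(X, x)}) (Eq Y y))
          (Cf (set (zip Zs zs) \<union> {(X, x')}) (Eq Y y')).
        zs \<leftarrow> tuples \<sigma> Zs, x \<leftarrow> vals \<sigma> X, x' \<leftarrow> vals \<sigma> X, x \<noteq> x',
        y \<leftarrow> vals \<sigma> Y, y' \<leftarrow> vals \<sigma> Y, y \<noteq> y']"

definition affects :: "'v \<Rightarrow> 'v \<Rightarrow> ('v, 'a) fm" where
  "affects X Y = big disj falsum
     (concat (map (\<lambda>Zs. dep Zs X Y) (subseqs [Z \<leftarrow> vars \<sigma>. Z \<noteq> X])))"

definition phi_DC :: "'v \<Rightarrow> 'v \<Rightarrow> ('v, 'a) fm" where
  "phi_DC X Y = big disj falsum (dep [Z \<leftarrow> vars \<sigma>. Z \<noteq> X \<and> Z \<noteq> Y] X Y)"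

definition phi_End :: "'v \<Rightarrow> ('v, 'a) fm" where
  "phi_End Y = big Or falsum [phi_DC X Y. X \<leftarrow> vars \<sigma>, X \<noteq> Y]"

end


section \<open>The deduction system\<close>

text \<open>Propositional schemas for the two kinds of tautologies.\<close>

datatype pform = PVar nat | PTop | PBot | PNot pform
  | PAnd pform pform | POr pform pform | PImp pform pform

primrec peval :: "(nat \<Rightarrow> bool) \<Rightarrow> pform \<Rightarrow> bool" where
  "peval v (PVar n) \<longleftrightarrow> v n"
| "peval v PTop \<longleftrightarrow> True"
| "peval v PBot \<longleftrightarrow> False"
| "peval v (PNot p) \<longleftrightarrow> \<not> peval v p"
| "peval v (PAnd p q) \<longleftrightarrow> peval v p \<and> peval v q"
| "peval v (POr p q) \<longleftrightarrow> peval v p \<or> peval v q"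
| "peval v (PImp p q) \<longleftrightarrow> (peval v p \<longrightarrow> peval v q)"

definition tautology :: "pform \<Rightarrow> bool" where
  "tautology p \<longleftrightarrow> (\<forall>v. peval v p)"

primrec inst_PCO :: "('v, 'a) signature \<Rightarrow> (nat \<Rightarrow> ('v, 'a) fm) \<Rightarrow> pform \<Rightarrow> ('v, 'a) fm" where
  "inst_PCO \<sigma> g (PVar n) = g n"
| "inst_PCO \<sigma> g PTop = verum \<sigma>"
| "inst_PCO \<sigma> g PBot = falsum \<sigma>"
| "inst_PCO \<sigma> g (PNot p) = wneg \<sigma> (inst_PCO \<sigma> g p)"
| "inst_PCO \<sigma> g (PAnd p q) = And (inst_PCO \<sigma> g p) (inst_PCO \<sigma> g q)"
| "inst_PCO \<sigma> g (POr p q) = Or (inst_PCO \<sigma> g p) (inst_PCO \<sigma> g q)"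
| "inst_PCO \<sigma> g (PImp p q) = imp \<sigma> (inst_PCO \<sigma> g p) (inst_PCO \<sigma> g q)"

primrec inst_CO :: "('v, 'a) signature \<Rightarrow> (nat \<Rightarrow> ('v, 'a) fm) \<Rightarrow> pform \<Rightarrow> ('v, 'a) fm" where
  "inst_CO \<sigma> g (PVar n) = g n"
| "inst_CO \<sigma> g PTop = verum \<sigma>"
| "inst_CO \<sigma> g PBot = falsum \<sigma>"
| "inst_CO \<sigma> g (PNot p) = neg \<sigma> (inst_CO \<sigma> g p)"
| "inst_CO \<sigma> g (PAnd p q) = And (inst_CO \<sigma> g p) (inst_CO \<sigma> g q)"
| "inst_CO \<sigma> g (POr p q) = disj \<sigma> (inst_CO \<sigma> g p) (inst_CO \<sigma> g q)"
| "inst_CO \<sigma> g (PImp p q) = Imp (inst_CO \<sigma> g p) (inst_CO \<sigma> g q)"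

text \<open>Replacement of all occurrences of \<open>\<theta>\<close> by \<open>\<theta>'\<close>, also inside probability atoms and
  antecedents of \<open>\<supset>\<close>.\<close>

primrec replace :: "('v, 'a) fm \<Rightarrow> ('v, 'a) fm \<Rightarrow> ('v, 'a) fm \<Rightarrow> ('v, 'a) fm" where
  "replace \<theta> \<theta>' (Eq X x) = (if Eq X x = \<theta> then \<theta>' else Eq X x)"
| "replace \<theta> \<theta>' (Neq X x) = (if Neq X x = \<theta> then \<theta>' else Neq X x)"
| "replace \<theta> \<theta>' (PrGe \<alpha> \<epsilon>) =
     (if PrGe \<alpha> \<epsilon> = \<theta> then \<theta>' else PrGe (replace \<theta> \<theta>' \<alpha>) \<epsilon>)"
| "replace \<theta> \<theta>' (PrGt \<alpha> \<epsilon>) =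
     (if PrGt \<alpha> \<epsilon> = \<theta> then \<theta>' else PrGt (replace \<theta> \<theta>' \<alpha>) \<epsilon>)"
| "replace \<theta> \<theta>' (PrGeP \<alpha> \<beta>) =
     (if PrGeP \<alpha> \<beta> = \<theta> then \<theta>' else PrGeP (replace \<theta> \<theta>' \<alpha>) (replace \<theta> \<theta>' \<beta>))"
| "replace \<theta> \<theta>' (PrGtP \<alpha> \<beta>) =
     (if PrGtP \<alpha> \<beta> = \<theta> then \<theta>' else PrGtP (replace \<theta> \<theta>' \<alpha>) (replace \<theta> \<theta>' \<beta>))"
| "replace \<theta> \<theta>' (And \<phi> \<psi>) =
     (if And \<phi> \<psi> = \<theta> then \<theta>' else And (replace \<theta> \<theta>' \<phi>) (replace \<theta> \<theta>' \<psi>))"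
| "replace \<theta> \<theta>' (Or \<phi> \<psi>) =
     (if Or \<phi> \<psi> = \<theta> then \<theta>' else Or (replace \<theta> \<theta>' \<phi>) (replace \<theta> \<theta>' \<psi>))"
| "replace \<theta> \<theta>' (Imp \<alpha> \<phi>) =
     (if Imp \<alpha> \<phi> = \<theta> then \<theta>' else Imp (replace \<theta> \<theta>' \<alpha>) (replace \<theta> \<theta>' \<phi>))"
| "replace \<theta> \<theta>' (Cf E \<phi>) =
     (if Cf E \<phi> = \<theta> then \<theta>' else Cf E (replace \<theta> \<theta>' \<phi>))"

primrec cf_free :: "('v, 'a) fm \<Rightarrow> bool" where
  "cf_free (Eq X x) \<longleftrightarrow> True"
| "cf_free (Neq X x) \<longleftrightarrow> True"
| "cf_free (PrGe \<alpha> \<epsilon>) \<longleftrightarrow> cf_free \<alpha>"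
| "cf_free (PrGt \<alpha> \<epsilon>) \<longleftrightarrow> cf_free \<alpha>"
| "cf_free (PrGeP \<alpha> \<beta>) \<longleftrightarrow> cf_free \<alpha> \<and> cf_free \<beta>"
| "cf_free (PrGtP \<alpha> \<beta>) \<longleftrightarrow> cf_free \<alpha> \<and> cf_free \<beta>"
| "cf_free (And \<phi> \<psi>) \<longleftrightarrow> cf_free \<phi> \<and> cf_free \<psi>"
| "cf_free (Or \<phi> \<psi>) \<longleftrightarrow> cf_free \<phi> \<and> cf_free \<psi>"
| "cf_free (Imp \<alpha> \<phi>) \<longleftrightarrow> cf_free \<alpha> \<and> cf_free \<phi>"
| "cf_free (Cf E \<phi>) \<longleftrightarrow> False"

text \<open>The consistency side conditions of \<open>C4b\<close>, \<open>C8\<close>, \<open>C8b\<close> and the distinctness condition of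
  \<open>C11\<close> exclude degenerate instances, some of which are not valid. For example, if
  \<open>X = x \<and> X = x'\<close> is inconsistent, then \<open>(X = x \<and> X = x') \<box>\<rightarrow> \<chi>\<close> is vacuously true, whereas
  \<open>X = x \<box>\<rightarrow> (X = x' \<box>\<rightarrow> \<chi>)\<close> need not be; and \<open>X \<leadsto> X\<close> is valid when \<open>X\<close> has two values.\<close>

inductive axiom :: "('v, 'a) signature \<Rightarrow> ('v, 'a) fm \<Rightarrow> bool" for \<sigma> where
  T1: "tautology p \<Longrightarrow> (\<And>n. g n \<in> PCO \<sigma>) \<Longrightarrow> axiom \<sigma> (inst_PCO \<sigma> g p)"
| T2: "tautology p \<Longrightarrow> (\<And>n. g n \<in> CO \<sigma>) \<Longrightarrow> axiom \<sigma> (inst_CO \<sigma> g p)"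
| P1: "\<alpha> \<in> CO \<sigma> \<Longrightarrow> axiom \<sigma> (iff \<sigma> \<alpha> (PrEq \<sigma> \<alpha> 1))"
| P2: "\<alpha> \<in> CO \<sigma> \<Longrightarrow> axiom \<sigma> (PrGe \<alpha> 0)"
| P3: "\<alpha> \<in> CO \<sigma> \<Longrightarrow> \<beta> \<in> CO \<sigma> \<Longrightarrow> 0 \<le> \<delta> \<Longrightarrow> 0 \<le> \<epsilon> \<Longrightarrow> \<delta> + \<epsilon> \<le> 1 \<Longrightarrow>
    axiom \<sigma> (imp \<sigma> (And (And (PrEq \<sigma> \<alpha> \<delta>) (PrEq \<sigma> \<beta> \<epsilon>)) (PrEq \<sigma> (And \<alpha> \<beta>) 0))
                   (PrEq \<sigma> (disj \<sigma> \<alpha> \<beta>) (\<delta> + \<epsilon>)))"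
| P3b: "\<alpha> \<in> CO \<sigma> \<Longrightarrow> \<beta> \<in> CO \<sigma> \<Longrightarrow> 0 \<le> \<epsilon> \<Longrightarrow> \<epsilon> \<le> 1 \<Longrightarrow>
    axiom \<sigma> (imp \<sigma> (And (PrGe \<alpha> \<epsilon>) (PrEq \<sigma> (And \<alpha> \<beta>) 0)) (PrLe \<sigma> \<beta> (1 - \<epsilon>)))"
| P4: "\<alpha> \<in> CO \<sigma> \<Longrightarrow> 0 \<le> \<epsilon> \<Longrightarrow> \<epsilon> < \<delta> \<Longrightarrow> \<delta> \<le> 1 \<Longrightarrow>
    axiom \<sigma> (imp \<sigma> (PrLe \<sigma> \<alpha> \<epsilon>) (PrLt \<sigma> \<alpha> \<delta>))"
| P5: "\<alpha> \<in> CO \<sigma> \<Longrightarrow> 0 \<le> \<epsilon> \<Longrightarrow> \<epsilon> \<le> 1 \<Longrightarrow>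
    axiom \<sigma> (imp \<sigma> (PrLt \<sigma> \<alpha> \<epsilon>) (PrLe \<sigma> \<alpha> \<epsilon>))"
| P6: "\<alpha> \<in> CO \<sigma> \<Longrightarrow> \<beta> \<in> CO \<sigma> \<Longrightarrow> 0 \<le> \<epsilon> \<Longrightarrow> \<epsilon> \<le> 1 \<Longrightarrow>
    axiom \<sigma> (imp \<sigma> (PrEq \<sigma> (equi \<alpha> \<beta>) 1) (imp \<sigma> (PrEq \<sigma> \<alpha> \<epsilon>) (PrEq \<sigma> \<beta> \<epsilon>)))"
| P6b: "\<alpha> \<in> CO \<sigma> \<Longrightarrow> \<beta> \<in> CO \<sigma> \<Longrightarrow> 0 \<le> \<epsilon> \<Longrightarrow> \<epsilon> \<le> 1 \<Longrightarrow>
    axiom \<sigma> (imp \<sigma> (PrEq \<sigma> (Imp \<alpha> \<beta>) 1) (imp \<sigma> (PrEq \<sigma> \<alpha> \<epsilon>) (PrGe \<beta> \<epsilon>)))"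
| CP1: "\<alpha> \<in> CO \<sigma> \<Longrightarrow> \<beta> \<in> CO \<sigma> \<Longrightarrow> 0 \<le> \<epsilon> \<Longrightarrow> \<epsilon> \<le> \<delta> \<Longrightarrow> \<delta> \<le> 1 \<Longrightarrow>
    axiom \<sigma> (imp \<sigma> (And (PrEq \<sigma> \<alpha> \<delta>) (PrEq \<sigma> \<beta> \<epsilon>)) (PrGeP \<alpha> \<beta>))"
| CP2: "\<alpha> \<in> CO \<sigma> \<Longrightarrow> \<beta> \<in> CO \<sigma> \<Longrightarrow> 0 \<le> \<epsilon> \<Longrightarrow> \<epsilon> < \<delta> \<Longrightarrow> \<delta> \<le> 1 \<Longrightarrow>
    axiom \<sigma> (imp \<sigma> (And (PrEq \<sigma> \<alpha> \<delta>) (PrEq \<sigma> \<beta> \<epsilon>)) (PrGtP \<alpha> \<beta>))"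
| O1: "\<alpha> \<in> CO \<sigma> \<Longrightarrow> \<psi> \<in> PCO \<sigma> \<Longrightarrow> axiom \<sigma> (imp \<sigma> (PrEq \<sigma> \<alpha> 0) (Imp \<alpha> \<psi>))"
| O1b: "\<alpha> \<in> CO \<sigma> \<Longrightarrow> axiom \<sigma> (imp \<sigma> (Imp \<alpha> (falsum \<sigma>)) (PrEq \<sigma> \<alpha> 0))"
| O2: "\<alpha> \<in> CO \<sigma> \<Longrightarrow> \<beta> \<in> CO \<sigma> \<Longrightarrow> 0 \<le> \<epsilon> \<Longrightarrow> \<epsilon> \<le> \<delta> \<Longrightarrow> \<delta> \<noteq> 0 \<Longrightarrow> \<delta> \<le> 1 \<Longrightarrow>
    axiom \<sigma> (imp \<sigma> (And (PrEq \<sigma> \<alpha> \<delta>) (PrEq \<sigma> (And \<alpha> \<beta>) \<epsilon>)) (Imp \<alpha> (PrEq \<sigma> \<beta> (\<epsilon> / \<delta>))))"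
| O3: "\<alpha> \<in> CO \<sigma> \<Longrightarrow> \<beta> \<in> CO \<sigma> \<Longrightarrow> 0 \<le> \<epsilon> \<Longrightarrow> \<epsilon> \<le> 1 \<Longrightarrow> \<epsilon> \<noteq> 0 \<Longrightarrow> 0 \<le> \<delta> \<Longrightarrow> \<delta> \<le> 1 \<Longrightarrow>
    axiom \<sigma> (imp \<sigma> (Imp \<alpha> (PrEq \<sigma> \<beta> \<epsilon>))
                   (iff \<sigma> (PrEq \<sigma> \<alpha> \<delta>) (PrEq \<sigma> (And \<alpha> \<beta>) (\<epsilon> * \<delta>))))"
| O4: "\<alpha> \<in> CO \<sigma> \<Longrightarrow> \<psi> \<in> PCO \<sigma> \<Longrightarrow> axiom \<sigma> (imp \<sigma> (Imp \<alpha> \<psi>) (imp \<sigma> \<alpha> \<psi>))"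
| O5_And: "\<alpha> \<in> CO \<sigma> \<Longrightarrow> \<psi> \<in> PCO \<sigma> \<Longrightarrow> \<chi> \<in> PCO \<sigma> \<Longrightarrow>
    axiom \<sigma> (iff \<sigma> (Imp \<alpha> (And \<psi> \<chi>)) (And (Imp \<alpha> \<psi>) (Imp \<alpha> \<chi>)))"
| O5_Or: "\<alpha> \<in> CO \<sigma> \<Longrightarrow> \<psi> \<in> PCO \<sigma> \<Longrightarrow> \<chi> \<in> PCO \<sigma> \<Longrightarrow>
    axiom \<sigma> (iff \<sigma> (Imp \<alpha> (Or \<psi> \<chi>)) (Or (Imp \<alpha> \<psi>) (Imp \<alpha> \<chi>)))"
| O5_Imp: "\<alpha> \<in> CO \<sigma> \<Longrightarrow> \<beta> \<in> CO \<sigma> \<Longrightarrow> \<chi> \<in> PCO \<sigma> \<Longrightarrow>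
    axiom \<sigma> (iff \<sigma> (Imp \<alpha> (Imp \<beta> \<chi>)) (Imp (And \<alpha> \<beta>) \<chi>))"
| A1: "set Ys \<subseteq> Dom \<sigma> \<Longrightarrow> ys \<in> set (tuples \<sigma> Ys) \<Longrightarrow> ys' \<in> set (tuples \<sigma> Ys) \<Longrightarrow> ys \<noteq> ys' \<Longrightarrow>
    axiom \<sigma> (imp \<sigma> (eqs_fm \<sigma> (zip Ys ys)) (neqs_fm \<sigma> (zip Ys ys')))"
| A2: "X \<in> Dom \<sigma> \<Longrightarrow> x \<in> Ran \<sigma> X \<Longrightarrow> axiom \<sigma> (iff \<sigma> (Neq X x) (Imp (Eq X x) (falsum \<sigma>)))"
| A3: "set Ys \<subseteq> Dom \<sigma> \<Longrightarrow>
    axiom \<sigma> (big (disj \<sigma>) (falsum \<sigma>) [eqs_fm \<sigma> (zip Ys ys). ys \<leftarrow> tuples \<sigma> Ys])"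
| C1: "is_eqs \<sigma> E \<Longrightarrow> \<psi> \<in> PCO \<sigma> \<Longrightarrow> \<chi> \<in> PCO \<sigma> \<Longrightarrow>
    axiom \<sigma> (iff \<sigma> (Cf E (And \<psi> \<chi>)) (And (Cf E \<psi>) (Cf E \<chi>)))"
| C2: "is_eqs \<sigma> E \<Longrightarrow> \<psi> \<in> PCO \<sigma> \<Longrightarrow> \<chi> \<in> PCO \<sigma> \<Longrightarrow>
    axiom \<sigma> (iff \<sigma> (Cf E (Or \<psi> \<chi>)) (Or (Cf E \<psi>) (Cf E \<chi>)))"
| C3: "is_eqs \<sigma> E \<Longrightarrow> \<alpha> \<in> CO \<sigma> \<Longrightarrow> \<chi> \<in> PCO \<sigma> \<Longrightarrow>
    axiom \<sigma> (iff \<sigma> (Cf E (Imp \<alpha> \<chi>)) (Imp (Cf E \<alpha>) (Cf E \<chi>)))"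
| C4: "is_eqs \<sigma> E \<Longrightarrow> is_eqs \<sigma> D \<Longrightarrow> \<chi> \<in> PCO \<sigma> \<Longrightarrow> consistent E \<Longrightarrow>
    axiom \<sigma> (iff \<sigma> (Cf E (Cf D \<chi>)) (Cf ({(X, x)\<in>E. X \<notin> fst ` D} \<union> D) \<chi>))"
| C4b: "is_eqs \<sigma> E \<Longrightarrow> is_eqs \<sigma> D \<Longrightarrow> \<chi> \<in> PCO \<sigma> \<Longrightarrow> consistent (E \<union> D) \<Longrightarrow>
    axiom \<sigma> (imp \<sigma> (Cf (E \<union> D) \<chi>) (Cf E (Cf D \<chi>)))"
| C5: "is_eqs \<sigma> E \<Longrightarrow> \<psi> \<in> PCO \<sigma> \<Longrightarrow> consistent E \<Longrightarrow>
    axiom \<sigma> (imp \<sigma> (Cf E (falsum \<sigma>)) \<psi>)"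
| C6: "is_eqs \<sigma> E \<Longrightarrow> Y \<in> Dom \<sigma> \<Longrightarrow> y \<in> Ran \<sigma> Y \<Longrightarrow>
    axiom \<sigma> (Cf (E \<union> {(Y, y)}) (Eq Y y))"
| C7: "is_eqs \<sigma> (set xs) \<Longrightarrow> \<gamma> \<in> PCO \<sigma> \<Longrightarrow> cf_free \<gamma> \<Longrightarrow>
    axiom \<sigma> (imp \<sigma> (And (eqs_fm \<sigma> xs) \<gamma>) (Cf (set xs) \<gamma>))"
| C8_ge: "is_eqs \<sigma> E \<Longrightarrow> consistent E \<Longrightarrow> \<alpha> \<in> CO \<sigma> \<Longrightarrow> 0 \<le> \<epsilon> \<Longrightarrow> \<epsilon> \<le> 1 \<Longrightarrow>
    axiom \<sigma> (iff \<sigma> (Cf E (PrGe \<alpha> \<epsilon>)) (PrGe (Cf E \<alpha>) \<epsilon>))"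
| C8_gt: "is_eqs \<sigma> E \<Longrightarrow> consistent E \<Longrightarrow> \<alpha> \<in> CO \<sigma> \<Longrightarrow> 0 \<le> \<epsilon> \<Longrightarrow> \<epsilon> \<le> 1 \<Longrightarrow>
    axiom \<sigma> (iff \<sigma> (Cf E (PrGt \<alpha> \<epsilon>)) (PrGt (Cf E \<alpha>) \<epsilon>))"
| C8b_ge: "is_eqs \<sigma> E \<Longrightarrow> consistent E \<Longrightarrow> \<alpha> \<in> CO \<sigma> \<Longrightarrow> \<beta> \<in> CO \<sigma> \<Longrightarrow>
    axiom \<sigma> (iff \<sigma> (Cf E (PrGeP \<alpha> \<beta>)) (PrGeP (Cf E \<alpha>) (Cf E \<beta>)))"
| C8b_gt: "is_eqs \<sigma> E \<Longrightarrow> consistent E \<Longrightarrow> \<alpha> \<in> CO \<sigma> \<Longrightarrow> \<beta> \<in> CO \<sigma> \<Longrightarrow>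
    axiom \<sigma> (iff \<sigma> (Cf E (PrGtP \<alpha> \<beta>)) (PrGtP (Cf E \<alpha>) (Cf E \<beta>)))"
| C9: "Y \<in> Dom \<sigma> \<Longrightarrow> w \<in> assigns \<sigma> (others \<sigma> Y) \<Longrightarrow>
    axiom \<sigma> (imp \<sigma> (phi_End \<sigma> Y)
      (Cf (eqs_of w (others \<sigma> Y)) (big Or (falsum \<sigma>) [Eq Y y. y \<leftarrow> vals \<sigma> Y])))"
| C10: "Y \<in> Dom \<sigma> \<Longrightarrow> y \<in> Ran \<sigma> Y \<Longrightarrow> w \<in> assigns \<sigma> (others \<sigma> Y) \<Longrightarrow>
    axiom \<sigma> (imp \<sigma> (wneg \<sigma> (phi_End \<sigma> Y))
      (Imp (Eq Y y) (Cf (eqs_of w (others \<sigma> Y)) (Eq Y y))))"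
| C11: "set Xs \<subseteq> Dom \<sigma> \<Longrightarrow> distinct Xs \<Longrightarrow> length Xs > 1 \<Longrightarrow>
    axiom \<sigma> (imp \<sigma>
      (big And (verum \<sigma>) [affects \<sigma> (Xs ! i) (Xs ! Suc i). i \<leftarrow> [0..<length Xs - 1]])
      (wneg \<sigma> (affects \<sigma> (last Xs) (hd Xs))))"

text \<open>\<open>rule \<sigma> P \<phi>\<close>: the formula \<open>\<phi>\<close> follows by a rule from premises in the set \<open>P\<close>.\<close>

inductive rule :: "('v, 'a) signature \<Rightarrow> ('v, 'a) fm set \<Rightarrow> ('v, 'a) fm \<Rightarrow> bool" for \<sigma> P where
  MP: "\<psi> \<in> P \<Longrightarrow> imp \<sigma> \<psi> \<chi> \<in> P \<Longrightarrow> rule \<sigma> P \<chi>"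
| Bot_omega: "\<psi> \<in> PCO \<sigma> \<Longrightarrow> \<alpha> \<in> CO \<sigma> \<Longrightarrow>
    (\<And>\<epsilon>. 0 \<le> \<epsilon> \<Longrightarrow> \<epsilon> \<le> 1 \<Longrightarrow> imp \<sigma> \<psi> (PrNe \<sigma> \<alpha> \<epsilon>) \<in> P) \<Longrightarrow>
    rule \<sigma> P (imp \<sigma> \<psi> (falsum \<sigma>))"
| Imp_omega: "\<psi> \<in> PCO \<sigma> \<Longrightarrow> \<alpha> \<in> CO \<sigma> \<Longrightarrow> \<beta> \<in> CO \<sigma> \<Longrightarrow> 0 \<le> \<delta> \<Longrightarrow> \<delta> \<le> 1 \<Longrightarrow>
    (\<And>\<epsilon>. 0 < \<epsilon> \<Longrightarrow> \<epsilon> \<le> 1 \<Longrightarrow>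
       imp \<sigma> \<psi> (iff \<sigma> (PrEq \<sigma> (And \<alpha> \<beta>) (\<delta> * \<epsilon>)) (PrEq \<sigma> \<alpha> \<epsilon>)) \<in> P) \<Longrightarrow>
    rule \<sigma> P (imp \<sigma> \<psi> (Imp \<alpha> (PrEq \<sigma> \<beta> \<delta>)))"

text \<open>The rules whose premises have to be theorems.\<close>

inductive thm_rule :: "('v, 'a) signature \<Rightarrow> ('v, 'a) fm set \<Rightarrow> ('v, 'a) fm \<Rightarrow> bool"
  for \<sigma> P where
  Rep: "\<phi> \<in> P \<Longrightarrow> \<theta> \<in> PCO \<sigma> \<Longrightarrow> \<theta>' \<in> PCO \<sigma> \<Longrightarrow> iff \<sigma> \<theta> \<theta>' \<in> P \<Longrightarrow>
    replace \<theta> \<theta>' \<phi> \<in> PCO \<sigma> \<Longrightarrow> thm_rule \<sigma> P (replace \<theta> \<theta>' \<phi>)"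
| Mon_Imp: "\<alpha> \<in> CO \<sigma> \<Longrightarrow> \<psi> \<in> PCO \<sigma> \<Longrightarrow> \<chi> \<in> PCO \<sigma> \<Longrightarrow> imp \<sigma> \<psi> \<chi> \<in> P \<Longrightarrow>
    thm_rule \<sigma> P (imp \<sigma> (Imp \<alpha> \<psi>) (Imp \<alpha> \<chi>))"
| To_Imp: "\<alpha> \<in> CO \<sigma> \<Longrightarrow> \<psi> \<in> PCO \<sigma> \<Longrightarrow> imp \<sigma> \<alpha> \<psi> \<in> P \<Longrightarrow> thm_rule \<sigma> P (Imp \<alpha> \<psi>)"
| Mon_Cf: "is_eqs \<sigma> E \<Longrightarrow> \<psi> \<in> PCO \<sigma> \<Longrightarrow> \<chi> \<in> PCO \<sigma> \<Longrightarrow> imp \<sigma> \<psi> \<chi> \<in> P \<Longrightarrow>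
    thm_rule \<sigma> P (imp \<sigma> (Cf E \<psi>) (Cf E \<chi>))"

text \<open>\<open>proof_seq S J r f m\<close>: the family \<open>f\<close> of formulas in \<open>S\<close>, indexed by the well-order \<open>r\<close> on a
  subset of \<^typ>\<open>nat\<close> (every countable ordinal arises this way), has final index \<open>m\<close> and each
  item is justified by \<open>J\<close> from the set of earlier items.\<close>

definition proof_seq ::
  "'f set \<Rightarrow> ('f set \<Rightarrow> 'f \<Rightarrow> bool) \<Rightarrow> nat rel \<Rightarrow> (nat \<Rightarrow> 'f) \<Rightarrow> nat \<Rightarrow> bool" where
  "proof_seq S J r f m \<longleftrightarrow>
     Well_order r \<and> m \<in> Field r \<and> (\<forall>i\<in>Field r. (i, m) \<in> r) \<and>
     (\<forall>i\<in>Field r. f i \<in> S \<and> J (f ` underS r i) (f i))"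

definition provable :: "('v, 'a) signature \<Rightarrow> ('v, 'a) fm \<Rightarrow> bool" where
  "provable \<sigma> \<phi> \<longleftrightarrow> (\<exists>r f m. f m = \<phi> \<and>
     proof_seq (PCO \<sigma>) (\<lambda>P \<psi>. axiom \<sigma> \<psi> \<or> rule \<sigma> P \<psi> \<or> thm_rule \<sigma> P \<psi>) r f m)"

definition derivable ::
  "('v, 'a) signature \<Rightarrow> ('v, 'a) fm set \<Rightarrow> ('v, 'a) fm \<Rightarrow> bool" where
  "derivable \<sigma> \<Gamma> \<phi> \<longleftrightarrow> (\<exists>r f m. f m = \<phi> \<and>
     proof_seq (PCO \<sigma>) (\<lambda>P \<psi>. axiom \<sigma> \<psi> \<or> \<psi> \<in> \<Gamma> \<or> rule \<sigma> P \<psi> \<or>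
       thm_rule \<sigma> (P \<inter> {\<theta>. provable \<sigma> \<theta>}) \<psi>) r f m)"

end

theory Submission
  imports Defs "HOL-Library.Countable_Set" "HOL-Library.Extended_Nat"
begin

text \<open>A formula that is not derivable from \<open>\<Gamma>\<close> is refuted in a causal multiteam read off a complete
  theory \<open>\<Delta> \<supseteq> \<Gamma>\<close>: a prime, consistent set of formulas closed under modus ponens which assigns
  to each formula \<open>\<alpha>\<close> of \<open>CO\<close> a rational probability. The infinitary rule for \<open>\<bottom>\<close> is exactly what
  makes it possible to pick these probabilities one by one in the Lindenbaum construction; closure
  of \<open>\<Delta>\<close> under the infinitary rules is not needed. Complete theories are stable under conditioning,
  \<open>\<Delta> \<mapsto> {\<phi>. \<alpha> \<supset> \<phi> \<in> \<Delta>}\<close> for \<open>\<alpha>\<close> of positive probability, and under intervention,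
  \<open>\<Delta> \<mapsto> {\<phi>. E \<box>\<rightarrow> \<phi> \<in> \<Delta>}\<close>, which match observation and intervention on multiteams.
  The axioms \<open>C9\<close>--\<open>C11\<close> let \<open>\<Delta>\<close> determine a recursive system of structural functions, and the
  multiplicity of an assignment is proportional to its probability in \<open>\<Delta>\<close>.\<close>

section \<open>Proof sequences and inductive closure\<close>

text \<open>The main obstacle is that a complete theory \<Delta> is prime for \<open>Or\<close> and
  \<open>wneg\<close>, not for \<open>disj\<close> and \<open>neg\<close>: a formula of
  \<open>CO\<close> lies in \<Delta> iff its probability is 1, and its \<open>neg\<close> iff it is
  0, so a value in between leaves both outside. Formulas of \<open>CO\<close> are decided only after
  conditioning on a single state, and arguments by cases take place there. What is common to all
  states, such as the structural functions, comes from \<open>phi_End\<close> and \<open>C9\<close>,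
  whose outer disjunctions are \<open>Or\<close>. Solutions of the structural equations after an
  intervention are not built by recursion along the causal graph: the intervened theory gives some
  state positive probability, this state is a solution, and acyclicity makes it the only one. On the
  proof-theoretic side, ordinal-indexed sequences are traded for an inductive closure with
  infinitely branching steps; the way back needs a countable language, so that proofs of all
  premises can be strung along one countable well-order.\<close>

inductive_set jclosure :: "'f set \<Rightarrow> ('f set \<Rightarrow> 'f \<Rightarrow> bool) \<Rightarrow> 'f set"
  for S :: "'f set" and J :: "'f set \<Rightarrow> 'f \<Rightarrow> bool" where
  step: "\<forall>y\<in>P. y \<in> jclosure S J \<Longrightarrow> J P x \<Longrightarrow> x \<in> S \<Longrightarrow> x \<in> jclosure S J"

lemma proof_seq_imp_jclosure:
  assumes "proof_seq S J r f m"
  shows "f m \<in> jclosure S J"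
proof -
  have wf: "wf (r - Id)" using assms by (simp add: proof_seq_def well_order_on_def)
  have "i \<in> Field r \<longrightarrow> f i \<in> jclosure S J" for i
  proof (induction i rule: wf_induct_rule[OF wf])
    case (1 i)
    show ?case
    proof
      assume i: "i \<in> Field r"
      have "\<forall>y\<in>f ` underS r i. y \<in> jclosure S J"
        using 1 by (auto simp: underS_def Field_def)
      with assms i show "f i \<in> jclosure S J"
        by (intro jclosure.step[of "f ` underS r i"]) (auto simp: proof_seq_def)
    qed
  qed
  with assms show ?thesis by (simp add: proof_seq_def)
qed

text \<open>Concatenation of the well-orders \<open>r k\<close> along K. It serves to string proofs
  of all premises together, one block per premise, with the conclusion as the last block.\<close>

definition lex_sum :: "'k::wellorder set \<Rightarrow> ('k \<Rightarrow> 'i rel) \<Rightarrow> ('k \<times> 'i) rel" where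
  "lex_sum K r = {((k, i), (l, j)). k \<in> K \<and> l \<in> K \<and> i \<in> Field (r k) \<and> j \<in> Field (r l) \<and>
     (k < l \<or> k = l \<and> (i, j) \<in> r k)}"

lemma Field_lex_sum:
  assumes "\<And>k. k \<in> K \<Longrightarrow> Well_order (r k)"
  shows "Field (lex_sum K r) = Sigma K (\<lambda>k. Field (r k))"
proof -
  have "(i, i) \<in> r k" if "k \<in> K" "i \<in> Field (r k)" for k i
    using assms[OF that(1)] that(2)
    by (auto simp: well_order_on_def linear_order_on_def partial_order_on_def preorder_on_def refl_on_def)
  then show ?thesis by (fastforce simp: lex_sum_def Field_def)
qed

lemma Well_order_lex_sum:
  assumes wo: "\<And>k. k \<in> K \<Longrightarrow> Well_order (r k)"
  shows "Well_order (lex_sum K r)"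
proof -
  let ?L = "lex_sum K r"
  have tr: "trans (r k)" and an: "antisym (r k)" and re: "refl_on (Field (r k)) (r k)"
    and to: "total_on (Field (r k)) (r k)" and wf: "wf (r k - Id)" if "k \<in> K" for k
    using wo[OF that]
    by (auto simp: well_order_on_def linear_order_on_def partial_order_on_def preorder_on_def)
  have F: "Field ?L = Sigma K (\<lambda>k. Field (r k))" by (rule Field_lex_sum[OF wo])
  have "refl_on (Field ?L) ?L"
    unfolding F using re by (auto simp: refl_on_def lex_sum_def)
  moreover have "trans ?L"
  proof (rule transI)
    fix x y z assume "(x, y) \<in> ?L" "(y, z) \<in> ?L"
    then show "(x, z) \<in> ?L"
      by (auto simp: lex_sum_def dest: tr[THEN transD] less_trans)
  qed
  moreover have "antisym ?L"
    by (rule antisymI) (auto simp: lex_sum_def dest: an[THEN antisymD])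
  moreover have "total_on (Field ?L) ?L"
    unfolding F using to by (fastforce simp: total_on_def lex_sum_def)
  moreover have "wf (?L - Id)"
  proof (rule wfI_pf)
    fix A assume A: "A \<subseteq> (?L - Id) `` A"
    \<comment> \<open>Every element of A has a strictly smaller one in A, either in an earlier block
      or lower in its own block; the outer induction excludes the first, the inner one the
      second.\<close>
    have "\<forall>i. (k, i) \<notin> A" for k
    proof (induction k rule: less_induct)
      case (less k)
      show ?case
      proof (cases "k \<in> K")
        case True
        have "(k, i) \<notin> A" for i
        proof (induction i rule: wf_induct_rule[OF wf[OF True]])
          case (1 i)
          show ?case using A less 1 by (fastforce simp: lex_sum_def)
        qed
        then show ?thesis by blast
      next
        case False then show ?thesis using A by (fastforce simp: lex_sum_def)
      qed
    qed
    then show "A = {}" by auto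
  qed
  moreover have "?L \<subseteq> Field ?L \<times> Field ?L" by (auto simp: Field_def)
  ultimately show ?thesis
    by (simp only: well_order_on_def linear_order_on_def partial_order_on_def preorder_on_def simp_thms)
qed

text \<open>\<open>proof_seq\<close> admits only orders on subsets of \<open>nat\<close>, whereas a
  concatenation is indexed by pairs; any countable index type can be transported along
  \<open>to_nat\<close>.\<close>

lemma proof_seq_reindex:
  fixes r :: "'i::countable rel"
  assumes "Well_order r" "m \<in> Field r" "\<forall>i\<in>Field r. (i, m) \<in> r"
    and "\<forall>i\<in>Field r. f i \<in> S \<and> J (f ` underS r i) (f i)"
  shows "\<exists>r' f' m'. f' m' = f m \<and> proof_seq S J r' f' m'"
proof -
  let ?r = "dir_image r to_nat" and ?f = "\<lambda>n. f (from_nat n)"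
  have 1: "Well_order ?r" by (rule Well_order_dir_image) (use assms in auto)
  have F: "Field ?r = to_nat ` Field r" by (rule dir_image_Field)
  have u: "underS ?r (to_nat i) = to_nat ` underS r i" for i
    by (auto simp: underS_def dir_image_def)
  have "proof_seq S J ?r ?f (to_nat m)"
    unfolding proof_seq_def
  proof (intro conjI)
    show "\<forall>i\<in>Field ?r. (i, to_nat m) \<in> ?r" using assms(3) unfolding F by (auto simp: dir_image_def)
    show "\<forall>i\<in>Field ?r. ?f i \<in> S \<and> J (?f ` underS ?r i) (?f i)"
      using assms(4) unfolding F by (simp add: u image_image)
  qed (use 1 assms(2) F in auto)
  then show ?thesis by (intro exI[of _ ?r] exI[of _ ?f] exI[of _ "to_nat m"]) simp
qed

text \<open>A well-founded derivation is flattened: proofs of the premises exist by induction and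
  are chosen simultaneously, laid end to end in the order of an enumeration of S, and followed by
  the conclusion. Monotonicity of J absorbs the additional earlier items.\<close>

lemma jclosure_imp_proof_seq:
  assumes S: "countable S" and mono: "\<And>P Q x. J P x \<Longrightarrow> P \<subseteq> Q \<Longrightarrow> J Q x"
    and "x \<in> jclosure S J"
  shows "\<exists>r f m. f m = x \<and> proof_seq S J r f m"
  using assms(3)
proof induction
  case (step P x)
  let ?P = "{y \<in> P. y \<in> S}"
  have "\<exists>R. \<forall>y\<in>P. \<exists>f m. f m = y \<and> proof_seq S J (R y) f m"
    using step.IH by (intro bchoice) blast
  then obtain R where "\<forall>y\<in>P. \<exists>f m. f m = y \<and> proof_seq S J (R y) f m" by blast
  then have "\<exists>f. \<forall>y\<in>P. \<exists>m. f y m = y \<and> proof_seq S J (R y) (f y) m" by (intro bchoice) blast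
  then obtain f where "\<forall>y\<in>P. \<exists>m. f y m = y \<and> proof_seq S J (R y) (f y) m" by blast
  then have "\<exists>m. \<forall>y\<in>P. f y (m y) = y \<and> proof_seq S J (R y) (f y) (m y)" by (intro bchoice) blast
  then obtain m where Q: "\<And>y. y \<in> P \<Longrightarrow> f y (m y) = y"
      "\<And>y. y \<in> P \<Longrightarrow> proof_seq S J (R y) (f y) (m y)"
    by blast
  have PS: "P \<subseteq> S" using step.IH by (auto elim: jclosure.cases)
  \<comment> \<open>Each premise takes a finite position; \<infinity> is kept for the conclusion,
    which thus comes after all premises even if they are infinitely many.\<close>
  define e where "e y = enat (to_nat_on S y)" for y
  define d where "d k = inv_into S e k" for k
  have "inj_on e S" using inj_on_to_nat_on[OF S] by (simp add: e_def inj_on_def)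
  then have d: "d (e y) = y" if "y \<in> P" for y using PS that by (auto simp: d_def)
  have e: "e y \<noteq> \<infinity>" "e y < \<infinity>" for y by (auto simp: e_def)
  define K where "K = insert \<infinity> (e ` P)"
  define r where "r k = (if k = \<infinity> then {(0, 0)} else R (d k))" for k :: enat
  define g where "g = (\<lambda>(k, i). if k = \<infinity> then x else f (d k) i)"
  have r: "Well_order (r k)" if "k \<in> K" for k
  proof (cases "k = \<infinity>")
    case True
    then show ?thesis
      by (simp add: r_def well_order_on_def linear_order_on_def partial_order_on_def preorder_on_def
        refl_on_def trans_def antisym_def total_on_def)
  next
    case False then show ?thesis using that Q(2) d by (auto simp: K_def r_def proof_seq_def)
  qed
  let ?L = "lex_sum K r"
  have F: "Field ?L = Sigma K (\<lambda>k. Field (r k))" by (rule Field_lex_sum[OF r])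
  have Finf: "Field (r \<infinity>) = {0}" by (simp add: r_def)
  have re: "r (e y) = R y" if "y \<in> P" for y using that d by (simp add: r_def e_def)
  have "\<exists>r' f' m'. f' m' = g (\<infinity>, 0) \<and> proof_seq S J r' f' m'"
  proof (rule proof_seq_reindex[OF Well_order_lex_sum[OF r]])
    show "(\<infinity>, 0) \<in> Field ?L" unfolding F by (auto simp: Finf K_def)
    show "\<forall>i\<in>Field ?L. (i, (\<infinity>, 0)) \<in> ?L"
      unfolding F by (auto simp: lex_sum_def K_def Finf r_def e)
    show "\<forall>i\<in>Field ?L. g i \<in> S \<and> J (g ` underS ?L i) (g i)"
    proof
      fix p assume p: "p \<in> Field ?L"
      then consider "p = (\<infinity>, 0)" | y i where "p = (e y, i)" "y \<in> P" "i \<in> Field (R y)"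
        using re unfolding F by (auto simp: Finf K_def)
      then show "g p \<in> S \<and> J (g ` underS ?L p) (g p)"
      proof cases
        case 1
        have "y \<in> g ` underS ?L p" if y: "y \<in> P" for y
        proof -
          have "m y \<in> Field (r (e y))" using Q(2)[OF y] re[OF y] by (simp add: proof_seq_def)
          then have "(e y, m y) \<in> underS ?L p"
            using y 1 e by (auto simp: underS_def lex_sum_def K_def Finf)
          moreover have "g (e y, m y) = y" using d y Q by (simp add: g_def e_def)
          ultimately show ?thesis by force
        qed
        then have "P \<subseteq> g ` underS ?L p" by blast
        then show ?thesis using 1 step.hyps mono by (auto simp: g_def)
      next
        case 2
        have "f y ` underS (R y) i \<subseteq> g ` underS ?L p"
        proof
          fix z assume "z \<in> f y ` underS (R y) i"
          then obtain j where j: "z = f y j" "j \<in> underS (R y) i" by blast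
          then have "(e y, j) \<in> underS ?L p"
            using 2 re by (auto simp: underS_def lex_sum_def K_def Field_def)
          moreover have "g (e y, j) = z" using d 2 j by (simp add: g_def e_def)
          ultimately show "z \<in> g ` underS ?L p" by force
        qed
        moreover have "g p = f y i" using 2 d by (simp add: g_def e_def)
        ultimately show ?thesis using Q(2)[OF 2(2)] 2 mono by (auto simp: proof_seq_def)
      qed
    qed
  qed
  then show ?case by (simp add: g_def)
qed

section \<open>Well-formedness of formulas\<close>

lemma CO_simps [simp]:
  "Eq X x \<in> CO \<sigma> \<longleftrightarrow> X \<in> Dom \<sigma> \<and> x \<in> Ran \<sigma> X"
  "Neq X x \<in> CO \<sigma> \<longleftrightarrow> X \<in> Dom \<sigma> \<and> x \<in> Ran \<sigma> X"
  "And \<alpha> \<beta> \<in> CO \<sigma> \<longleftrightarrow> \<alpha> \<in> CO \<sigma> \<and> \<beta> \<in> CO \<sigma>"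
  "Imp \<alpha> \<beta> \<in> CO \<sigma> \<longleftrightarrow> \<alpha> \<in> CO \<sigma> \<and> \<beta> \<in> CO \<sigma>"
  "Cf E \<alpha> \<in> CO \<sigma> \<longleftrightarrow> is_eqs \<sigma> E \<and> \<alpha> \<in> CO \<sigma>"
  by (auto intro: CO.intros elim: CO.cases)

lemma PCO_simps [simp]:
  "Eq X x \<in> PCO \<sigma> \<longleftrightarrow> X \<in> Dom \<sigma> \<and> x \<in> Ran \<sigma> X"
  "Neq X x \<in> PCO \<sigma> \<longleftrightarrow> X \<in> Dom \<sigma> \<and> x \<in> Ran \<sigma> X"
  "PrGe \<alpha> \<epsilon> \<in> PCO \<sigma> \<longleftrightarrow> \<alpha> \<in> CO \<sigma> \<and> 0 \<le> \<epsilon> \<and> \<epsilon> \<le> 1"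
  "PrGt \<alpha> \<epsilon> \<in> PCO \<sigma> \<longleftrightarrow> \<alpha> \<in> CO \<sigma> \<and> 0 \<le> \<epsilon> \<and> \<epsilon> \<le> 1"
  "PrGeP \<alpha> \<beta> \<in> PCO \<sigma> \<longleftrightarrow> \<alpha> \<in> CO \<sigma> \<and> \<beta> \<in> CO \<sigma>"
  "PrGtP \<alpha> \<beta> \<in> PCO \<sigma> \<longleftrightarrow> \<alpha> \<in> CO \<sigma> \<and> \<beta> \<in> CO \<sigma>"
  "And \<phi> \<psi> \<in> PCO \<sigma> \<longleftrightarrow> \<phi> \<in> PCO \<sigma> \<and> \<psi> \<in> PCO \<sigma>"
  "Or \<phi> \<psi> \<in> PCO \<sigma> \<longleftrightarrow> \<phi> \<in> PCO \<sigma> \<and> \<psi> \<in> PCO \<sigma>"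
  "Imp \<alpha> \<phi> \<in> PCO \<sigma> \<longleftrightarrow> \<alpha> \<in> CO \<sigma> \<and> \<phi> \<in> PCO \<sigma>"
  "Cf E \<phi> \<in> PCO \<sigma> \<longleftrightarrow> is_eqs \<sigma> E \<and> \<phi> \<in> PCO \<sigma>"
  by (auto intro: PCO.intros elim: PCO.cases)

lemma CO_subset_PCO: "\<alpha> \<in> CO \<sigma> \<Longrightarrow> \<alpha> \<in> PCO \<sigma>"
  by (induction rule: CO.induct) auto

lemma enum: "finite A \<Longrightarrow> set (enum A) = A \<and> distinct (enum A)"
  unfolding enum_def by (rule someI_ex) (rule finite_distinct_list)

lemma big_closed:
  "e \<in> A \<Longrightarrow> set xs \<subseteq> A \<Longrightarrow> (\<And>x y. x \<in> A \<Longrightarrow> y \<in> A \<Longrightarrow> f x y \<in> A) \<Longrightarrow> big f e xs \<in> A"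
  by (induction f e xs rule: big.induct) auto

locale signature_context =
  fixes \<sigma> :: "('v, 'a) signature"
  assumes is_signature: "is_signature \<sigma>"
begin

lemma finite_Dom: "finite (Dom \<sigma>)"
  and Dom_ne: "Dom \<sigma> \<noteq> {}"
  and finite_Ran: "X \<in> Dom \<sigma> \<Longrightarrow> finite (Ran \<sigma> X)"
  and Ran_ne: "X \<in> Dom \<sigma> \<Longrightarrow> Ran \<sigma> X \<noteq> {}"
  using is_signature by (auto simp: is_signature_def)

lemma vars [simp]: "set (vars \<sigma>) = Dom \<sigma>" "distinct (vars \<sigma>)"
  using enum[OF finite_Dom] by (auto simp: vars_def)

lemma vals [simp]:
  "X \<in> Dom \<sigma> \<Longrightarrow> set (vals \<sigma> X) = Ran \<sigma> X" "X \<in> Dom \<sigma> \<Longrightarrow> distinct (vals \<sigma> X)"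
  using enum[OF finite_Ran] by (auto simp: vals_def)

lemma set_tuples:
  "set Xs \<subseteq> Dom \<sigma> \<Longrightarrow>
     ys \<in> set (tuples \<sigma> Xs) \<longleftrightarrow> length ys = length Xs \<and> (\<forall>i<length Xs. ys ! i \<in> Ran \<sigma> (Xs ! i))"
  by (auto simp: tuples_def product_lists_set list_all2_conv_all_nth subset_iff)

definition var0 :: 'v where "var0 = hd (vars \<sigma>)"
definition val0 :: 'a where "val0 = hd (vals \<sigma> var0)"

lemma var0 [simp]: "var0 \<in> Dom \<sigma>"
  using Dom_ne vars(1) unfolding var0_def by (metis hd_in_set set_empty)

lemma val0 [simp]: "val0 \<in> Ran \<sigma> var0"
  using Ran_ne[OF var0] vals(1)[OF var0] unfolding val0_def by (metis hd_in_set set_empty)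

lemma falsum_eq: "falsum \<sigma> = Cf {(var0, val0)} (Neq var0 val0)"
  and verum_eq: "verum \<sigma> = Cf {(var0, val0)} (Eq var0 val0)"
  by (simp_all add: falsum_def verum_def var0_def val0_def Let_def)

lemma falsum_verum_CO [simp]: "falsum \<sigma> \<in> CO \<sigma>" "verum \<sigma> \<in> CO \<sigma>"
  by (simp_all add: falsum_eq verum_eq is_eqs_def)

lemma falsum_verum_PCO [simp]: "falsum \<sigma> \<in> PCO \<sigma>" "verum \<sigma> \<in> PCO \<sigma>"
  by (simp_all add: CO_subset_PCO)

lemma neg_CO [simp]: "neg \<sigma> \<alpha> \<in> CO \<sigma> \<longleftrightarrow> \<alpha> \<in> CO \<sigma>"
  and neg_PCO [simp]: "neg \<sigma> \<alpha> \<in> PCO \<sigma> \<longleftrightarrow> \<alpha> \<in> CO \<sigma>"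
  by (simp_all add: neg_def)

lemma disj_CO [simp]: "disj \<sigma> \<alpha> \<beta> \<in> CO \<sigma> \<longleftrightarrow> \<alpha> \<in> CO \<sigma> \<and> \<beta> \<in> CO \<sigma>"
  by (simp add: disj_def)

lemma equi_CO [simp]: "equi \<alpha> \<beta> \<in> CO \<sigma> \<longleftrightarrow> \<alpha> \<in> CO \<sigma> \<and> \<beta> \<in> CO \<sigma>"
  by (auto simp: equi_def)

lemma Pr_PCO [simp]:
  "PrLe \<sigma> \<alpha> \<epsilon> \<in> PCO \<sigma> \<longleftrightarrow> \<alpha> \<in> CO \<sigma> \<and> 0 \<le> \<epsilon> \<and> \<epsilon> \<le> 1"
  "PrLt \<sigma> \<alpha> \<epsilon> \<in> PCO \<sigma> \<longleftrightarrow> \<alpha> \<in> CO \<sigma> \<and> 0 \<le> \<epsilon> \<and> \<epsilon> \<le> 1"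
  "PrEq \<sigma> \<alpha> \<epsilon> \<in> PCO \<sigma> \<longleftrightarrow> \<alpha> \<in> CO \<sigma> \<and> 0 \<le> \<epsilon> \<and> \<epsilon> \<le> 1"
  "PrNe \<sigma> \<alpha> \<epsilon> \<in> PCO \<sigma> \<longleftrightarrow> \<alpha> \<in> CO \<sigma> \<and> 0 \<le> \<epsilon> \<and> \<epsilon> \<le> 1"
  by (auto simp: PrLe_def PrLt_def PrEq_def PrNe_def)

lemma wneg_PCO [simp]: "\<phi> \<in> PCO \<sigma> \<Longrightarrow> wneg \<sigma> \<phi> \<in> PCO \<sigma>"
  by (induction rule: PCO.induct) auto

lemma imp_PCO [simp]: "\<phi> \<in> PCO \<sigma> \<Longrightarrow> imp \<sigma> \<phi> \<psi> \<in> PCO \<sigma> \<longleftrightarrow> \<psi> \<in> PCO \<sigma>"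
  by (simp add: imp_def)

lemma imp_PCO_D: "imp \<sigma> \<phi> \<psi> \<in> PCO \<sigma> \<Longrightarrow> \<psi> \<in> PCO \<sigma>"
  by (simp add: imp_def)

lemma iff_PCO [simp]: "\<phi> \<in> PCO \<sigma> \<Longrightarrow> \<psi> \<in> PCO \<sigma> \<Longrightarrow> iff \<sigma> \<phi> \<psi> \<in> PCO \<sigma>"
  by (simp add: iff_def)

lemma inst_PCO_PCO: "(\<And>n. g n \<in> PCO \<sigma>) \<Longrightarrow> inst_PCO \<sigma> g p \<in> PCO \<sigma>"
  by (induction p) auto

lemma inst_CO_CO: "(\<And>n. g n \<in> CO \<sigma>) \<Longrightarrow> inst_CO \<sigma> g p \<in> CO \<sigma>"
  by (induction p) auto

lemma big_And_CO: "set xs \<subseteq> CO \<sigma> \<Longrightarrow> big And (verum \<sigma>) xs \<in> CO \<sigma>"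
  and big_disj_CO: "set xs \<subseteq> CO \<sigma> \<Longrightarrow> big (disj \<sigma>) (falsum \<sigma>) xs \<in> CO \<sigma>"
  by (rule big_closed; simp)+

lemma big_Or_PCO: "set xs \<subseteq> PCO \<sigma> \<Longrightarrow> big Or (falsum \<sigma>) xs \<in> PCO \<sigma>"
  by (rule big_closed) auto

lemma eqs_fm_CO: "is_eqs \<sigma> (set xs) \<Longrightarrow> eqs_fm \<sigma> xs \<in> CO \<sigma>"
  unfolding eqs_fm_def by (rule big_And_CO) (auto simp: is_eqs_def)

lemma neqs_fm_CO: "is_eqs \<sigma> (set xs) \<Longrightarrow> neqs_fm \<sigma> xs \<in> CO \<sigma>"
  unfolding neqs_fm_def by (rule big_disj_CO) (auto simp: is_eqs_def)

lemma is_eqs_zip: "set Xs \<subseteq> Dom \<sigma> \<Longrightarrow> ys \<in> set (tuples \<sigma> Xs) \<Longrightarrow> is_eqs \<sigma> (set (zip Xs ys))"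
  by (auto simp: set_tuples is_eqs_def set_zip)

lemma is_eqs_eqs_of: "w \<in> assigns \<sigma> A \<Longrightarrow> A \<subseteq> Dom \<sigma> \<Longrightarrow> is_eqs \<sigma> (eqs_of w A)"
  by (auto simp: is_eqs_def eqs_of_def assigns_def)

lemma is_eqs_Un [simp]: "is_eqs \<sigma> (E \<union> D) \<longleftrightarrow> is_eqs \<sigma> E \<and> is_eqs \<sigma> D"
  by (auto simp: is_eqs_def)

lemma is_eqs_insert [simp]:
  "is_eqs \<sigma> (insert (X, x) E) \<longleftrightarrow> X \<in> Dom \<sigma> \<and> x \<in> Ran \<sigma> X \<and> is_eqs \<sigma> E"
  "is_eqs \<sigma> {}"
  by (auto simp: is_eqs_def)

lemma is_eqs_subset: "is_eqs \<sigma> E \<Longrightarrow> D \<subseteq> E \<Longrightarrow> is_eqs \<sigma> D"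
  by (auto simp: is_eqs_def)

lemma dep_CO:
  assumes "set Zs \<subseteq> Dom \<sigma>" "X \<in> Dom \<sigma>" "Y \<in> Dom \<sigma>"
  shows "set (dep \<sigma> Zs X Y) \<subseteq> CO \<sigma>"
  using assms by (auto simp: dep_def is_eqs_zip)

lemma affects_CO [simp]: "X \<in> Dom \<sigma> \<Longrightarrow> Y \<in> Dom \<sigma> \<Longrightarrow> affects \<sigma> X Y \<in> CO \<sigma>"
proof -
  assume *: "X \<in> Dom \<sigma>" "Y \<in> Dom \<sigma>"
  have "set Zs \<subseteq> Dom \<sigma>" if "Zs \<in> set (subseqs [Z\<leftarrow>vars \<sigma>. Z \<noteq> X])" for Zs
    using that subseqs_powset[of "[Z\<leftarrow>vars \<sigma>. Z \<noteq> X]"] by (auto simp: image_subset_iff)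
  then show ?thesis unfolding affects_def using dep_CO * by (intro big_disj_CO) force
qed

lemma phi_DC_CO [simp]: "X \<in> Dom \<sigma> \<Longrightarrow> Y \<in> Dom \<sigma> \<Longrightarrow> phi_DC \<sigma> X Y \<in> CO \<sigma>"
  unfolding phi_DC_def by (intro big_disj_CO dep_CO) auto

lemma phi_End_PCO [simp]: "Y \<in> Dom \<sigma> \<Longrightarrow> phi_End \<sigma> Y \<in> PCO \<sigma>"
  unfolding phi_End_def by (intro big_Or_PCO) (auto simp: CO_subset_PCO)

lemma axiom_PCO: "axiom \<sigma> \<phi> \<Longrightarrow> \<phi> \<in> PCO \<sigma>"
proof (induction rule: axiom.induct)
  case (A1 Ys ys ys')
  then show ?case by (simp add: is_eqs_zip eqs_fm_CO neqs_fm_CO CO_subset_PCO)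
next
  case (A3 Ys)
  then show ?case
    by (intro CO_subset_PCO big_disj_CO) (auto simp: is_eqs_zip eqs_fm_CO)
next
  case (C4 E D \<chi>)
  moreover have "is_eqs \<sigma> {(X, x) \<in> E. X \<notin> fst ` D}"
    using C4(1) by (rule is_eqs_subset) auto
  ultimately show ?case by simp
next
  case (C9 Y w)
  have "big Or (falsum \<sigma>) [Eq Y y. y \<leftarrow> vals \<sigma> Y] \<in> PCO \<sigma>"
    using C9 by (intro big_Or_PCO) auto
  then show ?case using C9 by (simp add: is_eqs_eqs_of)
next
  case (C11 Xs)
  have "big And (verum \<sigma>) [affects \<sigma> (Xs ! i) (Xs ! Suc i). i \<leftarrow> [0..<length Xs - 1]] \<in> CO \<sigma>"
    using C11 by (intro big_And_CO) (auto simp: subset_iff)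
  moreover have "last Xs \<in> Dom \<sigma>" "hd Xs \<in> Dom \<sigma>"
    using C11 by (cases Xs; auto simp: subset_iff)+
  ultimately show ?case by (simp add: CO_subset_PCO)
qed (auto simp: CO_subset_PCO inst_PCO_PCO inst_CO_CO is_eqs_eqs_of eqs_fm_CO mult_le_one)

end

section \<open>Countability of the language\<close>

datatype fm_code = CEq nat nat | CNeq nat nat | CPrGe fm_code rat | CPrGt fm_code rat
  | CPrGeP fm_code fm_code | CPrGtP fm_code fm_code | CAnd fm_code fm_code | COr fm_code fm_code
  | CImp fm_code fm_code | CCf "(nat \<times> nat) list" fm_code

instance fm_code :: countable by countable_datatype

context signature_context
begin

text \<open>The types of variables and values are arbitrary, but a formula over the signature
  mentions only its finitely many variables and values. These are numbered, and every formula is the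
  decoding of a finite tree; lists in the codes stand in for the equation sets, which are finite
  here.\<close>

lemma countable_PCO: "countable (PCO \<sigma>)"
proof -
  define V where "V = from_nat_into (Dom \<sigma>)"
  define R where "R = from_nat_into (\<Union>X\<in>Dom \<sigma>. Ran \<sigma> X)"
  define dec where "dec = rec_fm_code (\<lambda>i j. Eq (V i) (R j)) (\<lambda>i j. Neq (V i) (R j))
    (\<lambda>_ \<epsilon> a. PrGe a \<epsilon>) (\<lambda>_ \<epsilon> a. PrGt a \<epsilon>) (\<lambda>_ _ a b. PrGeP a b) (\<lambda>_ _ a b. PrGtP a b)
    (\<lambda>_ _ a b. And a b) (\<lambda>_ _ a b. Or a b) (\<lambda>_ _ a b. Imp a b)
    (\<lambda>es _ a. Cf (set (map (\<lambda>(i, j). (V i, R j)) es)) a)"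
  have cD: "countable (Dom \<sigma>)" using finite_Dom by (simp add: countable_finite)
  have cR: "countable (\<Union>X\<in>Dom \<sigma>. Ran \<sigma> X)" using finite_Dom finite_Ran by (simp add: countable_finite)
  have V: "\<exists>i. X = V i" if "X \<in> Dom \<sigma>" for X
    using from_nat_into_surj[OF cD that] by (auto simp: V_def)
  have R: "\<exists>i. x = R i" if "X \<in> Dom \<sigma>" "x \<in> Ran \<sigma> X" for X x
    using from_nat_into_surj[OF cR, of x] that by (auto simp: R_def)
  have E: "\<exists>es. E = set (map (\<lambda>(i, j). (V i, R j)) es)" if "is_eqs \<sigma> E" for E
  proof -
    have "finite E" using that finite_Dom finite_Ran
      unfolding is_eqs_def by (auto intro: finite_subset)
    moreover have "\<forall>p\<in>E. \<exists>q. p = (\<lambda>(i, j). (V i, R j)) q"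
      using that V R by (fastforce simp: is_eqs_def)
    ultimately show ?thesis
    proof (induction E)
      case empty then show ?case by (intro exI[of _ "[]"]) simp
    next
      case (insert p E)
      then obtain es q where "E = set (map (\<lambda>(i, j). (V i, R j)) es)" "p = (\<lambda>(i, j). (V i, R j)) q"
        by auto
      then show ?case by (intro exI[of _ "q # es"]) simp
    qed
  qed
  have co: "\<phi> \<in> range dec" if "\<phi> \<in> CO \<sigma>" for \<phi>
    using that
  proof induction
    case (1 X x)
    then obtain i j where "X = V i" "x = R j" using V R by blast
    then show ?case by (intro range_eqI[of _ _ "CEq i j"]) (simp add: dec_def)
  next
    case (2 X x)
    then obtain i j where "X = V i" "x = R j" using V R by blast
    then show ?case by (intro range_eqI[of _ _ "CNeq i j"]) (simp add: dec_def)
  next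
    case (3 a b)
    then obtain c d where "a = dec c" "b = dec d" by blast
    then show ?case by (intro range_eqI[of _ _ "CAnd c d"]) (simp add: dec_def)
  next
    case (4 a b)
    then obtain c d where "a = dec c" "b = dec d" by blast
    then show ?case by (intro range_eqI[of _ _ "CImp c d"]) (simp add: dec_def)
  next
    case (5 E a)
    then obtain es c where "E = set (map (\<lambda>(i, j). (V i, R j)) es)" "a = dec c" using E by blast
    then show ?case by (intro range_eqI[of _ _ "CCf es c"]) (simp add: dec_def)
  qed
  have "\<phi> \<in> range dec" if "\<phi> \<in> PCO \<sigma>" for \<phi>
    using that
  proof induction
    case (1 X x)
    then show ?case by (intro co) simp
  next
    case (2 X x)
    then show ?case by (intro co) simp
  next
    case (3 a \<epsilon>)
    then obtain c where "a = dec c" using co by blast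
    then show ?case by (intro range_eqI[of _ _ "CPrGe c \<epsilon>"]) (simp add: dec_def)
  next
    case (4 a \<epsilon>)
    then obtain c where "a = dec c" using co by blast
    then show ?case by (intro range_eqI[of _ _ "CPrGt c \<epsilon>"]) (simp add: dec_def)
  next
    case (5 a b)
    then obtain c d where "a = dec c" "b = dec d" using co by blast
    then show ?case by (intro range_eqI[of _ _ "CPrGeP c d"]) (simp add: dec_def)
  next
    case (6 a b)
    then obtain c d where "a = dec c" "b = dec d" using co by blast
    then show ?case by (intro range_eqI[of _ _ "CPrGtP c d"]) (simp add: dec_def)
  next
    case (7 a b)
    then obtain c d where "a = dec c" "b = dec d" by blast
    then show ?case by (intro range_eqI[of _ _ "CAnd c d"]) (simp add: dec_def)
  next
    case (8 a b)
    then obtain c d where "a = dec c" "b = dec d" by blast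
    then show ?case by (intro range_eqI[of _ _ "COr c d"]) (simp add: dec_def)
  next
    case (9 a b)
    then obtain c d where "a = dec c" "b = dec d" using co by blast
    then show ?case by (intro range_eqI[of _ _ "CImp c d"]) (simp add: dec_def)
  next
    case (10 E a)
    then obtain es c where "E = set (map (\<lambda>(i, j). (V i, R j)) es)" "a = dec c" using E by blast
    then show ?case by (intro range_eqI[of _ _ "CCf es c"]) (simp add: dec_def)
  qed
  then have "PCO \<sigma> \<subseteq> range dec" by blast
  then show ?thesis by (rule countable_subset) simp
qed

end

section \<open>Derivability and the deduction theorem\<close>

lemma rule_mono: "rule \<sigma> P \<phi> \<Longrightarrow> P \<subseteq> Q \<Longrightarrow> rule \<sigma> Q \<phi>"
  by (induction rule: rule.induct) (auto intro: rule.intros)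

lemma thm_rule_mono: "thm_rule \<sigma> P \<phi> \<Longrightarrow> P \<subseteq> Q \<Longrightarrow> thm_rule \<sigma> Q \<phi>"
  by (induction rule: thm_rule.induct) (auto intro: thm_rule.intros)

text \<open>Substitutes the entries of a list for \<open>PVar 0\<close>, \<open>PVar 1\<close> and
  so on. The default matters because \<open>T1\<close> and \<open>T2\<close> require the instance of
  every variable, also of those absent from the schema, to lie in the language.\<close>

definition nthd :: "'b \<Rightarrow> 'b list \<Rightarrow> nat \<Rightarrow> 'b" where
  "nthd d xs n = (if n < length xs then xs ! n else d)"

context signature_context
begin

lemma provable_iff:
  "provable \<sigma> \<phi> \<longleftrightarrow>
     \<phi> \<in> jclosure (PCO \<sigma>) (\<lambda>P \<psi>. axiom \<sigma> \<psi> \<or> rule \<sigma> P \<psi> \<or> thm_rule \<sigma> P \<psi>)"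
    (is "_ \<longleftrightarrow> _ \<in> jclosure _ ?J")
proof
  assume "provable \<sigma> \<phi>"
  then show "\<phi> \<in> jclosure (PCO \<sigma>) ?J"
    unfolding provable_def using proof_seq_imp_jclosure by blast
next
  assume "\<phi> \<in> jclosure (PCO \<sigma>) ?J"
  then show "provable \<sigma> \<phi>"
    unfolding provable_def
    by (rule jclosure_imp_proof_seq[OF countable_PCO, rotated]) (blast intro: rule_mono thm_rule_mono)
qed

abbreviation just :: "('v, 'a) fm set \<Rightarrow> ('v, 'a) fm set \<Rightarrow> ('v, 'a) fm \<Rightarrow> bool" where
  "just \<Gamma> P \<psi> \<equiv> axiom \<sigma> \<psi> \<or> \<psi> \<in> \<Gamma> \<or> rule \<sigma> P \<psi> \<or> thm_rule \<sigma> (P \<inter> {\<theta>. provable \<sigma> \<theta>}) \<psi>"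

lemma derivable_iff: "derivable \<sigma> \<Gamma> \<phi> \<longleftrightarrow> \<phi> \<in> jclosure (PCO \<sigma>) (just \<Gamma>)"
proof
  assume "derivable \<sigma> \<Gamma> \<phi>"
  then show "\<phi> \<in> jclosure (PCO \<sigma>) (just \<Gamma>)"
    unfolding derivable_def using proof_seq_imp_jclosure by blast
next
  assume *: "\<phi> \<in> jclosure (PCO \<sigma>) (just \<Gamma>)"
  have "just \<Gamma> P x \<Longrightarrow> P \<subseteq> Q \<Longrightarrow> just \<Gamma> Q x" for P Q x
    using rule_mono[of \<sigma> P x Q] thm_rule_mono[of \<sigma> "P \<inter> {\<theta>. provable \<sigma> \<theta>}" x "Q \<inter> {\<theta>. provable \<sigma> \<theta>}"]
    by blast
  then show "derivable \<sigma> \<Gamma> \<phi>"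
    unfolding derivable_def by (rule jclosure_imp_proof_seq[OF countable_PCO _ *])
qed

lemma provable_PCO: "provable \<sigma> \<phi> \<Longrightarrow> \<phi> \<in> PCO \<sigma>"
  unfolding provable_iff by (erule jclosure.cases) simp

lemma derivable_PCO: "derivable \<sigma> \<Gamma> \<phi> \<Longrightarrow> \<phi> \<in> PCO \<sigma>"
  unfolding derivable_iff by (erule jclosure.cases) simp

lemma provable_axiom: "axiom \<sigma> \<phi> \<Longrightarrow> provable \<sigma> \<phi>"
  unfolding provable_iff by (rule jclosure.step[of "{}"]) (auto simp: axiom_PCO)

lemma provable_rule:
  "rule \<sigma> {\<theta>. provable \<sigma> \<theta>} \<phi> \<Longrightarrow> \<phi> \<in> PCO \<sigma> \<Longrightarrow> provable \<sigma> \<phi>"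
  "thm_rule \<sigma> {\<theta>. provable \<sigma> \<theta>} \<phi> \<Longrightarrow> \<phi> \<in> PCO \<sigma> \<Longrightarrow> provable \<sigma> \<phi>"
  unfolding provable_iff by (rule jclosure.step; auto)+

lemma provable_MP: "provable \<sigma> \<psi> \<Longrightarrow> provable \<sigma> (imp \<sigma> \<psi> \<chi>) \<Longrightarrow> provable \<sigma> \<chi>"
  by (rule provable_rule(1)) (auto intro: rule.MP imp_PCO_D provable_PCO)

lemma derivable_axiom: "axiom \<sigma> \<phi> \<Longrightarrow> derivable \<sigma> \<Gamma> \<phi>"
  unfolding derivable_iff by (rule jclosure.step[of "{}"]) (auto simp: axiom_PCO)

lemma derivable_hyp: "\<phi> \<in> \<Gamma> \<Longrightarrow> \<phi> \<in> PCO \<sigma> \<Longrightarrow> derivable \<sigma> \<Gamma> \<phi>"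
  unfolding derivable_iff by (rule jclosure.step[of "{}"]) auto

lemma derivable_rule: "rule \<sigma> {\<theta>. derivable \<sigma> \<Gamma> \<theta>} \<phi> \<Longrightarrow> \<phi> \<in> PCO \<sigma> \<Longrightarrow> derivable \<sigma> \<Gamma> \<phi>"
  unfolding derivable_iff by (rule jclosure.step; auto)

lemma derivable_MP: "derivable \<sigma> \<Gamma> \<psi> \<Longrightarrow> derivable \<sigma> \<Gamma> (imp \<sigma> \<psi> \<chi>) \<Longrightarrow> derivable \<sigma> \<Gamma> \<chi>"
  by (rule derivable_rule) (auto intro: rule.MP imp_PCO_D derivable_PCO)

lemma provable_imp_derivable: "provable \<sigma> \<phi> \<Longrightarrow> derivable \<sigma> \<Gamma> \<phi>"
proof -
  let ?J = "\<lambda>P \<psi>. axiom \<sigma> \<psi> \<or> rule \<sigma> P \<psi> \<or> thm_rule \<sigma> P \<psi>"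
  assume "provable \<sigma> \<phi>"
  then have "\<phi> \<in> jclosure (PCO \<sigma>) ?J" by (simp add: provable_iff)
  then have "\<phi> \<in> jclosure (PCO \<sigma>) (just \<Gamma>)"
  proof induction
    case (step P x)
    have "P \<inter> {\<theta>. provable \<sigma> \<theta>} = P" using step.IH by (auto simp: provable_iff)
    then show ?case using step by (intro jclosure.step[of P]) auto
  qed
  then show ?thesis by (simp add: derivable_iff)
qed

text \<open>A rule restricted to theorems yields a theorem, so all uses of \<open>Rep\<close>,
  \<open>Mon_Imp\<close>, \<open>To_Imp\<close> and \<open>Mon_Cf\<close> merge into one case about
  provable formulas, and only \<open>rule\<close> remains as a genuine induction step.\<close>

lemma derivable_induct [consumes 1, case_names ax hyp rl th]:
  assumes "derivable \<sigma> \<Gamma> \<phi>"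
    and "\<And>x. axiom \<sigma> x \<Longrightarrow> Q x"
    and "\<And>x. x \<in> \<Gamma> \<Longrightarrow> x \<in> PCO \<sigma> \<Longrightarrow> Q x"
    and "\<And>P x. \<forall>y\<in>P. derivable \<sigma> \<Gamma> y \<and> Q y \<Longrightarrow> rule \<sigma> P x \<Longrightarrow> x \<in> PCO \<sigma> \<Longrightarrow> Q x"
    and "\<And>x. provable \<sigma> x \<Longrightarrow> Q x"
  shows "Q \<phi>"
proof -
  have "\<phi> \<in> jclosure (PCO \<sigma>) (just \<Gamma>)" using assms(1) by (simp add: derivable_iff)
  then show ?thesis
  proof induction
    case (step P x)
    have "provable \<sigma> x" if "thm_rule \<sigma> (P \<inter> {\<theta>. provable \<sigma> \<theta>}) x"
      using that by (intro provable_rule(2) step) (auto intro: thm_rule_mono)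
    moreover have "\<forall>y\<in>P. derivable \<sigma> \<Gamma> y \<and> Q y" using step.IH by (auto simp: derivable_iff)
    ultimately show ?case using step.hyps assms(2-5) by metis
  qed
qed

lemma derivable_mono: "derivable \<sigma> \<Gamma> \<phi> \<Longrightarrow> \<Gamma> \<subseteq> \<Delta> \<Longrightarrow> derivable \<sigma> \<Delta> \<phi>"
proof (induction rule: derivable_induct)
  case (rl P x)
  then show ?case by (intro derivable_rule) (auto elim!: rule_mono)
qed (auto intro: derivable_axiom derivable_hyp provable_imp_derivable)

lemma taut:
  assumes "tautology p" "set xs \<subseteq> PCO \<sigma>"
  shows "provable \<sigma> (inst_PCO \<sigma> (nthd (verum \<sigma>) xs) p)"
  using assms by (intro provable_axiom axiom.T1) (auto simp: nthd_def)

lemma taut_CO: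
  assumes "tautology p" "set xs \<subseteq> CO \<sigma>"
  shows "provable \<sigma> (inst_CO \<sigma> (nthd (verum \<sigma>) xs) p)"
  using assms by (intro provable_axiom axiom.T2) (auto simp: nthd_def)

lemma provable_verum: "provable \<sigma> (verum \<sigma>)"
  using taut[of PTop "[]"] by (simp add: tautology_def)

lemma provable_weaken: "\<phi> \<in> PCO \<sigma> \<Longrightarrow> \<psi> \<in> PCO \<sigma> \<Longrightarrow> provable \<sigma> (imp \<sigma> \<phi> (imp \<sigma> \<psi> \<phi>))"
  using taut[of "PImp (PVar 0) (PImp (PVar 1) (PVar 0))" "[\<phi>, \<psi>]"]
  by (simp add: tautology_def nthd_def)

text \<open>Every rule with arbitrary premises carries over under the antecedent \<psi>. For
  \<open>MP\<close> this is a tautology; the infinitary rules already have a side antecedent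
  \<theta>, which is enlarged to \<open>And \<psi> \<theta>\<close>. The rules without such a slot
  apply to theorems only, and theorems are weakened.\<close>

lemma deduction:
  assumes "derivable \<sigma> (insert \<psi> \<Gamma>) \<chi>" and psi: "\<psi> \<in> PCO \<sigma>"
  shows "derivable \<sigma> \<Gamma> (imp \<sigma> \<psi> \<chi>)"
  using assms(1)
proof (induction rule: derivable_induct)
  case (ax x)
  then show ?case
    using provable_weaken[of x \<psi>] psi
    by (blast intro: derivable_MP derivable_axiom provable_imp_derivable axiom_PCO)
next
  case (th x)
  then show ?case
    using provable_weaken[of x \<psi>] psi
    by (blast intro: derivable_MP provable_imp_derivable provable_PCO)
next
  case (hyp x)
  show ?case
  proof (cases "x = \<psi>")
    case True
    have "provable \<sigma> (imp \<sigma> \<psi> \<psi>)"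
      using taut[of "PImp (PVar 0) (PVar 0)" "[\<psi>]"] psi by (simp add: tautology_def nthd_def)
    then show ?thesis using True by (simp add: provable_imp_derivable)
  next
    case False
    then show ?thesis
      using provable_weaken[of x \<psi>] psi hyp
      by (blast intro: derivable_MP derivable_hyp provable_imp_derivable)
  qed
next
  case (rl P x)
  have export: "derivable \<sigma> \<Gamma> (imp \<sigma> \<psi> (imp \<sigma> \<theta> \<phi>)) \<longleftrightarrow> derivable \<sigma> \<Gamma> (imp \<sigma> (And \<psi> \<theta>) \<phi>)"
    if "\<theta> \<in> PCO \<sigma>" "\<phi> \<in> PCO \<sigma>" for \<theta> \<phi>
  proof -
    let ?a = "PImp (PVar 0) (PImp (PVar 1) (PVar 2))" and ?b = "PImp (PAnd (PVar 0) (PVar 1)) (PVar 2)"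
    have "provable \<sigma> (imp \<sigma> (imp \<sigma> \<psi> (imp \<sigma> \<theta> \<phi>)) (imp \<sigma> (And \<psi> \<theta>) \<phi>))"
      using taut[of "PImp ?a ?b" "[\<psi>, \<theta>, \<phi>]"] psi that by (simp add: tautology_def nthd_def)
    moreover have "provable \<sigma> (imp \<sigma> (imp \<sigma> (And \<psi> \<theta>) \<phi>) (imp \<sigma> \<psi> (imp \<sigma> \<theta> \<phi>)))"
      using taut[of "PImp ?b ?a" "[\<psi>, \<theta>, \<phi>]"] psi that by (simp add: tautology_def nthd_def)
    ultimately show ?thesis by (blast intro: derivable_MP provable_imp_derivable)
  qed
  from rl(2) show ?case
  proof cases
    case (MP \<theta>)
    have PCO: "\<theta> \<in> PCO \<sigma>" "x \<in> PCO \<sigma>" using MP rl by (auto dest: derivable_PCO)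
    have "provable \<sigma> (imp \<sigma> (imp \<sigma> \<psi> \<theta>) (imp \<sigma> (imp \<sigma> \<psi> (imp \<sigma> \<theta> x)) (imp \<sigma> \<psi> x)))"
      using taut[of "PImp (PImp (PVar 0) (PVar 1)) (PImp (PImp (PVar 0) (PImp (PVar 1) (PVar 2)))
        (PImp (PVar 0) (PVar 2)))" "[\<psi>, \<theta>, x]"] PCO psi
      by (simp add: tautology_def nthd_def)
    moreover have "derivable \<sigma> \<Gamma> (imp \<sigma> \<psi> \<theta>)" "derivable \<sigma> \<Gamma> (imp \<sigma> \<psi> (imp \<sigma> \<theta> x))"
      using rl(1) MP by auto
    ultimately show ?thesis by (blast intro: derivable_MP provable_imp_derivable)
  next
    case (Bot_omega \<theta> \<alpha>)
    have "rule \<sigma> {\<theta>. derivable \<sigma> \<Gamma> \<theta>} (imp \<sigma> (And \<psi> \<theta>) (falsum \<sigma>))"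
    proof (rule rule.Bot_omega)
      fix \<epsilon> :: rat assume "0 \<le> \<epsilon>" "\<epsilon> \<le> 1"
      then show "imp \<sigma> (And \<psi> \<theta>) (PrNe \<sigma> \<alpha> \<epsilon>) \<in> {\<theta>. derivable \<sigma> \<Gamma> \<theta>}"
        using rl(1) Bot_omega export[of \<theta> "PrNe \<sigma> \<alpha> \<epsilon>"] by auto
    qed (use Bot_omega psi in auto)
    then have "derivable \<sigma> \<Gamma> (imp \<sigma> (And \<psi> \<theta>) (falsum \<sigma>))"
      using Bot_omega psi by (intro derivable_rule) auto
    then show ?thesis using export Bot_omega by auto
  next
    case (Imp_omega \<theta> \<alpha> \<beta> \<delta>)
    let ?c = "\<lambda>\<epsilon>. iff \<sigma> (PrEq \<sigma> (And \<alpha> \<beta>) (\<delta> * \<epsilon>)) (PrEq \<sigma> \<alpha> \<epsilon>)"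
    have "rule \<sigma> {\<theta>. derivable \<sigma> \<Gamma> \<theta>} (imp \<sigma> (And \<psi> \<theta>) (Imp \<alpha> (PrEq \<sigma> \<beta> \<delta>)))"
    proof (rule rule.Imp_omega)
      fix \<epsilon> :: rat assume *: "0 < \<epsilon>" "\<epsilon> \<le> 1"
      then have "?c \<epsilon> \<in> PCO \<sigma>" using Imp_omega by (simp add: mult_le_one)
      then show "imp \<sigma> (And \<psi> \<theta>) (?c \<epsilon>) \<in> {\<theta>. derivable \<sigma> \<Gamma> \<theta>}"
        using rl(1) Imp_omega export[of \<theta> "?c \<epsilon>"] * by auto
    qed (use Imp_omega psi in auto)
    then have "derivable \<sigma> \<Gamma> (imp \<sigma> (And \<psi> \<theta>) (Imp \<alpha> (PrEq \<sigma> \<beta> \<delta>)))"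
      using Imp_omega psi by (intro derivable_rule) auto
    then show ?thesis using export Imp_omega by auto
  qed
qed

section \<open>Complete theories\<close>

definition complete_theory :: "('v, 'a) fm set \<Rightarrow> bool" where
  "complete_theory \<Delta> \<longleftrightarrow>
     \<Delta> \<subseteq> PCO \<sigma> \<and> {\<phi>. provable \<sigma> \<phi>} \<subseteq> \<Delta> \<and> falsum \<sigma> \<notin> \<Delta> \<and>
     (\<forall>\<psi>\<in>\<Delta>. \<forall>\<chi>. imp \<sigma> \<psi> \<chi> \<in> \<Delta> \<longrightarrow> \<chi> \<in> \<Delta>) \<and>
     (\<forall>\<psi>\<in>PCO \<sigma>. \<psi> \<in> \<Delta> \<or> wneg \<sigma> \<psi> \<in> \<Delta>) \<and>
     (\<forall>\<alpha>\<in>CO \<sigma>. \<exists>\<epsilon>. 0 \<le> \<epsilon> \<and> \<epsilon> \<le> 1 \<and> PrEq \<sigma> \<alpha> \<epsilon> \<in> \<Delta>)"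

section \<open>Consistency and the Lindenbaum construction\<close>

abbreviation inconsistent :: "('v, 'a) fm set \<Rightarrow> bool" where
  "inconsistent \<Gamma> \<equiv> derivable \<sigma> \<Gamma> (falsum \<sigma>)"

lemma inconsistent_pair:
  assumes "derivable \<sigma> \<Gamma> \<psi>" "derivable \<sigma> \<Gamma> (wneg \<sigma> \<psi>)"
  shows "inconsistent \<Gamma>"
proof -
  have "provable \<sigma> (imp \<sigma> \<psi> (imp \<sigma> (wneg \<sigma> \<psi>) (falsum \<sigma>)))"
    using taut[of "PImp (PVar 0) (PImp (PNot (PVar 0)) PBot)" "[\<psi>]"] assms
    by (simp add: tautology_def nthd_def derivable_PCO)
  then show ?thesis using assms by (blast intro: derivable_MP provable_imp_derivable)
qed

lemma inconsistent_cases: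
  assumes "inconsistent (insert \<psi> \<Gamma>)" "inconsistent (insert (wneg \<sigma> \<psi>) \<Gamma>)" "\<psi> \<in> PCO \<sigma>"
  shows "inconsistent \<Gamma>"
proof -
  have "provable \<sigma> (imp \<sigma> (imp \<sigma> \<psi> (falsum \<sigma>)) (imp \<sigma> (imp \<sigma> (wneg \<sigma> \<psi>) (falsum \<sigma>)) (falsum \<sigma>)))"
    using taut[of "PImp (PImp (PVar 0) PBot) (PImp (PImp (PNot (PVar 0)) PBot) PBot)" "[\<psi>]"] assms
    by (simp add: tautology_def nthd_def)
  moreover have "derivable \<sigma> \<Gamma> (imp \<sigma> \<psi> (falsum \<sigma>))" "derivable \<sigma> \<Gamma> (imp \<sigma> (wneg \<sigma> \<psi>) (falsum \<sigma>))"
    using assms by (auto intro: deduction)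
  ultimately show ?thesis by (blast intro: derivable_MP provable_imp_derivable)
qed

text \<open>If each value \<epsilon> for the probability of \<alpha> is refutable, then
  \<open>PrNe\<close> is derivable for every \<epsilon>, and these are the premises of
  \<open>Bot_omega\<close> with antecedent \<open>verum\<close>.\<close>

lemma inconsistent_PrEq:
  assumes "\<And>\<epsilon>. 0 \<le> \<epsilon> \<Longrightarrow> \<epsilon> \<le> 1 \<Longrightarrow> inconsistent (insert (PrEq \<sigma> \<alpha> \<epsilon>) \<Gamma>)" and "\<alpha> \<in> CO \<sigma>"
  shows "inconsistent \<Gamma>"
proof -
  have "derivable \<sigma> \<Gamma> (imp \<sigma> (verum \<sigma>) (PrNe \<sigma> \<alpha> \<epsilon>))" if "0 \<le> \<epsilon>" "\<epsilon> \<le> 1" for \<epsilon>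
  proof -
    \<comment> \<open>Purely propositional: \<open>PrLe\<close> is literally the \<open>wneg\<close>
      of \<open>PrGt\<close>, and \<open>PrLt\<close> that of \<open>PrGe\<close>, so
      \<open>PrEq\<close> and \<open>PrNe\<close> are combinations of the two atoms
      \<open>PrGe\<close> and \<open>PrGt\<close>.\<close>
    have "provable \<sigma> (imp \<sigma> (imp \<sigma> (PrEq \<sigma> \<alpha> \<epsilon>) (falsum \<sigma>)) (imp \<sigma> (verum \<sigma>) (PrNe \<sigma> \<alpha> \<epsilon>)))"
      using taut[of "PImp (PImp (PAnd (PVar 0) (PNot (PVar 1))) PBot)
        (PImp PTop (POr (PVar 1) (PNot (PVar 0))))" "[PrGe \<alpha> \<epsilon>, PrGt \<alpha> \<epsilon>]"] assms that
      by (auto simp: tautology_def nthd_def PrEq_def PrNe_def)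
    moreover have "derivable \<sigma> \<Gamma> (imp \<sigma> (PrEq \<sigma> \<alpha> \<epsilon>) (falsum \<sigma>))"
      using assms that by (intro deduction) auto
    ultimately show ?thesis by (blast intro: derivable_MP provable_imp_derivable)
  qed
  then have "rule \<sigma> {\<theta>. derivable \<sigma> \<Gamma> \<theta>} (imp \<sigma> (verum \<sigma>) (falsum \<sigma>))"
    using assms by (intro rule.Bot_omega[of _ _ \<alpha>]) auto
  then have "derivable \<sigma> \<Gamma> (imp \<sigma> (verum \<sigma>) (falsum \<sigma>))" by (rule derivable_rule) simp
  then show ?thesis using provable_verum by (blast intro: derivable_MP provable_imp_derivable)
qed

text \<open>Deciding a formula and fixing a probability are demands of the same shape: one element
  of a set R is to be added. There are countably many demands, and each can be met without losing
  consistency, so stage n settles the n-th one.\<close>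

lemma complete_extension:
  assumes \<Gamma>: "\<Gamma> \<subseteq> PCO \<sigma>" and cons: "\<not> inconsistent \<Gamma>"
  shows "\<exists>\<Delta>. \<Gamma> \<subseteq> \<Delta> \<and> complete_theory \<Delta>"
proof -
  define Rs where "Rs = (\<lambda>\<psi>. {\<psi>, wneg \<sigma> \<psi>}) ` PCO \<sigma> \<union>
    (\<lambda>\<alpha>. {PrEq \<sigma> \<alpha> \<epsilon> | \<epsilon>. 0 \<le> \<epsilon> \<and> \<epsilon> \<le> 1}) ` CO \<sigma>"
  have ext: "\<exists>\<chi>\<in>R. \<not> inconsistent (insert \<chi> \<Gamma>)" if R: "R \<in> Rs" and c: "\<not> inconsistent \<Gamma>" for R \<Gamma>
  proof -
    from R have "R \<in> (\<lambda>\<psi>. {\<psi>, wneg \<sigma> \<psi>}) ` PCO \<sigma> \<or>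
        R \<in> (\<lambda>\<alpha>. {PrEq \<sigma> \<alpha> \<epsilon> | \<epsilon>. 0 \<le> \<epsilon> \<and> \<epsilon> \<le> 1}) ` CO \<sigma>"
      by (simp only: Rs_def Un_iff)
    then show ?thesis
    proof
      assume "R \<in> (\<lambda>\<psi>. {\<psi>, wneg \<sigma> \<psi>}) ` PCO \<sigma>"
      then obtain \<psi> where "R = {\<psi>, wneg \<sigma> \<psi>}" "\<psi> \<in> PCO \<sigma>" by (rule imageE)
      then show ?thesis using c inconsistent_cases[of \<psi> \<Gamma>] by auto
    next
      assume "R \<in> (\<lambda>\<alpha>. {PrEq \<sigma> \<alpha> \<epsilon> | \<epsilon>. 0 \<le> \<epsilon> \<and> \<epsilon> \<le> 1}) ` CO \<sigma>"
      then obtain \<alpha> where \<alpha>: "R = {PrEq \<sigma> \<alpha> \<epsilon> | \<epsilon>. 0 \<le> \<epsilon> \<and> \<epsilon> \<le> 1}" "\<alpha> \<in> CO \<sigma>"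
        by (rule imageE)
      show ?thesis
      proof (rule ccontr)
        assume "\<not> (\<exists>\<chi>\<in>R. \<not> inconsistent (insert \<chi> \<Gamma>))"
        then have "inconsistent (insert (PrEq \<sigma> \<alpha> \<epsilon>) \<Gamma>)" if "0 \<le> \<epsilon>" "\<epsilon> \<le> 1" for \<epsilon>
          using \<alpha>(1) that by auto
        then have "inconsistent \<Gamma>" using \<alpha>(2) by (rule inconsistent_PrEq)
        then show False using c by simp
      qed
    qed
  qed
  have sub: "R \<subseteq> PCO \<sigma>" if "R \<in> Rs" for R using that by (auto simp: Rs_def)
  have "countable (CO \<sigma>)" by (rule countable_subset[OF _ countable_PCO]) (auto simp: CO_subset_PCO)
  then have "countable Rs" unfolding Rs_def using countable_PCO by auto
  moreover have "Rs \<noteq> {}" using falsum_verum_PCO unfolding Rs_def by blast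
  moreover define req where "req = from_nat_into Rs"
  ultimately have req: "range req = Rs" by (simp add: range_from_nat_into)
  have "\<forall>n \<Delta>. \<exists>\<chi>. \<not> inconsistent \<Delta> \<longrightarrow> \<chi> \<in> req n \<and> \<not> inconsistent (insert \<chi> \<Delta>)"
  proof (intro allI)
    fix n \<Delta>
    have "req n \<in> Rs" using req by blast
    from ext[OF this, of \<Delta>]
    show "\<exists>\<chi>. \<not> inconsistent \<Delta> \<longrightarrow> \<chi> \<in> req n \<and> \<not> inconsistent (insert \<chi> \<Delta>)" by blast
  qed
  then obtain pick where
    "\<forall>n \<Delta>. \<not> inconsistent \<Delta> \<longrightarrow> pick n \<Delta> \<in> req n \<and> \<not> inconsistent (insert (pick n \<Delta>) \<Delta>)"
    unfolding choice_iff ..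
  then have pick: "pick n \<Delta> \<in> req n" "\<not> inconsistent (insert (pick n \<Delta>) \<Delta>)"
    if "\<not> inconsistent \<Delta>" for n \<Delta>
    using that by simp_all
  define D where "D = rec_nat \<Gamma> (\<lambda>n \<Delta>. insert (pick n \<Delta>) \<Delta>)"
  have D0: "D 0 = \<Gamma>" and DS: "D (Suc n) = insert (pick n (D n)) (D n)" for n
    by (simp_all add: D_def)
  have cons: "\<not> inconsistent (D n)" for n
    by (induction n) (simp_all add: D0 cons DS pick)
  have step: "\<exists>\<chi>\<in>req n. \<chi> \<in> D (Suc n)" for n
    using pick(1)[OF cons[of n], of n] by (auto simp: DS)
  have mono: "D m \<subseteq> D n" if "m \<le> n" for m n
    using that by (rule lift_Suc_mono_le[rotated]) (auto simp: DS)
  define \<Delta> where "\<Delta> = (\<Union>n. D n)"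
  have "D n \<subseteq> PCO \<sigma>" for n
  proof (induction n)
    case 0 then show ?case using \<Gamma> D0 by simp
  next
    case (Suc n)
    have "pick n (D n) \<in> req n" by (rule pick(1)[OF cons])
    moreover have "req n \<subseteq> PCO \<sigma>" by (rule sub) (use req in blast)
    ultimately show ?case using Suc DS by auto
  qed
  then have PCO: "\<Delta> \<subseteq> PCO \<sigma>" by (auto simp: \<Delta>_def)
  \<comment> \<open>Stated for derivations from one stage, not from \<Delta>: an infinitary
    derivation may use hypotheses from infinitely many stages, and consistency is known of the
    stages only. If \<phi> were missing, its \<open>wneg\<close> would have been picked, and both
    would be derivable at a common stage.\<close>
  have closed: "\<phi> \<in> \<Delta>" if "derivable \<sigma> (D n) \<phi>" for \<phi> n
  proof (rule ccontr)
    assume "\<phi> \<notin> \<Delta>"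
    have "{\<phi>, wneg \<sigma> \<phi>} \<in> Rs" using derivable_PCO[OF that] by (auto simp: Rs_def)
    then obtain k where "req k = {\<phi>, wneg \<sigma> \<phi>}" unfolding req[symmetric] by force
    then have "wneg \<sigma> \<phi> \<in> D (Suc k)" using step[of k] \<open>\<phi> \<notin> \<Delta>\<close> by (auto simp: \<Delta>_def)
    then have "derivable \<sigma> (D (max n (Suc k))) (wneg \<sigma> \<phi>)"
      using mono[of "Suc k" "max n (Suc k)"] derivable_PCO[OF that] by (intro derivable_hyp) auto
    moreover have "derivable \<sigma> (D (max n (Suc k))) \<phi>"
      using that by (rule derivable_mono) (rule mono, simp)
    ultimately show False using cons inconsistent_pair by blast
  qed
  have "complete_theory \<Delta>"
    unfolding complete_theory_def
  proof (intro conjI ballI allI impI)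
    show "{\<phi>. provable \<sigma> \<phi>} \<subseteq> \<Delta>" using closed provable_imp_derivable by blast
    show "falsum \<sigma> \<notin> \<Delta>"
    proof
      assume "falsum \<sigma> \<in> \<Delta>"
      then show False using cons derivable_hyp[of "falsum \<sigma>"] by (auto simp: \<Delta>_def)
    qed
    show "\<chi> \<in> \<Delta>" if prems: "\<psi> \<in> \<Delta>" "imp \<sigma> \<psi> \<chi> \<in> \<Delta>" for \<psi> \<chi>
    proof -
      obtain m n where "\<psi> \<in> D m" "imp \<sigma> \<psi> \<chi> \<in> D n" using prems by (auto simp: \<Delta>_def)
      then have "\<psi> \<in> D (max m n)" "imp \<sigma> \<psi> \<chi> \<in> D (max m n)"
        using mono[of m "max m n"] mono[of n "max m n"] by auto
      then have "derivable \<sigma> (D (max m n)) \<psi>" "derivable \<sigma> (D (max m n)) (imp \<sigma> \<psi> \<chi>)"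
        using prems PCO by (auto intro: derivable_hyp)
      then show ?thesis by (rule closed[OF derivable_MP])
    qed
    show "\<psi> \<in> \<Delta> \<or> wneg \<sigma> \<psi> \<in> \<Delta>" if "\<psi> \<in> PCO \<sigma>" for \<psi>
    proof -
      have "{\<psi>, wneg \<sigma> \<psi>} \<in> Rs" using that by (auto simp: Rs_def)
      then obtain k where "req k = {\<psi>, wneg \<sigma> \<psi>}" unfolding req[symmetric] by force
      then show ?thesis using step[of k] by (auto simp: \<Delta>_def)
    qed
    show "\<exists>\<epsilon>. 0 \<le> \<epsilon> \<and> \<epsilon> \<le> 1 \<and> PrEq \<sigma> \<alpha> \<epsilon> \<in> \<Delta>" if "\<alpha> \<in> CO \<sigma>" for \<alpha>
    proof -
      have "{PrEq \<sigma> \<alpha> \<epsilon> | \<epsilon>. 0 \<le> \<epsilon> \<and> \<epsilon> \<le> 1} \<in> Rs" using that by (auto simp: Rs_def)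
      then obtain k where "req k = {PrEq \<sigma> \<alpha> \<epsilon> | \<epsilon>. 0 \<le> \<epsilon> \<and> \<epsilon> \<le> 1}" unfolding req[symmetric] by force
      then show ?thesis using step[of k] by (auto simp: \<Delta>_def)
    qed
  qed (rule PCO)
  moreover have "\<Gamma> \<subseteq> \<Delta>" using D0 by (auto simp: \<Delta>_def)
  ultimately show ?thesis by blast
qed

lemma not_derivable_complete:
  assumes "\<Gamma> \<subseteq> PCO \<sigma>" "\<phi> \<in> PCO \<sigma>" "\<not> derivable \<sigma> \<Gamma> \<phi>"
  shows "\<exists>\<Delta>. insert (wneg \<sigma> \<phi>) \<Gamma> \<subseteq> \<Delta> \<and> complete_theory \<Delta>"
proof (rule complete_extension)
  show "\<not> inconsistent (insert (wneg \<sigma> \<phi>) \<Gamma>)"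
  proof
    assume "inconsistent (insert (wneg \<sigma> \<phi>) \<Gamma>)"
    then have "derivable \<sigma> \<Gamma> (imp \<sigma> (wneg \<sigma> \<phi>) (falsum \<sigma>))" using assms by (intro deduction) auto
    moreover have "provable \<sigma> (imp \<sigma> (imp \<sigma> (wneg \<sigma> \<phi>) (falsum \<sigma>)) \<phi>)"
      using taut[of "PImp (PImp (PNot (PVar 0)) PBot) (PVar 0)" "[\<phi>]"] assms
      by (simp add: tautology_def nthd_def)
    ultimately show False using assms(3) by (blast intro: derivable_MP provable_imp_derivable)
  qed
qed (use assms in auto)

section \<open>Membership in a complete theory\<close>

lemma ct_PCO: "complete_theory \<Delta> \<Longrightarrow> \<phi> \<in> \<Delta> \<Longrightarrow> \<phi> \<in> PCO \<sigma>"
  and ct_thm: "complete_theory \<Delta> \<Longrightarrow> provable \<sigma> \<phi> \<Longrightarrow> \<phi> \<in> \<Delta>"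
  and ct_falsum: "complete_theory \<Delta> \<Longrightarrow> falsum \<sigma> \<notin> \<Delta>"
  and ct_MP: "complete_theory \<Delta> \<Longrightarrow> imp \<sigma> \<psi> \<chi> \<in> \<Delta> \<Longrightarrow> \<psi> \<in> \<Delta> \<Longrightarrow> \<chi> \<in> \<Delta>"
  and ct_prime: "complete_theory \<Delta> \<Longrightarrow> \<psi> \<in> PCO \<sigma> \<Longrightarrow> \<psi> \<in> \<Delta> \<or> wneg \<sigma> \<psi> \<in> \<Delta>"
  and ct_PrEq: "complete_theory \<Delta> \<Longrightarrow> \<alpha> \<in> CO \<sigma> \<Longrightarrow> \<exists>\<epsilon>. 0 \<le> \<epsilon> \<and> \<epsilon> \<le> 1 \<and> PrEq \<sigma> \<alpha> \<epsilon> \<in> \<Delta>"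
  unfolding complete_theory_def by blast+

lemma ct_axiom: "complete_theory \<Delta> \<Longrightarrow> axiom \<sigma> \<phi> \<Longrightarrow> \<phi> \<in> \<Delta>"
  by (simp add: ct_thm provable_axiom)

lemma ct_axiom_imp: "complete_theory \<Delta> \<Longrightarrow> axiom \<sigma> (imp \<sigma> \<phi> \<psi>) \<Longrightarrow> \<phi> \<in> \<Delta> \<Longrightarrow> \<psi> \<in> \<Delta>"
  using ct_axiom ct_MP by blast

lemma ct_wneg:
  assumes ct: "complete_theory \<Delta>" and "\<psi> \<in> PCO \<sigma>"
  shows "wneg \<sigma> \<psi> \<in> \<Delta> \<longleftrightarrow> \<psi> \<notin> \<Delta>"
proof
  assume *: "wneg \<sigma> \<psi> \<in> \<Delta>"
  have "provable \<sigma> (imp \<sigma> \<psi> (imp \<sigma> (wneg \<sigma> \<psi>) (falsum \<sigma>)))"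
    using taut[of "PImp (PVar 0) (PImp (PNot (PVar 0)) PBot)" "[\<psi>]"] assms
    by (simp add: tautology_def nthd_def)
  then show "\<psi> \<notin> \<Delta>" using * ct_thm[OF ct] ct_MP[OF ct] ct_falsum[OF ct] by blast
qed (use ct_prime[OF assms] in blast)

lemma ct_And:
  assumes ct: "complete_theory \<Delta>"
  shows "And \<phi> \<psi> \<in> \<Delta> \<longleftrightarrow> \<phi> \<in> \<Delta> \<and> \<psi> \<in> \<Delta>"
proof (cases "\<phi> \<in> PCO \<sigma> \<and> \<psi> \<in> PCO \<sigma>")
  case True
  have "provable \<sigma> (imp \<sigma> \<phi> (imp \<sigma> \<psi> (And \<phi> \<psi>)))"
    using taut[of "PImp (PVar 0) (PImp (PVar 1) (PAnd (PVar 0) (PVar 1)))" "[\<phi>, \<psi>]"] True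
    by (simp add: tautology_def nthd_def)
  moreover have "provable \<sigma> (imp \<sigma> (And \<phi> \<psi>) \<phi>)"
    using taut[of "PImp (PAnd (PVar 0) (PVar 1)) (PVar 0)" "[\<phi>, \<psi>]"] True
    by (simp add: tautology_def nthd_def)
  moreover have "provable \<sigma> (imp \<sigma> (And \<phi> \<psi>) \<psi>)"
    using taut[of "PImp (PAnd (PVar 0) (PVar 1)) (PVar 1)" "[\<phi>, \<psi>]"] True
    by (simp add: tautology_def nthd_def)
  ultimately show ?thesis using ct_thm[OF ct] ct_MP[OF ct] by metis
next
  case False
  then show ?thesis using ct_PCO[OF ct] by (metis PCO_simps(7))
qed

lemma ct_Or:
  assumes ct: "complete_theory \<Delta>" and "\<phi> \<in> PCO \<sigma>" "\<psi> \<in> PCO \<sigma>"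
  shows "Or \<phi> \<psi> \<in> \<Delta> \<longleftrightarrow> \<phi> \<in> \<Delta> \<or> \<psi> \<in> \<Delta>"
proof -
  have "provable \<sigma> (imp \<sigma> (Or \<phi> \<psi>) (imp \<sigma> (wneg \<sigma> \<phi>) \<psi>))"
    using taut[of "PImp (POr (PVar 0) (PVar 1)) (PImp (PNot (PVar 0)) (PVar 1))" "[\<phi>, \<psi>]"] assms
    by (auto simp: tautology_def nthd_def)
  moreover have "provable \<sigma> (imp \<sigma> \<phi> (Or \<phi> \<psi>))"
    using taut[of "PImp (PVar 0) (POr (PVar 0) (PVar 1))" "[\<phi>, \<psi>]"] assms
    by (simp add: tautology_def nthd_def)
  moreover have "provable \<sigma> (imp \<sigma> \<psi> (Or \<phi> \<psi>))"
    using taut[of "PImp (PVar 1) (POr (PVar 0) (PVar 1))" "[\<phi>, \<psi>]"] assms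
    by (simp add: tautology_def nthd_def)
  ultimately show ?thesis
    using ct_thm[OF ct] ct_MP[OF ct] ct_wneg[OF ct assms(2)] by metis
qed

lemma ct_axiom_iff:
  assumes ct: "complete_theory \<Delta>" and "axiom \<sigma> (iff \<sigma> \<phi> \<psi>)"
  shows "\<phi> \<in> \<Delta> \<longleftrightarrow> \<psi> \<in> \<Delta>"
  using ct_axiom[OF assms] ct_MP[OF ct] unfolding iff_def ct_And[OF ct] by metis

lemma ct_big_Or:
  assumes ct: "complete_theory \<Delta>" and "set xs \<subseteq> PCO \<sigma>" "big Or (falsum \<sigma>) xs \<in> \<Delta>"
  shows "\<exists>x\<in>set xs. x \<in> \<Delta>"
  using assms(2,3)
proof (induction xs rule: induct_list012)
  case 1 then show ?case using ct_falsum[OF ct] by simp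
next
  case (3 a b xs)
  then show ?case using ct_Or[OF ct, of a "big Or (falsum \<sigma>) (b # xs)"] big_Or_PCO[of "b # xs"] by auto
qed auto

lemma ct_big_And:
  assumes ct: "complete_theory \<Delta>" and "set xs \<subseteq> \<Delta>"
  shows "big And (verum \<sigma>) xs \<in> \<Delta>"
  using assms(2)
  by (induction xs rule: induct_list012) (auto simp: ct_And[OF ct] ct_thm[OF ct] provable_verum)

lemma ct_big_And_D:
  assumes ct: "complete_theory \<Delta>" and "big And (verum \<sigma>) xs \<in> \<Delta>" "x \<in> set xs"
  shows "x \<in> \<Delta>"
  using assms(2,3) by (induction xs rule: induct_list012) (auto simp: ct_And[OF ct])

lemma ct_Imp_MP:
  assumes ct: "complete_theory \<Delta>" and "Imp \<alpha> \<psi> \<in> \<Delta>" "\<alpha> \<in> \<Delta>"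
  shows "\<psi> \<in> \<Delta>"
  using assms ct_axiom_imp[OF ct axiom.O4, of \<alpha> \<psi>] ct_PCO[OF ct assms(2)] ct_MP[OF ct] by auto

lemma ct_taut_CO:
  assumes "complete_theory \<Delta>" "tautology p" "set xs \<subseteq> CO \<sigma>"
  shows "inst_CO \<sigma> (nthd (verum \<sigma>) xs) p \<in> \<Delta>"
  using assms by (simp add: ct_thm taut_CO)

lemma ct_neg: "complete_theory \<Delta> \<Longrightarrow> neg \<sigma> \<alpha> \<in> \<Delta> \<Longrightarrow> \<alpha> \<notin> \<Delta>"
  using ct_Imp_MP ct_falsum unfolding neg_def by blast

text \<open>Only the introduction direction holds for \<open>disj\<close>: a disjunction may be
  certain although neither disjunct is. The converse is recovered for theories of a single state in
  \<open>state_theory_big_disj\<close>.\<close>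

lemma ct_disjI:
  assumes ct: "complete_theory \<Delta>" and "\<alpha> \<in> CO \<sigma>" "\<beta> \<in> CO \<sigma>" "\<alpha> \<in> \<Delta> \<or> \<beta> \<in> \<Delta>"
  shows "disj \<sigma> \<alpha> \<beta> \<in> \<Delta>"
proof -
  have "Imp \<alpha> (disj \<sigma> \<alpha> \<beta>) \<in> \<Delta>"
    using ct_taut_CO[OF ct, of "PImp (PVar 0) (POr (PVar 0) (PVar 1))" "[\<alpha>, \<beta>]"] assms
    by (simp add: tautology_def nthd_def)
  moreover have "Imp \<beta> (disj \<sigma> \<alpha> \<beta>) \<in> \<Delta>"
    using ct_taut_CO[OF ct, of "PImp (PVar 1) (POr (PVar 0) (PVar 1))" "[\<alpha>, \<beta>]"] assms
    by (simp add: tautology_def nthd_def)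
  ultimately show ?thesis using assms(4) ct_Imp_MP[OF ct] by blast
qed

lemma ct_big_disjI:
  assumes ct: "complete_theory \<Delta>" and "set xs \<subseteq> CO \<sigma>" "x \<in> set xs" "x \<in> \<Delta>"
  shows "big (disj \<sigma>) (falsum \<sigma>) xs \<in> \<Delta>"
  using assms(2,3)
proof (induction xs rule: induct_list012)
  case (3 a b xs)
  then show ?case
    using ct_disjI[OF ct, of a "big (disj \<sigma>) (falsum \<sigma>) (b # xs)"] big_disj_CO[of "b # xs"] assms(4)
    by auto
qed (use assms(4) in auto)

subsection \<open>Probability values\<close>

definition val :: "('v, 'a) fm set \<Rightarrow> ('v, 'a) fm \<Rightarrow> rat" where
  "val \<Delta> \<alpha> = (THE \<epsilon>. PrEq \<sigma> \<alpha> \<epsilon> \<in> \<Delta>)"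

context
  fixes \<Delta> :: "('v, 'a) fm set" and \<alpha> :: "('v, 'a) fm"
  assumes ct: "complete_theory \<Delta>" and CO: "\<alpha> \<in> CO \<sigma>"
begin

text \<open>\<open>P4\<close> raises the upper bound to \<open>PrLt\<close> with \<delta>, which is
  the \<open>wneg\<close> of \<open>PrGe\<close> with \<delta>.\<close>

lemma PrLe_less:
  "PrLe \<sigma> \<alpha> \<epsilon> \<in> \<Delta> \<Longrightarrow> \<epsilon> < \<delta> \<Longrightarrow> \<delta> \<le> 1 \<Longrightarrow> PrGe \<alpha> \<delta> \<notin> \<Delta>"
  using ct_axiom_imp[OF ct axiom.P4[OF CO], of \<epsilon> \<delta>] ct_PCO[OF ct, of "PrLe \<sigma> \<alpha> \<epsilon>"]
    ct_wneg[OF ct, of "PrGe \<alpha> \<delta>"] CO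
  by auto

lemma PrEq_unique:
  assumes "PrEq \<sigma> \<alpha> \<epsilon> \<in> \<Delta>" "PrEq \<sigma> \<alpha> \<delta> \<in> \<Delta>"
  shows "\<epsilon> = \<delta>"
proof -
  have "\<epsilon> \<le> 1" "\<delta> \<le> 1" using assms ct_PCO[OF ct] by fastforce+
  then show ?thesis
    using assms PrLe_less[of \<epsilon> \<delta>] PrLe_less[of \<delta> \<epsilon>] unfolding PrEq_def
    by (auto simp: ct_And[OF ct] intro: linorder_cases[of \<epsilon> \<delta>])
qed

lemma PrEq_val: "PrEq \<sigma> \<alpha> (val \<Delta> \<alpha>) \<in> \<Delta>"
  unfolding val_def using ct_PrEq[OF ct CO] PrEq_unique by (metis (mono_tags, lifting) theI')

lemma PrEq_iff: "PrEq \<sigma> \<alpha> \<epsilon> \<in> \<Delta> \<longleftrightarrow> val \<Delta> \<alpha> = \<epsilon>"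
  using PrEq_val PrEq_unique by blast

lemma val_bounds: "0 \<le> val \<Delta> \<alpha>" "val \<Delta> \<alpha> \<le> 1"
  using ct_PCO[OF ct PrEq_val] by auto

lemma PrGe_iff:
  assumes "0 \<le> \<epsilon>" "\<epsilon> \<le> 1"
  shows "PrGe \<alpha> \<epsilon> \<in> \<Delta> \<longleftrightarrow> \<epsilon> \<le> val \<Delta> \<alpha>"
proof
  have v: "PrGe \<alpha> (val \<Delta> \<alpha>) \<in> \<Delta>" "PrLe \<sigma> \<alpha> (val \<Delta> \<alpha>) \<in> \<Delta>"
    using PrEq_val by (auto simp: PrEq_def ct_And[OF ct])
  show "\<epsilon> \<le> val \<Delta> \<alpha>" if "PrGe \<alpha> \<epsilon> \<in> \<Delta>"
    using PrLe_less[OF v(2), of \<epsilon>] assms that by fastforce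
  show "PrGe \<alpha> \<epsilon> \<in> \<Delta>" if "\<epsilon> \<le> val \<Delta> \<alpha>"
  proof (rule ccontr)
    assume "PrGe \<alpha> \<epsilon> \<notin> \<Delta>"
    moreover from this have "\<epsilon> < val \<Delta> \<alpha>" using v(1) that by (cases "\<epsilon> = val \<Delta> \<alpha>") auto
    \<comment> \<open>Failure of \<open>PrGe\<close> amounts to \<open>PrLt\<close>, which
      \<open>P5\<close> weakens to \<open>PrLe\<close>; by \<open>PrLe_less\<close> this excludes
      the larger value.\<close>
    moreover have "PrLe \<sigma> \<alpha> \<epsilon> \<in> \<Delta>"
      using calculation(1) ct_wneg[OF ct, of "PrGe \<alpha> \<epsilon>"] ct_axiom_imp[OF ct axiom.P5[OF CO assms]] assms CO
      by simp
    ultimately show False using PrLe_less v(1) val_bounds by blast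
  qed
qed

lemma PrGt_iff:
  assumes "0 \<le> \<epsilon>" "\<epsilon> \<le> 1"
  shows "PrGt \<alpha> \<epsilon> \<in> \<Delta> \<longleftrightarrow> \<epsilon> < val \<Delta> \<alpha>"
proof -
  have v: "PrLe \<sigma> \<alpha> (val \<Delta> \<alpha>) \<in> \<Delta>"
    using PrEq_val by (auto simp: PrEq_def ct_And[OF ct])
  have le: "PrLe \<sigma> \<alpha> \<epsilon> \<in> \<Delta> \<longleftrightarrow> PrGt \<alpha> \<epsilon> \<notin> \<Delta>"
    using ct_wneg[OF ct, of "PrGt \<alpha> \<epsilon>"] CO assms by simp
  have "PrLe \<sigma> \<alpha> \<epsilon> \<in> \<Delta> \<longleftrightarrow> val \<Delta> \<alpha> \<le> \<epsilon>"
  proof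
    show "val \<Delta> \<alpha> \<le> \<epsilon>" if "PrLe \<sigma> \<alpha> \<epsilon> \<in> \<Delta>"
      using PrLe_less[OF that, of "val \<Delta> \<alpha>"] PrGe_iff[OF val_bounds] val_bounds by fastforce
    show "PrLe \<sigma> \<alpha> \<epsilon> \<in> \<Delta>" if "val \<Delta> \<alpha> \<le> \<epsilon>"
    proof (cases "val \<Delta> \<alpha> = \<epsilon>")
      case False
      then have "PrLt \<sigma> \<alpha> \<epsilon> \<in> \<Delta>"
        using PrGe_iff[OF assms] ct_wneg[OF ct, of "PrGe \<alpha> \<epsilon>"] CO assms that by simp
      then show ?thesis by (rule ct_axiom_imp[OF ct axiom.P5[OF CO assms]])
    qed (use v in simp)
  qed
  then show ?thesis using le by auto
qed

lemma mem_iff_val: "\<alpha> \<in> \<Delta> \<longleftrightarrow> val \<Delta> \<alpha> = 1"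
  using ct_axiom_iff[OF ct axiom.P1[OF CO]] PrEq_iff by simp

lemma neg_mem_iff_val: "neg \<sigma> \<alpha> \<in> \<Delta> \<longleftrightarrow> val \<Delta> \<alpha> = 0"
  using ct_axiom_imp[OF ct axiom.O1b[OF CO]] ct_axiom_imp[OF ct axiom.O1[OF CO, of "falsum \<sigma>"]] PrEq_iff
  unfolding neg_def by auto

end

lemma PrGeP_iff:
  assumes ct: "complete_theory \<Delta>" and CO: "\<alpha> \<in> CO \<sigma>" "\<beta> \<in> CO \<sigma>"
  shows "PrGeP \<alpha> \<beta> \<in> \<Delta> \<longleftrightarrow> val \<Delta> \<beta> \<le> val \<Delta> \<alpha>" "PrGtP \<beta> \<alpha> \<in> \<Delta> \<longleftrightarrow> val \<Delta> \<alpha> < val \<Delta> \<beta>"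
proof -
  have a: "PrEq \<sigma> \<alpha> (val \<Delta> \<alpha>) \<in> \<Delta>" and b: "PrEq \<sigma> \<beta> (val \<Delta> \<beta>) \<in> \<Delta>"
    using PrEq_val assms by auto
  have ba: "0 \<le> val \<Delta> \<alpha>" "val \<Delta> \<alpha> \<le> 1" and bb: "0 \<le> val \<Delta> \<beta>" "val \<Delta> \<beta> \<le> 1"
    using val_bounds assms by auto
  have 1: "PrGtP \<beta> \<alpha> \<in> \<Delta> \<longleftrightarrow> PrGeP \<alpha> \<beta> \<notin> \<Delta>" using ct_wneg[OF ct, of "PrGeP \<alpha> \<beta>"] CO by simp
  have 2: "PrGeP \<alpha> \<beta> \<in> \<Delta>" if "val \<Delta> \<beta> \<le> val \<Delta> \<alpha>"
    using ct_axiom_imp[OF ct axiom.CP1[OF CO bb(1) that ba(2)]] a b by (simp add: ct_And[OF ct])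
  have 3: "PrGtP \<beta> \<alpha> \<in> \<Delta>" if "val \<Delta> \<alpha> < val \<Delta> \<beta>"
    using ct_axiom_imp[OF ct axiom.CP2[OF CO(2,1) ba(1) that bb(2)]] a b by (simp add: ct_And[OF ct])
  show "PrGeP \<alpha> \<beta> \<in> \<Delta> \<longleftrightarrow> val \<Delta> \<beta> \<le> val \<Delta> \<alpha>" "PrGtP \<beta> \<alpha> \<in> \<Delta> \<longleftrightarrow> val \<Delta> \<alpha> < val \<Delta> \<beta>"
    using 1 2 3 by (meson not_le)+
qed

subsection \<open>Conditioning and intervening on a complete theory\<close>

text \<open>Conditioning (\<open>Imp \<alpha>\<close>) and intervening (\<open>Cf E\<close>) are
  treated together as an operator C. Primeness comes from putting the theorem
  \<open>Or \<phi> (wneg \<phi>)\<close> under C and splitting it with \<open>dis\<close>. It is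
  offered to \<open>pr\<close> as a premise because for \<open>Cf\<close> the upper bound on a
  probability is obtained from primeness.\<close>

lemma complete_theory_image:
  assumes ct: "complete_theory \<Delta>"
    and PCO: "\<And>\<phi>. C \<phi> \<in> PCO \<sigma> \<Longrightarrow> \<phi> \<in> PCO \<sigma>"
    and nec: "\<And>\<phi>. provable \<sigma> \<phi> \<Longrightarrow> C \<phi> \<in> \<Delta>"
    and mon: "\<And>\<phi> \<psi>. \<phi> \<in> PCO \<sigma> \<Longrightarrow> \<psi> \<in> PCO \<sigma> \<Longrightarrow> provable \<sigma> (imp \<sigma> \<phi> \<psi>) \<Longrightarrow> C \<phi> \<in> \<Delta> \<Longrightarrow> C \<psi> \<in> \<Delta>"
    and conj: "\<And>\<phi> \<psi>. C \<phi> \<in> \<Delta> \<Longrightarrow> C \<psi> \<in> \<Delta> \<Longrightarrow> C (And \<phi> \<psi>) \<in> \<Delta>"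
    and dis: "\<And>\<phi> \<psi>. C (Or \<phi> \<psi>) \<in> \<Delta> \<Longrightarrow> C \<phi> \<in> \<Delta> \<or> C \<psi> \<in> \<Delta>"
    and bot: "C (falsum \<sigma>) \<notin> \<Delta>"
    and pr: "\<And>\<alpha>. \<alpha> \<in> CO \<sigma> \<Longrightarrow> (\<And>\<phi>. \<phi> \<in> PCO \<sigma> \<Longrightarrow> C \<phi> \<in> \<Delta> \<or> C (wneg \<sigma> \<phi>) \<in> \<Delta>) \<Longrightarrow>
      \<exists>\<epsilon>. 0 \<le> \<epsilon> \<and> \<epsilon> \<le> 1 \<and> C (PrEq \<sigma> \<alpha> \<epsilon>) \<in> \<Delta>"
  shows "complete_theory {\<phi>. C \<phi> \<in> \<Delta>}"
proof -
  have P: "\<phi> \<in> PCO \<sigma>" if "C \<phi> \<in> \<Delta>" for \<phi> using that ct_PCO[OF ct] PCO by blast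
  have prime: "C \<phi> \<in> \<Delta> \<or> C (wneg \<sigma> \<phi>) \<in> \<Delta>" if "\<phi> \<in> PCO \<sigma>" for \<phi>
  proof -
    have "provable \<sigma> (Or \<phi> (wneg \<sigma> \<phi>))"
      using taut[of "POr (PVar 0) (PNot (PVar 0))" "[\<phi>]"] that by (simp add: tautology_def nthd_def)
    then show ?thesis using nec dis by blast
  qed
  have MP: "C \<chi> \<in> \<Delta>" if "C \<psi> \<in> \<Delta>" "C (imp \<sigma> \<psi> \<chi>) \<in> \<Delta>" for \<psi> \<chi>
  proof -
    have *: "\<psi> \<in> PCO \<sigma>" "\<chi> \<in> PCO \<sigma>" using that P imp_PCO_D by blast+
    then have "provable \<sigma> (imp \<sigma> (And \<psi> (imp \<sigma> \<psi> \<chi>)) \<chi>)"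
      using taut[of "PImp (PAnd (PVar 0) (PImp (PVar 0) (PVar 1))) (PVar 1)" "[\<psi>, \<chi>]"]
      by (simp add: tautology_def nthd_def)
    from mon[OF _ _ this] show ?thesis using conj[OF that] * by simp
  qed
  have "\<exists>\<epsilon>. 0 \<le> \<epsilon> \<and> \<epsilon> \<le> 1 \<and> C (PrEq \<sigma> \<alpha> \<epsilon>) \<in> \<Delta>" if "\<alpha> \<in> CO \<sigma>" for \<alpha>
    using that prime by (rule pr)
  then have "\<forall>\<alpha>\<in>CO \<sigma>. \<exists>\<epsilon>. 0 \<le> \<epsilon> \<and> \<epsilon> \<le> 1 \<and> PrEq \<sigma> \<alpha> \<epsilon> \<in> {\<phi>. C \<phi> \<in> \<Delta>}" by simp
  moreover have "{\<phi>. C \<phi> \<in> \<Delta>} \<subseteq> PCO \<sigma>" using P by blast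
  moreover have "{\<phi>. provable \<sigma> \<phi>} \<subseteq> {\<phi>. C \<phi> \<in> \<Delta>}" using nec by blast
  moreover have "\<forall>\<psi>\<in>{\<phi>. C \<phi> \<in> \<Delta>}. \<forall>\<chi>. imp \<sigma> \<psi> \<chi> \<in> {\<phi>. C \<phi> \<in> \<Delta>} \<longrightarrow> \<chi> \<in> {\<phi>. C \<phi> \<in> \<Delta>}"
    unfolding mem_Collect_eq using MP by blast
  moreover have "\<forall>\<psi>\<in>PCO \<sigma>. \<psi> \<in> {\<phi>. C \<phi> \<in> \<Delta>} \<or> wneg \<sigma> \<psi> \<in> {\<phi>. C \<phi> \<in> \<Delta>}"
    using prime by simp
  moreover have "falsum \<sigma> \<notin> {\<phi>. C \<phi> \<in> \<Delta>}" using bot by simp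
  ultimately show ?thesis unfolding complete_theory_def by (intro conjI)
qed

definition cond :: "('v, 'a) fm set \<Rightarrow> ('v, 'a) fm \<Rightarrow> ('v, 'a) fm set" where
  "cond \<Delta> \<alpha> = {\<phi>. Imp \<alpha> \<phi> \<in> \<Delta>}"

context
  fixes \<Delta> :: "('v, 'a) fm set" and \<alpha> :: "('v, 'a) fm"
  assumes ct: "complete_theory \<Delta>" and CO: "\<alpha> \<in> CO \<sigma>"
begin

text \<open>\<open>O2\<close> requires the numerator not to exceed the denominator. This comes from
  \<open>P6b\<close> applied to the tautology \<open>Imp (And \<alpha> \<beta>) \<alpha>\<close>,
  which has probability 1.\<close>

lemma PrEq_cond:
  assumes "val \<Delta> \<alpha> \<noteq> 0" "\<beta> \<in> CO \<sigma>"
  shows "val \<Delta> (And \<alpha> \<beta>) \<le> val \<Delta> \<alpha>"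
    "Imp \<alpha> (PrEq \<sigma> \<beta> (val \<Delta> (And \<alpha> \<beta>) / val \<Delta> \<alpha>)) \<in> \<Delta>"
proof -
  have AB: "And \<alpha> \<beta> \<in> CO \<sigma>" using CO assms by simp
  have "Imp (And \<alpha> \<beta>) \<alpha> \<in> \<Delta>"
    using ct_taut_CO[OF ct, of "PImp (PAnd (PVar 0) (PVar 1)) (PVar 0)" "[\<alpha>, \<beta>]"] CO assms
    by (simp add: tautology_def nthd_def)
  moreover have "Imp (And \<alpha> \<beta>) \<alpha> \<in> CO \<sigma>" using AB CO by simp
  ultimately have "PrEq \<sigma> (Imp (And \<alpha> \<beta>) \<alpha>) 1 \<in> \<Delta>"
    using PrEq_iff[OF ct] mem_iff_val[OF ct] by simp
  then have "imp \<sigma> (PrEq \<sigma> (And \<alpha> \<beta>) (val \<Delta> (And \<alpha> \<beta>))) (PrGe \<alpha> (val \<Delta> (And \<alpha> \<beta>))) \<in> \<Delta>"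
    by (rule ct_axiom_imp[OF ct axiom.P6b[OF AB CO val_bounds[OF ct AB]]])
  then have "PrGe \<alpha> (val \<Delta> (And \<alpha> \<beta>)) \<in> \<Delta>" using PrEq_val[OF ct AB] ct_MP[OF ct] by blast
  then show le: "val \<Delta> (And \<alpha> \<beta>) \<le> val \<Delta> \<alpha>" using PrGe_iff[OF ct CO val_bounds[OF ct AB]] by simp
  show "Imp \<alpha> (PrEq \<sigma> \<beta> (val \<Delta> (And \<alpha> \<beta>) / val \<Delta> \<alpha>)) \<in> \<Delta>"
    using ct_axiom_imp[OF ct axiom.O2[OF CO assms(2) val_bounds(1)[OF ct AB] le assms(1) val_bounds(2)[OF ct CO]]]
      PrEq_val[OF ct CO] PrEq_val[OF ct AB] by (simp add: ct_And[OF ct])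
qed

lemma cond_complete:
  assumes "val \<Delta> \<alpha> \<noteq> 0"
  shows "complete_theory (cond \<Delta> \<alpha>)"
  unfolding cond_def
proof (rule complete_theory_image[OF ct])
  show "Imp \<alpha> \<phi> \<in> PCO \<sigma> \<Longrightarrow> \<phi> \<in> PCO \<sigma>" for \<phi> by simp
  show "Imp \<alpha> \<phi> \<in> \<Delta>" if "provable \<sigma> \<phi>" for \<phi>
  proof -
    have "provable \<sigma> (imp \<sigma> \<alpha> \<phi>)"
      using provable_weaken[of \<phi> \<alpha>] that CO by (blast intro: provable_MP provable_PCO CO_subset_PCO)
    then have "provable \<sigma> (Imp \<alpha> \<phi>)"
      using CO that by (intro provable_rule(2)) (auto intro: thm_rule.To_Imp simp: provable_PCO)
    then show ?thesis by (rule ct_thm[OF ct])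
  qed
  show "Imp \<alpha> \<psi> \<in> \<Delta>" if "\<phi> \<in> PCO \<sigma>" "\<psi> \<in> PCO \<sigma>" "provable \<sigma> (imp \<sigma> \<phi> \<psi>)" "Imp \<alpha> \<phi> \<in> \<Delta>" for \<phi> \<psi>
  proof -
    have "provable \<sigma> (imp \<sigma> (Imp \<alpha> \<phi>) (Imp \<alpha> \<psi>))"
      using CO that by (intro provable_rule(2)) (auto intro: thm_rule.Mon_Imp)
    then show ?thesis using that(4) ct_thm[OF ct] ct_MP[OF ct] by blast
  qed
  have I: "\<phi> \<in> PCO \<sigma>" if "Imp \<alpha> \<phi> \<in> \<Delta>" for \<phi> using ct_PCO[OF ct that] by simp
  show "Imp \<alpha> (And \<phi> \<psi>) \<in> \<Delta>" if "Imp \<alpha> \<phi> \<in> \<Delta>" "Imp \<alpha> \<psi> \<in> \<Delta>" for \<phi> \<psi>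
    using ct_axiom_iff[OF ct axiom.O5_And[OF CO I[OF that(1)] I[OF that(2)]]] that
    by (simp add: ct_And[OF ct])
  show "Imp \<alpha> \<phi> \<in> \<Delta> \<or> Imp \<alpha> \<psi> \<in> \<Delta>" if "Imp \<alpha> (Or \<phi> \<psi>) \<in> \<Delta>" for \<phi> \<psi>
    using ct_axiom_iff[OF ct axiom.O5_Or[OF CO, of \<phi> \<psi>]] I[OF that] that CO
    by (simp add: ct_Or[OF ct])
  show "Imp \<alpha> (falsum \<sigma>) \<notin> \<Delta>"
    using neg_mem_iff_val[OF ct CO] assms by (simp add: neg_def)
  show "\<exists>\<epsilon>. 0 \<le> \<epsilon> \<and> \<epsilon> \<le> 1 \<and> Imp \<alpha> (PrEq \<sigma> \<beta> \<epsilon>) \<in> \<Delta>" if "\<beta> \<in> CO \<sigma>" for \<beta>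
    using PrEq_cond(2)[OF assms that] I[OF PrEq_cond(2)[OF assms that]] by auto
qed

lemma val_cond:
  assumes "val \<Delta> \<alpha> \<noteq> 0" "\<beta> \<in> CO \<sigma>"
  shows "val (cond \<Delta> \<alpha>) \<beta> = val \<Delta> (And \<alpha> \<beta>) / val \<Delta> \<alpha>"
  using PrEq_iff[OF cond_complete[OF assms(1)] assms(2)] PrEq_cond(2)[OF assms]
  by (simp add: cond_def)

text \<open>A certain formula of \<open>CO\<close> stays certain, by the tautology
  \<open>Imp \<beta> (Imp \<alpha> \<beta>)\<close>. For formulas of \<open>PCO\<close> this fails
  in general, as conditioning changes probabilities.\<close>

lemma cond_CO: "\<beta> \<in> CO \<sigma> \<Longrightarrow> \<beta> \<in> \<Delta> \<Longrightarrow> \<beta> \<in> cond \<Delta> \<alpha>"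
proof -
  assume *: "\<beta> \<in> CO \<sigma>" "\<beta> \<in> \<Delta>"
  have "Imp \<beta> (Imp \<alpha> \<beta>) \<in> \<Delta>"
    using ct_taut_CO[OF ct, of "PImp (PVar 0) (PImp (PVar 1) (PVar 0))" "[\<beta>, \<alpha>]"] CO *
    by (simp add: tautology_def nthd_def)
  then show ?thesis using * ct_Imp_MP[OF ct] by (auto simp: cond_def)
qed

lemma cond_self: "\<alpha> \<in> cond \<Delta> \<alpha>"
  using ct_taut_CO[OF ct, of "PImp (PVar 0) (PVar 0)" "[\<alpha>]"] CO
  by (simp add: tautology_def nthd_def cond_def)

text \<open>Since \<open>cond \<Delta> \<alpha>\<close> is again a complete theory, unless \<open>\<alpha>\<close> has probability zero, null events
  can be detected by deriving a contradiction as if \<open>\<alpha>\<close> were true.\<close>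

lemma val_zeroI:
  assumes "complete_theory (cond \<Delta> \<alpha>) \<Longrightarrow> False"
  shows "val \<Delta> \<alpha> = 0"
  using assms cond_complete by blast

end

definition after :: "('v, 'a) fm set \<Rightarrow> ('v, 'a) eqs \<Rightarrow> ('v, 'a) fm set" where
  "after \<Delta> E = {\<phi>. Cf E \<phi> \<in> \<Delta>}"

lemma provable_Mon_Cf:
  assumes "is_eqs \<sigma> E" "\<phi> \<in> PCO \<sigma>" "\<psi> \<in> PCO \<sigma>" "provable \<sigma> (imp \<sigma> \<phi> \<psi>)"
  shows "provable \<sigma> (imp \<sigma> (Cf E \<phi>) (Cf E \<psi>))"
  using assms by (intro provable_rule(2)) (auto intro: thm_rule.Mon_Cf)

context
  fixes \<Delta> :: "('v, 'a) fm set" and E :: "('v, 'a) eqs"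
  assumes ct: "complete_theory \<Delta>" and E: "is_eqs \<sigma> E"
begin

lemma Cf_mono:
  assumes "\<phi> \<in> PCO \<sigma>" "\<psi> \<in> PCO \<sigma>" "provable \<sigma> (imp \<sigma> \<phi> \<psi>)" "Cf E \<phi> \<in> \<Delta>"
  shows "Cf E \<psi> \<in> \<Delta>"
  using ct_thm[OF ct provable_Mon_Cf[OF E assms(1-3)]] assms(4) ct_MP[OF ct] by blast

lemma Cf_And: "Cf E (And \<phi> \<psi>) \<in> \<Delta> \<longleftrightarrow> Cf E \<phi> \<in> \<Delta> \<and> Cf E \<psi> \<in> \<Delta>"
proof (cases "\<phi> \<in> PCO \<sigma> \<and> \<psi> \<in> PCO \<sigma>")
  case True
  then show ?thesis using ct_axiom_iff[OF ct axiom.C1[OF E, of \<phi> \<psi>]] by (simp add: ct_And[OF ct])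
next
  case False
  then show ?thesis using ct_PCO[OF ct] by fastforce
qed

lemma Cf_Or: "\<phi> \<in> PCO \<sigma> \<Longrightarrow> \<psi> \<in> PCO \<sigma> \<Longrightarrow> Cf E (Or \<phi> \<psi>) \<in> \<Delta> \<longleftrightarrow> Cf E \<phi> \<in> \<Delta> \<or> Cf E \<psi> \<in> \<Delta>"
  using ct_axiom_iff[OF ct axiom.C2[OF E, of \<phi> \<psi>]] E by (simp add: ct_Or[OF ct])

lemma Cf_Eq:
  assumes "(Y, y) \<in> E"
  shows "Cf E (Eq Y y) \<in> \<Delta>"
proof -
  have "Y \<in> Dom \<sigma>" "y \<in> Ran \<sigma> Y" using E assms by (auto simp: is_eqs_def)
  from ct_axiom[OF ct axiom.C6[OF E this]] show ?thesis using assms by (simp add: insert_absorb)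
qed

lemma after_complete:
  assumes cons: "consistent E"
  shows "complete_theory (after \<Delta> E)"
  unfolding after_def
proof (rule complete_theory_image[OF ct])
  show "Cf E \<phi> \<in> PCO \<sigma> \<Longrightarrow> \<phi> \<in> PCO \<sigma>" for \<phi> by simp
  \<comment> \<open>There is a monotonicity rule for \<open>Cf\<close> but no necessitation, which
    therefore starts from \<open>Cf E verum\<close>. As \<open>verum\<close> is itself a
    counterfactual, \<open>C4\<close> merges the two interventions and \<open>C6\<close> proves the
    result.\<close>
  have v: "Cf E (verum \<sigma>) \<in> \<Delta>"
  proof -
    let ?D = "{(var0, val0)}" let ?E = "{(X, x) \<in> E. X \<notin> fst ` ?D} \<union> ?D"
    have "is_eqs \<sigma> ?D" by simp
    moreover have "is_eqs \<sigma> {(X, x) \<in> E. X \<notin> fst ` ?D}" using E by (rule is_eqs_subset) auto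
    ultimately have "Cf ?E (Eq var0 val0) \<in> \<Delta>" by (intro ct_axiom[OF ct axiom.C6]) auto
    then show ?thesis
      using ct_axiom_iff[OF ct axiom.C4[OF E \<open>is_eqs \<sigma> ?D\<close>, of "Eq var0 val0"]] cons
      by (simp add: verum_eq)
  qed
  show "Cf E \<phi> \<in> \<Delta>" if "provable \<sigma> \<phi>" for \<phi>
  proof -
    have "provable \<sigma> (imp \<sigma> (verum \<sigma>) \<phi>)"
      using provable_MP[OF that provable_weaken] that by (simp add: provable_PCO)
    then show ?thesis using v that Cf_mono[of "verum \<sigma>" \<phi>] by (simp add: provable_PCO)
  qed
  show "Cf E \<psi> \<in> \<Delta>" if "\<phi> \<in> PCO \<sigma>" "\<psi> \<in> PCO \<sigma>" "provable \<sigma> (imp \<sigma> \<phi> \<psi>)" "Cf E \<phi> \<in> \<Delta>" for \<phi> \<psi>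
    using that by (rule Cf_mono)
  show "Cf E (And \<phi> \<psi>) \<in> \<Delta>" if "Cf E \<phi> \<in> \<Delta>" "Cf E \<psi> \<in> \<Delta>" for \<phi> \<psi>
    using that by (simp add: Cf_And)
  show "Cf E \<phi> \<in> \<Delta> \<or> Cf E \<psi> \<in> \<Delta>" if "Cf E (Or \<phi> \<psi>) \<in> \<Delta>" for \<phi> \<psi>
    using that ct_PCO[OF ct that] by (simp add: Cf_Or)
  show "Cf E (falsum \<sigma>) \<notin> \<Delta>"
    using ct_axiom_imp[OF ct axiom.C5[OF E _ cons, of "falsum \<sigma>"]] ct_falsum[OF ct] by auto
  show "\<exists>\<epsilon>. 0 \<le> \<epsilon> \<and> \<epsilon> \<le> 1 \<and> Cf E (PrEq \<sigma> \<alpha> \<epsilon>) \<in> \<Delta>"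
    if \<alpha>: "\<alpha> \<in> CO \<sigma>" and prime: "\<And>\<phi>. \<phi> \<in> PCO \<sigma> \<Longrightarrow> Cf E \<phi> \<in> \<Delta> \<or> Cf E (wneg \<sigma> \<phi>) \<in> \<Delta>" for \<alpha>
  proof -
    have CO: "Cf E \<alpha> \<in> CO \<sigma>" using E \<alpha> by simp
    \<comment> \<open>The value after the intervention is that of \<open>Cf E \<alpha>\<close>
      before it, since \<open>C8\<close> moves bounds across. The upper bound is the failure of
      \<open>PrGt\<close>, turned into \<open>PrLe\<close> by primeness.\<close>
    define v where "v = val \<Delta> (Cf E \<alpha>)"
    have v: "0 \<le> v" "v \<le> 1" using val_bounds[OF ct CO] by (auto simp: v_def)
    have "Cf E (PrGe \<alpha> v) \<in> \<Delta>"
      using ct_axiom_iff[OF ct axiom.C8_ge[OF E cons \<alpha> v]] PrGe_iff[OF ct CO v] by (simp add: v_def)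
    moreover have "Cf E (PrGt \<alpha> v) \<notin> \<Delta>"
      using ct_axiom_iff[OF ct axiom.C8_gt[OF E cons \<alpha> v]] PrGt_iff[OF ct CO v] by (simp add: v_def)
    then have "Cf E (PrLe \<sigma> \<alpha> v) \<in> \<Delta>" using prime[of "PrGt \<alpha> v"] v \<alpha> by simp
    ultimately show ?thesis using v by (auto simp: PrEq_def Cf_And)
  qed
qed

lemma val_after:
  assumes cons: "consistent E" and \<alpha>: "\<alpha> \<in> CO \<sigma>"
  shows "val (after \<Delta> E) \<alpha> = val \<Delta> (Cf E \<alpha>)"
proof -
  let ?v = "val (after \<Delta> E) \<alpha>"
  note ct' = after_complete[OF cons]
  have CO: "Cf E \<alpha> \<in> CO \<sigma>" using E \<alpha> by simp
  have v: "0 \<le> ?v" "?v \<le> 1" using val_bounds[OF ct' \<alpha>] by auto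
  have "?v \<le> val \<Delta> (Cf E \<alpha>)"
    using ct_axiom_iff[OF ct axiom.C8_ge[OF E cons \<alpha> v]] PrGe_iff[OF ct CO v] PrGe_iff[OF ct' \<alpha> v]
    by (simp add: after_def)
  moreover have "\<not> ?v < val \<Delta> (Cf E \<alpha>)"
    using ct_axiom_iff[OF ct axiom.C8_gt[OF E cons \<alpha> v]] PrGt_iff[OF ct CO v] PrGt_iff[OF ct' \<alpha> v]
    by (simp add: after_def)
  ultimately show ?thesis by simp
qed

end

section \<open>Equations and inconsistent antecedents\<close>

lemma not_Eq_Eq:
  assumes ct: "complete_theory \<Delta>" and "Eq X x \<in> \<Delta>" "Eq X x' \<in> \<Delta>"
  shows "x = x'"
proof (rule ccontr)
  assume ne: "x \<noteq> x'"
  have X: "X \<in> Dom \<sigma>" "x \<in> Ran \<sigma> X" "x' \<in> Ran \<sigma> X" using assms ct_PCO[OF ct] by fastforce+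
  have "axiom \<sigma> (imp \<sigma> (Eq X x) (Neq X x'))"
    using axiom.A1[of "[X]" \<sigma> "[x]" "[x']"] X ne
    by (simp add: set_tuples eqs_fm_def neqs_fm_def)
  then have "Neq X x' \<in> \<Delta>" using assms ct_axiom_imp[OF ct] by blast
  then have "Imp (Eq X x') (falsum \<sigma>) \<in> \<Delta>" using ct_axiom_iff[OF ct axiom.A2] X by blast
  then show False using assms ct_Imp_MP[OF ct] ct_falsum[OF ct] by blast
qed

lemma Neq_mem:
  assumes ct: "complete_theory \<Delta>" and "Eq X x \<in> \<Delta>" "x' \<in> Ran \<sigma> X" "x' \<noteq> x"
  shows "Neq X x' \<in> \<Delta>"
proof -
  have X: "X \<in> Dom \<sigma>" "x \<in> Ran \<sigma> X" using assms ct_PCO[OF ct] by fastforce+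
  have "axiom \<sigma> (imp \<sigma> (Eq X x) (Neq X x'))"
    using axiom.A1[of "[X]" \<sigma> "[x]" "[x']"] X assms
    by (simp add: set_tuples eqs_fm_def neqs_fm_def)
  then show ?thesis using assms ct_axiom_imp[OF ct] by blast
qed

text \<open>By \<open>C6\<close> two different values of the same variable hold under E. Their
  conjunction provably implies any \<phi>, and \<open>Mon_Cf\<close> then places \<phi> under E, in
  accordance with the vacuous truth of such counterfactuals.\<close>

lemma Cf_inconsistent:
  assumes ct: "complete_theory \<Delta>" and E: "is_eqs \<sigma> E" "\<not> consistent E" and "\<phi> \<in> PCO \<sigma>"
  shows "Cf E \<phi> \<in> \<Delta>"
proof -
  obtain Y y y' where y: "(Y, y) \<in> E" "(Y, y') \<in> E" "y \<noteq> y'"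
    using E(2) by (auto simp: single_valued_def)
  have Y: "Y \<in> Dom \<sigma>" "y \<in> Ran \<sigma> Y" "y' \<in> Ran \<sigma> Y" using E y by (auto simp: is_eqs_def)
  let ?f = "falsum \<sigma>"
  have A1: "axiom \<sigma> (imp \<sigma> (Eq Y y) (Neq Y y'))"
    using axiom.A1[of "[Y]" \<sigma> "[y]" "[y']"] Y y by (simp add: set_tuples eqs_fm_def neqs_fm_def)
  have A2: "axiom \<sigma> (iff \<sigma> (Neq Y y') (Imp (Eq Y y') ?f))" using Y by (intro axiom.A2)
  have O4: "axiom \<sigma> (imp \<sigma> (Imp (Eq Y y') ?f) (imp \<sigma> (Eq Y y') ?f))" using Y by (intro axiom.O4) auto
  have "provable \<sigma> (imp \<sigma> (imp \<sigma> (Eq Y y) (Neq Y y'))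
    (imp \<sigma> (iff \<sigma> (Neq Y y') (Imp (Eq Y y') ?f)) (imp \<sigma> (imp \<sigma> (Imp (Eq Y y') ?f) (imp \<sigma> (Eq Y y') ?f))
      (imp \<sigma> (And (Eq Y y) (Eq Y y')) \<phi>))))"
    using taut[of "PImp (PImp (PVar 0) (PVar 1)) (PImp (PAnd (PImp (PVar 1) (PVar 2)) (PImp (PVar 2) (PVar 1)))
      (PImp (PImp (PVar 2) (PImp (PVar 3) PBot)) (PImp (PAnd (PVar 0) (PVar 3)) (PVar 4))))"
      "[Eq Y y, Neq Y y', Imp (Eq Y y') ?f, Eq Y y', \<phi>]"] Y assms
    by (auto simp: tautology_def nthd_def iff_def eval_nat_numeral)
  then have "provable \<sigma> (imp \<sigma> (And (Eq Y y) (Eq Y y')) \<phi>)"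
    using A1 A2 O4 provable_axiom provable_MP by metis
  moreover have "Cf E (And (Eq Y y) (Eq Y y')) \<in> \<Delta>"
    using y by (simp add: Cf_And[OF ct E(1)] Cf_Eq[OF ct E(1)])
  ultimately show ?thesis using Cf_mono[OF ct E(1), of "And (Eq Y y) (Eq Y y')" \<phi>] Y assms(4) by simp
qed

subsection \<open>Finite additivity\<close>

lemma val_cong:
  assumes ct: "complete_theory \<Delta>" and CO: "\<alpha> \<in> CO \<sigma>" "\<beta> \<in> CO \<sigma>" and "equi \<alpha> \<beta> \<in> \<Delta>"
  shows "val \<Delta> \<alpha> = val \<Delta> \<beta>"
proof -
  have "PrEq \<sigma> (equi \<alpha> \<beta>) 1 \<in> \<Delta>"
    using assms mem_iff_val[OF ct, of "equi \<alpha> \<beta>"] PrEq_iff[OF ct, of "equi \<alpha> \<beta>"] by simp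
  then have "imp \<sigma> (PrEq \<sigma> \<alpha> (val \<Delta> \<alpha>)) (PrEq \<sigma> \<beta> (val \<Delta> \<alpha>)) \<in> \<Delta>"
    by (rule ct_axiom_imp[OF ct axiom.P6[OF CO val_bounds[OF ct CO(1)]]])
  then have "PrEq \<sigma> \<beta> (val \<Delta> \<alpha>) \<in> \<Delta>" using PrEq_val[OF ct CO(1)] ct_MP[OF ct] by blast
  then show ?thesis using PrEq_iff[OF ct CO(2)] by simp
qed

text \<open>\<open>P3\<close> presupposes that the two values add up to at most 1. Exclusiveness
  guarantees this through \<open>P3b\<close>, which bounds the probability of \<beta> by
  \<open>1 - val \<Delta> \<alpha>\<close>.\<close>

lemma val_disj:
  assumes ct: "complete_theory \<Delta>" and CO: "\<alpha> \<in> CO \<sigma>" "\<beta> \<in> CO \<sigma>" and "val \<Delta> (And \<alpha> \<beta>) = 0"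
  shows "val \<Delta> (disj \<sigma> \<alpha> \<beta>) = val \<Delta> \<alpha> + val \<Delta> \<beta>"
proof -
  let ?a = "val \<Delta> \<alpha>" and ?b = "val \<Delta> \<beta>"
  have AB: "And \<alpha> \<beta> \<in> CO \<sigma>" "disj \<sigma> \<alpha> \<beta> \<in> CO \<sigma>" using CO by auto
  have z: "PrEq \<sigma> (And \<alpha> \<beta>) 0 \<in> \<Delta>" using PrEq_iff[OF ct AB(1)] assms by simp
  note ba = val_bounds[OF ct CO(1)] and bb = val_bounds[OF ct CO(2)]
  have "PrGe \<alpha> ?a \<in> \<Delta>" using PrGe_iff[OF ct CO(1) ba] by simp
  then have "PrLe \<sigma> \<beta> (1 - ?a) \<in> \<Delta>"
    using ct_axiom_imp[OF ct axiom.P3b[OF CO ba]] z by (simp add: ct_And[OF ct])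
  then have "?b \<le> 1 - ?a"
    using PrLe_less[OF ct CO(2), of "1 - ?a" ?b] PrGe_iff[OF ct CO(2) bb] bb by fastforce
  then have "?a + ?b \<le> 1" by simp
  then have "PrEq \<sigma> (disj \<sigma> \<alpha> \<beta>) (?a + ?b) \<in> \<Delta>"
    using ct_axiom_imp[OF ct axiom.P3[OF CO ba(1) bb(1)]] z PrEq_val[OF ct CO(1)] PrEq_val[OF ct CO(2)]
    by (simp add: ct_And[OF ct])
  then show ?thesis using PrEq_iff[OF ct AB(2)] by simp
qed

text \<open>The conjunct \<alpha> is what makes the induction work: with the head a in place of
  \<alpha>, the hypothesis shows that a and the disjunction of the tail have a null overlap, and
  with \<alpha> itself it computes the contribution of the tail.\<close>

lemma val_And_big_disj:
  assumes ct: "complete_theory \<Delta>" and "\<alpha> \<in> CO \<sigma>" "set xs \<subseteq> CO \<sigma>"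
    and "sorted_wrt (\<lambda>x y. val \<Delta> (And x y) = 0) xs"
  shows "val \<Delta> (And \<alpha> (big (disj \<sigma>) (falsum \<sigma>) xs)) = (\<Sum>x\<leftarrow>xs. val \<Delta> (And \<alpha> x))"
  using assms(2-)
proof (induction xs arbitrary: \<alpha> rule: induct_list012)
  case 1
  have "val \<Delta> (And \<alpha> (falsum \<sigma>)) = 0"
  proof (rule val_zeroI[OF ct])
    assume ct': "complete_theory (cond \<Delta> (And \<alpha> (falsum \<sigma>)))"
    show False
      using cond_self[OF ct, of "And \<alpha> (falsum \<sigma>)"] ct_And[OF ct'] ct_falsum[OF ct'] 1 by simp
  qed (use 1 in simp)
  then show ?case by simp
next
  case (2 a)
  then show ?case by simp
next
  case (3 a b xs)
  let ?B = "big (disj \<sigma>) (falsum \<sigma>) (b # xs)"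
  have CO: "\<alpha> \<in> CO \<sigma>" "a \<in> CO \<sigma>" "?B \<in> CO \<sigma>" using 3 big_disj_CO[of "b # xs"] by auto
  have "val \<Delta> (And a ?B) = (\<Sum>x\<leftarrow>b # xs. val \<Delta> (And a x))" using 3 by (intro "3.IH"(2)) auto
  also have "map (\<lambda>x. val \<Delta> (And a x)) (b # xs) = map (\<lambda>_. 0) (b # xs)" using 3 by auto
  also have "sum_list \<dots> = 0" by (simp add: map_replicate_const sum_list_replicate)
  finally have "neg \<sigma> (And a ?B) \<in> \<Delta>" using neg_mem_iff_val[OF ct, of "And a ?B"] CO by simp
  then have neg: "neg \<sigma> (And a ?B) \<in> cond \<Delta> \<gamma>" if "\<gamma> \<in> CO \<sigma>" for \<gamma>
    using cond_CO[OF ct that, of "neg \<sigma> (And a ?B)"] CO by simp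
  let ?\<gamma> = "And (And \<alpha> a) (And \<alpha> ?B)"
  have "val \<Delta> ?\<gamma> = 0"
  proof (rule val_zeroI[OF ct])
    assume ct': "complete_theory (cond \<Delta> ?\<gamma>)"
    show False
      using cond_self[OF ct, of ?\<gamma>] ct_And[OF ct'] ct_neg[OF ct' neg] CO by simp
  qed (use CO in simp)
  then have "val \<Delta> (disj \<sigma> (And \<alpha> a) (And \<alpha> ?B)) = val \<Delta> (And \<alpha> a) + val \<Delta> (And \<alpha> ?B)"
    using CO by (intro val_disj[OF ct]) auto
  moreover have "val \<Delta> (And \<alpha> (disj \<sigma> a ?B)) = val \<Delta> (disj \<sigma> (And \<alpha> a) (And \<alpha> ?B))"
  proof (rule val_cong[OF ct])
    let ?p = "PAnd (PVar 0) (POr (PVar 1) (PVar 2))"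
    let ?q = "POr (PAnd (PVar 0) (PVar 1)) (PAnd (PVar 0) (PVar 2))"
    show "equi (And \<alpha> (disj \<sigma> a ?B)) (disj \<sigma> (And \<alpha> a) (And \<alpha> ?B)) \<in> \<Delta>"
      using ct_taut_CO[OF ct, of "PAnd (PImp ?p ?q) (PImp ?q ?p)" "[\<alpha>, a, ?B]"] CO
      by (auto simp: tautology_def nthd_def equi_def)
  qed (use CO in auto)
  moreover have "val \<Delta> (And \<alpha> ?B) = (\<Sum>x\<leftarrow>b # xs. val \<Delta> (And \<alpha> x))" using 3 by (intro "3.IH"(2)) auto
  ultimately show ?case by simp
qed

end

section \<open>Recomputing assignments\<close>

context signature_context
begin

text \<open>w is changed into w' one coordinate at a time; each change affects a coordinate on which
  f does not depend, and all intermediate assignments stay in range. Independence is demanded just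
  where w and w' differ, which is what \<open>solves_unique\<close> can supply.\<close>

lemma independent_eq:
  assumes "finite A" and w: "w \<in> assigns \<sigma> A" "w' \<in> assigns \<sigma> A"
    and indep: "\<And>X u x. X \<in> A \<Longrightarrow> w X \<noteq> w' X \<Longrightarrow> u \<in> assigns \<sigma> A \<Longrightarrow> x \<in> Ran \<sigma> X \<Longrightarrow> f (u(X := x)) = f u"
  shows "f w = f w'"
proof -
  let ?D = "{X \<in> A. w X \<noteq> w' X}"
  have main: "override_on w w' D \<in> assigns \<sigma> A \<and> f (override_on w w' D) = f w"
    if "finite D" "D \<subseteq> ?D" for D
    using that
  proof (induction D)
    case empty then show ?case using w by simp
  next
    case (insert X D)
    then have X: "X \<in> A" "w X \<noteq> w' X" "w' X \<in> Ran \<sigma> X" using w by (auto simp: assigns_def)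
    have IH: "override_on w w' D \<in> assigns \<sigma> A" "f (override_on w w' D) = f w" using insert by auto
    have mem: "override_on w w' (insert X D) \<in> assigns \<sigma> A"
      using w insert.prems by (auto simp: assigns_def override_on_def PiE_iff extensional_def)
    have "f (override_on w w' (insert X D)) = f (override_on w w' D)"
      unfolding override_on_insert by (rule indep[OF X(1,2) IH(1) X(3)])
    also note IH(2)
    finally have "f (override_on w w' (insert X D)) = f w" .
    with mem show ?case by (rule conjI)
  qed
  have "finite ?D" using assms(1) by simp
  then have "f (override_on w w' ?D) = f w" using main by blast
  moreover have "override_on w w' ?D = w'"
    using w by (auto simp: assigns_def override_on_def PiE_iff extensional_def fun_eq_iff)
  ultimately show ?thesis by (simp only:)
qed

text \<open>The condition under the definite description in \<open>intervene_asg\<close>. Uniqueness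
  follows from acyclicity; existence is obtained from a complete theory in
  \<open>fits_after\<close>.\<close>

definition solves :: "('v, 'a) func \<Rightarrow> ('v, 'a) eqs \<Rightarrow> ('v \<Rightarrow> 'a) \<Rightarrow> ('v \<Rightarrow> 'a) \<Rightarrow> bool" where
  "solves F E s t \<longleftrightarrow> t \<in> assigns \<sigma> (Dom \<sigma>) \<and> (\<forall>(X, x)\<in>E. t X = x) \<and>
     (\<forall>V\<in>Dom \<sigma> - fst ` E.
        t V = (case F V of None \<Rightarrow> s V | Some f \<Rightarrow> f (restrict t (others \<sigma> V))))"

definition recursive_func :: "('v, 'a) func \<Rightarrow> bool" where
  "recursive_func F \<longleftrightarrow> dom F \<subseteq> Dom \<sigma> \<and> acyclic (parent_rel \<sigma> F)"

lemma restrict_assigns: "t \<in> assigns \<sigma> A \<Longrightarrow> B \<subseteq> A \<Longrightarrow> restrict t B \<in> assigns \<sigma> B"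
  by (auto simp: assigns_def)

text \<open>Induction along the causal graph: two solutions that agree on the parents of V differ
  only at arguments on which the structural function of V does not depend.\<close>

lemma solves_unique:
  assumes F: "recursive_func F" and t: "solves F E s t" "solves F E s t'"
  shows "t = t'"
proof -
  have "parent_rel \<sigma> F \<subseteq> Dom \<sigma> \<times> Dom \<sigma>" using F by (auto simp: parent_rel_def recursive_func_def)
  then have "finite (parent_rel \<sigma> F)" using finite_Dom by (meson finite_SigmaI finite_subset)
  then have wf: "wf (parent_rel \<sigma> F)"
    using F by (intro finite_acyclic_wf) (auto simp: recursive_func_def)
  have eq: "V \<in> Dom \<sigma> \<longrightarrow> t V = t' V" for V
  proof (induction V rule: wf_induct_rule[OF wf])
    case (1 V)
    show ?case
    proof
      assume V: "V \<in> Dom \<sigma>"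
      show "t V = t' V"
      proof (cases "V \<in> fst ` E")
        case True then show ?thesis using t by (fastforce simp: solves_def)
      next
        case False
        show ?thesis
        proof (cases "F V")
          case None then show ?thesis using t V False by (simp add: solves_def)
        next
          case (Some f)
          have "f (restrict t (others \<sigma> V)) = f (restrict t' (others \<sigma> V))"
          proof (rule independent_eq[where f = f and A = "others \<sigma> V"])
            fix X u x
            assume *: "X \<in> others \<sigma> V" "restrict t (others \<sigma> V) X \<noteq> restrict t' (others \<sigma> V) X"
              "u \<in> assigns \<sigma> (others \<sigma> V)" "x \<in> Ran \<sigma> X"
            then have "(X, V) \<notin> parent_rel \<sigma> F" using 1 by auto
            then show "f (u(X := x)) = f u" using * Some by (auto simp: parent_rel_def)
          qed (use finite_Dom t in \<open>auto intro!: restrict_assigns[of _ "Dom \<sigma>"] simp: solves_def\<close>)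
          then show ?thesis using t V False Some by (simp add: solves_def)
        qed
      qed
    qed
  qed
  show ?thesis
  proof (rule ext)
    show "t V = t' V" for V
      using eq[of V] t by (cases "V \<in> Dom \<sigma>") (auto simp: solves_def assigns_def PiE_iff extensional_def)
  qed
qed

lemma intervene_asg_eq:
  assumes "recursive_func F" "solves F E s t"
  shows "intervene_asg \<sigma> F E s = t"
  unfolding intervene_asg_def using assms solves_unique
  by (intro the_equality) (auto simp: solves_def)

lemma recursive_func_restrict: "recursive_func F \<Longrightarrow> recursive_func (F |` A)"
  unfolding recursive_func_def
  by (auto simp: parent_rel_def restrict_map_def split: if_splits elim!: acyclic_subset)

lemma fst_eqs_of [simp]: "fst ` eqs_of w A = A"
  and consistent_eqs_of [simp]: "consistent (eqs_of w A)"
  by (force simp: eqs_of_def single_valued_def)+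

section \<open>States\<close>

definition state_fm :: "('v \<Rightarrow> 'a) \<Rightarrow> ('v, 'a) fm" where
  "state_fm s = eqs_fm \<sigma> (map (\<lambda>X. (X, s X)) (vars \<sigma>))"

abbreviation states :: "('v \<Rightarrow> 'a) set" where
  "states \<equiv> assigns \<sigma> (Dom \<sigma>)"

lemma finite_states: "finite states"
  unfolding assigns_def using finite_Dom finite_Ran by (intro finite_PiE) auto

lemma states_Ran: "s \<in> states \<Longrightarrow> X \<in> Dom \<sigma> \<Longrightarrow> s X \<in> Ran \<sigma> X"
  by (auto simp: assigns_def)

lemma state_fm_CO [simp]: "s \<in> states \<Longrightarrow> state_fm s \<in> CO \<sigma>"
  unfolding state_fm_def by (rule eqs_fm_CO) (auto simp: is_eqs_def states_Ran)

lemma state_fm_Eq: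
  assumes ct: "complete_theory \<Delta>" and "state_fm s \<in> \<Delta>" "X \<in> Dom \<sigma>"
  shows "Eq X (s X) \<in> \<Delta>"
  using ct_big_And_D[OF ct assms(2)[unfolded state_fm_def eqs_fm_def], of "Eq X (s X)"] assms(3) by simp

lemma set_tuples_vars: "set (tuples \<sigma> (vars \<sigma>)) = (\<lambda>s. map s (vars \<sigma>)) ` states"
proof (intro equalityI subsetI)
  fix ys assume "ys \<in> set (tuples \<sigma> (vars \<sigma>))"
  then have ys: "length ys = length (vars \<sigma>)" "\<And>i. i < length (vars \<sigma>) \<Longrightarrow> ys ! i \<in> Ran \<sigma> (vars \<sigma> ! i)"
    by (auto simp: set_tuples)
  define s where "s = restrict (\<lambda>X. the (map_of (zip (vars \<sigma>) ys) X)) (Dom \<sigma>)"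
  have nth: "s (vars \<sigma> ! i) = ys ! i" if "i < length (vars \<sigma>)" for i
    using that ys nth_mem[OF that] by (simp add: s_def map_of_zip_nth)
  have "s \<in> states"
    unfolding assigns_def
  proof (rule PiE_I)
    fix X assume "X \<in> Dom \<sigma>"
    then obtain i where "i < length (vars \<sigma>)" "X = vars \<sigma> ! i" using vars(1) by (metis in_set_conv_nth)
    then show "s X \<in> Ran \<sigma> X" using nth ys by simp
  qed (simp add: s_def)
  moreover have "ys = map s (vars \<sigma>)" using ys nth by (auto intro: nth_equalityI)
  ultimately show "ys \<in> (\<lambda>s. map s (vars \<sigma>)) ` states" by blast
next
  fix ys assume "ys \<in> (\<lambda>s. map s (vars \<sigma>)) ` states"
  then obtain s where s: "s \<in> states" "ys = map s (vars \<sigma>)" by blast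
  have "vars \<sigma> ! i \<in> Dom \<sigma>" if "i < length (vars \<sigma>)" for i using nth_mem[OF that] by simp
  then show "ys \<in> set (tuples \<sigma> (vars \<sigma>))" using s states_Ran[OF s(1)] by (simp add: set_tuples)
qed

lemma inj_on_states: "inj_on (\<lambda>s. map s (vars \<sigma>)) states"
proof (rule inj_onI)
  fix s t assume *: "s \<in> states" "t \<in> states" "map s (vars \<sigma>) = map t (vars \<sigma>)"
  show "s = t"
  proof (rule ext)
    show "s X = t X" for X
      using * by (cases "X \<in> Dom \<sigma>") (auto simp: map_eq_conv assigns_def PiE_iff extensional_def)
  qed
qed

lemma distinct_tuples: "set Xs \<subseteq> Dom \<sigma> \<Longrightarrow> distinct (tuples \<sigma> Xs)"
  unfolding tuples_def by (rule distinct_product_lists) auto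

lemma zip_map_same: "zip xs (map f xs) = map (\<lambda>x. (x, f x)) xs"
  by (induction xs) auto

text \<open>\<open>A3\<close> makes the disjunction of all state formulas certain, and distinct
  states exclude each other, as a complete theory holds at most one equation per variable. Finite
  additivity then gives the law of total probability.\<close>

lemma sum_states:
  assumes ct: "complete_theory \<Delta>" and \<alpha>: "\<alpha> \<in> CO \<sigma>"
  shows "(\<Sum>s\<in>states. val \<Delta> (And \<alpha> (state_fm s))) = val \<Delta> \<alpha>"
proof -
  let ?g = "\<lambda>ys. eqs_fm \<sigma> (zip (vars \<sigma>) ys)" and ?T = "tuples \<sigma> (vars \<sigma>)"
  let ?D = "big (disj \<sigma>) (falsum \<sigma>) (map ?g ?T)"
  have g: "?g (map s (vars \<sigma>)) = state_fm s" for s by (simp add: state_fm_def zip_map_same)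
  have sub: "set (map ?g ?T) \<subseteq> CO \<sigma>" by (auto simp: set_tuples_vars g)
  then have D: "?D \<in> CO \<sigma>" by (rule big_disj_CO)
  have "?D \<in> \<Delta>" using ct_axiom[OF ct axiom.A3[of "vars \<sigma>" \<sigma>]] by simp
  have excl: "val \<Delta> (And (state_fm s) (state_fm t)) = 0" if st: "s \<in> states" "t \<in> states" "s \<noteq> t" for s t
  proof (rule val_zeroI[OF ct])
    let ?\<gamma> = "And (state_fm s) (state_fm t)"
    assume ct': "complete_theory (cond \<Delta> ?\<gamma>)"
    have "?\<gamma> \<in> cond \<Delta> ?\<gamma>" using st by (intro cond_self[OF ct]) auto
    then have "state_fm s \<in> cond \<Delta> ?\<gamma>" "state_fm t \<in> cond \<Delta> ?\<gamma>" by (simp_all add: ct_And[OF ct'])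
    then have "s X = t X" if "X \<in> Dom \<sigma>" for X
      using state_fm_Eq[OF ct' _ that] not_Eq_Eq[OF ct'] by blast
    then have "map s (vars \<sigma>) = map t (vars \<sigma>)" by simp
    then show False using inj_on_states st by (auto dest: inj_onD)
  qed (use st in auto)
  have "sorted_wrt (\<lambda>x y. val \<Delta> (And (?g x) (?g y)) = 0) ?T"
    unfolding sorted_wrt_iff_nth_less
  proof (intro allI impI)
    fix i j assume ij: "i < j" "j < length ?T"
    then have "?T ! i \<in> set ?T" "?T ! j \<in> set ?T" "?T ! i \<noteq> ?T ! j"
      using distinct_tuples[of "vars \<sigma>"] by (auto simp: distinct_conv_nth)
    then obtain s t where s: "?T ! i = map s (vars \<sigma>)" "s \<in> states"
      and t: "?T ! j = map t (vars \<sigma>)" "t \<in> states"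
      unfolding set_tuples_vars by blast
    have "s \<noteq> t" using \<open>?T ! i \<noteq> ?T ! j\<close> unfolding s(1) t(1) by blast
    then show "val \<Delta> (And (?g (?T ! i)) (?g (?T ! j))) = 0"
      unfolding s(1) t(1) g using excl s(2) t(2) by blast
  qed
  then have sorted: "sorted_wrt (\<lambda>x y. val \<Delta> (And x y) = 0) (map ?g ?T)" by (simp add: sorted_wrt_map)
  have "val \<Delta> (And \<alpha> ?D) = val \<Delta> \<alpha>"
  proof (rule val_cong[OF ct])
    let ?q = "PAnd (PVar 0) (PVar 1)"
    have "Imp ?D (equi (And \<alpha> ?D) \<alpha>) \<in> \<Delta>"
      using ct_taut_CO[OF ct, of "PImp (PVar 1) (PAnd (PImp ?q (PVar 0)) (PImp (PVar 0) ?q))" "[\<alpha>, ?D]"] \<alpha> D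
      by (simp add: tautology_def nthd_def equi_def)
    then show "equi (And \<alpha> ?D) \<alpha> \<in> \<Delta>" using \<open>?D \<in> \<Delta>\<close> by (rule ct_Imp_MP[OF ct])
  qed (use \<alpha> D in auto)
  moreover have "val \<Delta> (And \<alpha> ?D) = (\<Sum>ys\<leftarrow>?T. val \<Delta> (And \<alpha> (?g ys)))"
    using val_And_big_disj[OF ct \<alpha> sub sorted] by (simp add: comp_def)
  moreover have "\<dots> = (\<Sum>ys\<in>set ?T. val \<Delta> (And \<alpha> (?g ys)))"
    by (rule sum_list_distinct_conv_sum_set) (simp add: distinct_tuples)
  moreover have "\<dots> = (\<Sum>s\<in>states. val \<Delta> (And \<alpha> (state_fm s)))"
    unfolding set_tuples_vars by (subst sum.reindex[OF inj_on_states]) (simp add: g)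
  ultimately show ?thesis by simp
qed

text \<open>Reductio for \<open>CO\<close>: conditioning on \<gamma> stands in for assuming
  \<gamma>. If no complete theory results, \<gamma> has probability zero, which is what
  \<open>neg\<close> expresses.\<close>

lemma neg_memI:
  assumes ct: "complete_theory \<Delta>" and "\<gamma> \<in> CO \<sigma>"
    and "complete_theory (cond \<Delta> \<gamma>) \<Longrightarrow> False"
  shows "neg \<sigma> \<gamma> \<in> \<Delta>"
  using val_zeroI[OF ct assms(2,3)] neg_mem_iff_val[OF ct assms(2)] by simp

text \<open>The probabilities of the states add up to that of \<open>verum\<close>, which is 1, so
  some state has positive probability, and conditioning on it gives \<Delta>'.\<close>

lemma exists_state:
  assumes ct: "complete_theory \<Delta>"
  shows "\<exists>t\<in>states. \<exists>\<Delta>'. complete_theory \<Delta>' \<and> CO \<sigma> \<inter> \<Delta> \<subseteq> \<Delta>' \<and> (\<forall>X\<in>Dom \<sigma>. Eq X (t X) \<in> \<Delta>')"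
proof -
  have "verum \<sigma> \<in> \<Delta>" by (rule ct_thm[OF ct provable_verum])
  then have "(\<Sum>s\<in>states. val \<Delta> (And (verum \<sigma>) (state_fm s))) \<noteq> 0"
    using sum_states[OF ct, of "verum \<sigma>"] mem_iff_val[OF ct, of "verum \<sigma>"] by simp
  then obtain t where t: "t \<in> states" "val \<Delta> (And (verum \<sigma>) (state_fm t)) \<noteq> 0"
    by (rule sum.not_neutral_contains_not_neutral)
  let ?\<gamma> = "And (verum \<sigma>) (state_fm t)"
  have CO: "?\<gamma> \<in> CO \<sigma>" using t by simp
  note ct' = cond_complete[OF ct CO t(2)]
  have "state_fm t \<in> cond \<Delta> ?\<gamma>" using cond_self[OF ct CO] by (simp add: ct_And[OF ct'])
  then have "\<forall>X\<in>Dom \<sigma>. Eq X (t X) \<in> cond \<Delta> ?\<gamma>" using state_fm_Eq[OF ct'] by blast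
  moreover have "CO \<sigma> \<inter> \<Delta> \<subseteq> cond \<Delta> ?\<gamma>" using cond_CO[OF ct CO] by blast
  ultimately show ?thesis using t(1) ct' by blast
qed

text \<open>Were \<beta> not certain, conditioning on \<open>neg \<beta>\<close> and then on a state
  of positive probability would give a theory that contains \<open>neg \<beta>\<close>, but also
  \<beta> by assumption.\<close>

lemma CO_mem_by_states:
  assumes ct: "complete_theory \<Delta>" and \<beta>: "\<beta> \<in> CO \<sigma>"
    and *: "\<And>t \<Delta>'. t \<in> states \<Longrightarrow> complete_theory \<Delta>' \<Longrightarrow> CO \<sigma> \<inter> \<Delta> \<subseteq> \<Delta>' \<Longrightarrow>
      \<forall>X\<in>Dom \<sigma>. Eq X (t X) \<in> \<Delta>' \<Longrightarrow> \<beta> \<in> \<Delta>'"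
  shows "\<beta> \<in> \<Delta>"
proof -
  have "neg \<sigma> (neg \<sigma> \<beta>) \<in> \<Delta>"
  proof (rule neg_memI[OF ct])
    assume ct': "complete_theory (cond \<Delta> (neg \<sigma> \<beta>))"
    have n: "neg \<sigma> \<beta> \<in> CO \<sigma>" using \<beta> by simp
    obtain t \<Delta>' where t: "t \<in> states" "complete_theory \<Delta>'" "CO \<sigma> \<inter> cond \<Delta> (neg \<sigma> \<beta>) \<subseteq> \<Delta>'"
      "\<forall>X\<in>Dom \<sigma>. Eq X (t X) \<in> \<Delta>'"
      using exists_state[OF ct'] by blast
    have "CO \<sigma> \<inter> \<Delta> \<subseteq> \<Delta>'" using t(3) cond_CO[OF ct n] by blast
    then have "\<beta> \<in> \<Delta>'" using * t by blast
    moreover have "neg \<sigma> \<beta> \<in> \<Delta>'" using t(3) cond_self[OF ct n] n by blast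
    ultimately show False using ct_neg[OF t(2)] by blast
  qed (use \<beta> in simp)
  moreover have "Imp (neg \<sigma> (neg \<sigma> \<beta>)) \<beta> \<in> \<Delta>"
    using ct_taut_CO[OF ct, of "PImp (PNot (PNot (PVar 0))) (PVar 0)" "[\<beta>]"] \<beta>
    by (simp add: tautology_def nthd_def)
  ultimately show ?thesis using ct_Imp_MP[OF ct] by blast
qed

text \<open>The invariant that ties a state and structural functions to a theory. By the last clause
  F gives the certain response of Y to fixing all other variables; for an exogenous Y that response
  is its actual value. The invariant is preserved by interventions (\<open>fits_after\<close>) and
  settles all of \<open>CO\<close> (\<open>CO_decided\<close>).\<close>

definition fits :: "('v \<Rightarrow> 'a) \<Rightarrow> ('v, 'a) func \<Rightarrow> ('v, 'a) fm set \<Rightarrow> bool" where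
  "fits s F \<Delta> \<longleftrightarrow> s \<in> states \<and> (\<forall>X\<in>Dom \<sigma>. Eq X (s X) \<in> \<Delta>) \<and>
     (\<forall>Y\<in>Dom \<sigma>. \<forall>w\<in>assigns \<sigma> (others \<sigma> Y).
        Cf (eqs_of w (others \<sigma> Y)) (Eq Y (case F Y of None \<Rightarrow> s Y | Some f \<Rightarrow> f w)) \<in> \<Delta>)"

lemma Cf_Eq_unique:
  assumes ct: "complete_theory \<Delta>" and E: "is_eqs \<sigma> E" "consistent E"
    and "Cf E (Eq Y y) \<in> \<Delta>" "Cf E (Eq Y y') \<in> \<Delta>"
  shows "y = y'"
  using not_Eq_Eq[OF after_complete[OF ct E]] assms(4,5) by (simp add: after_def)

text \<open>By \<open>C7\<close>, setting variables to values they already have changes nothing, so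
  Y keeps the value \<open>t Y\<close>; values under a consistent intervention are unique.\<close>

lemma Cf_actual:
  assumes ct: "complete_theory \<Delta>" and t: "t \<in> states" "\<forall>X\<in>Dom \<sigma>. Eq X (t X) \<in> \<Delta>" and Y: "Y \<in> Dom \<sigma>"
    and Cf: "Cf (eqs_of (restrict t (others \<sigma> Y)) (others \<sigma> Y)) (Eq Y y) \<in> \<Delta>"
  shows "y = t Y"
proof -
  let ?O = "others \<sigma> Y" and ?xs = "map (\<lambda>X. (X, t X)) [X \<leftarrow> vars \<sigma>. X \<noteq> Y]"
  have set: "set ?xs = eqs_of (restrict t ?O) ?O" by (auto simp: eqs_of_def)
  have eqs: "is_eqs \<sigma> (eqs_of (restrict t ?O) ?O)"
    using t by (intro is_eqs_eqs_of) (auto intro: restrict_assigns)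
  have "eqs_fm \<sigma> ?xs \<in> \<Delta>" unfolding eqs_fm_def using t(2) by (intro ct_big_And[OF ct]) auto
  then have "Cf (set ?xs) (Eq Y (t Y)) \<in> \<Delta>"
    using t Y eqs states_Ran unfolding set[symmetric]
    by (intro ct_axiom_imp[OF ct axiom.C7]) (auto simp: ct_And[OF ct])
  then have "Cf (eqs_of (restrict t ?O) ?O) (Eq Y (t Y)) \<in> \<Delta>" by (simp only: set)
  then show ?thesis using Cf_Eq_unique[OF ct eqs consistent_eqs_of Cf] by simp
qed

text \<open>Fixing all variables other than Y overwrites every equation of E, because Y is not among
  the variables of E; so \<open>C4\<close> reduces the nested intervention to one described by
  \<open>fits\<close>.\<close>

lemma after_others:
  assumes ct: "complete_theory \<Delta>" and fits: "fits s F \<Delta>" and E: "is_eqs \<sigma> E" "consistent E"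
    and Y: "Y \<in> Dom \<sigma>" "Y \<notin> fst ` E" and w: "w \<in> assigns \<sigma> (others \<sigma> Y)"
  shows "Cf (eqs_of w (others \<sigma> Y)) (Eq Y (case F Y of None \<Rightarrow> s Y | Some f \<Rightarrow> f w)) \<in> after \<Delta> E"
    (is "Cf ?D ?\<chi> \<in> _")
proof -
  have *: "Cf ?D ?\<chi> \<in> \<Delta>" using fits Y w by (simp add: fits_def)
  have D: "is_eqs \<sigma> ?D" using w by (rule is_eqs_eqs_of) auto
  have "?\<chi> \<in> PCO \<sigma>" using ct_PCO[OF ct *] by simp
  moreover have "{(X, x) \<in> E. X \<notin> fst ` ?D} \<union> ?D = ?D" using E Y by (force simp: is_eqs_def)
  ultimately show ?thesis
    using ct_axiom_iff[OF ct axiom.C4[OF E(1) D _ E(2)], of ?\<chi>] * by (simp add: after_def)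
qed

text \<open>\<Delta>' is the theory of a state t that is possible after the intervention. The
  equations of E hold in it by \<open>C6\<close>; for the other variables
  \<open>after_others\<close> gives the response to the values of t, and \<open>Cf_actual\<close>
  identifies it with the value in t.\<close>

lemma after_solves:
  assumes ct: "complete_theory \<Delta>" and fits: "fits s F \<Delta>" and E: "is_eqs \<sigma> E" "consistent E"
    and ct': "complete_theory \<Delta>'" "CO \<sigma> \<inter> after \<Delta> E \<subseteq> \<Delta>'"
    and t: "t \<in> states" "\<forall>X\<in>Dom \<sigma>. Eq X (t X) \<in> \<Delta>'"
  shows "solves F E s t"
  unfolding solves_def
proof (intro conjI ballI)
  show "t \<in> states" by (rule t)
  show "case p of (X, x) \<Rightarrow> t X = x" if "p \<in> E" for p
  proof -
    obtain X x where p: "p = (X, x)" by (cases p)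
    then have X: "X \<in> Dom \<sigma>" "x \<in> Ran \<sigma> X" using E that by (auto simp: is_eqs_def)
    have "Eq X x \<in> after \<Delta> E" using Cf_Eq[OF ct E(1)] that p by (simp add: after_def)
    then have "Eq X x \<in> \<Delta>'" using ct'(2) X by auto
    then show ?thesis using not_Eq_Eq[OF ct'(1)] t X p by auto
  qed
  fix Y assume Y: "Y \<in> Dom \<sigma> - fst ` E"
  let ?w = "restrict t (others \<sigma> Y)"
  have w: "?w \<in> assigns \<sigma> (others \<sigma> Y)" using t by (intro restrict_assigns) auto
  let ?\<phi> = "Cf (eqs_of ?w (others \<sigma> Y)) (Eq Y (case F Y of None \<Rightarrow> s Y | Some f \<Rightarrow> f ?w))"
  have "?\<phi> \<in> after \<Delta> E" using Y w by (intro after_others[OF ct fits E]) auto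
  moreover from this have "?\<phi> \<in> CO \<sigma>"
    using ct_PCO[OF after_complete[OF ct E]] by force
  ultimately have "?\<phi> \<in> \<Delta>'" using ct'(2) by blast
  from Cf_actual[OF ct'(1) t _ this] Y
  show "t Y = (case F Y of None \<Rightarrow> s Y | Some f \<Rightarrow> f ?w)" by simp
qed

text \<open>At least one state is possible after the intervention, and every possible one is a
  solution, so a solution t exists. By uniqueness all possible states equal t, which makes the
  values of t certain by \<open>CO_mem_by_states\<close>.\<close>

lemma fits_after:
  assumes ct: "complete_theory \<Delta>" and fits: "fits s F \<Delta>" and F: "recursive_func F"
    and E: "is_eqs \<sigma> E" "consistent E"
  shows "fits (intervene_asg \<sigma> F E s) (F |` (- fst ` E)) (after \<Delta> E)"
proof -
  note ctE = after_complete[OF ct E]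
  obtain t where t: "t \<in> states" "solves F E s t"
    using exists_state[OF ctE] after_solves[OF ct fits E] by blast
  have int: "intervene_asg \<sigma> F E s = t" by (rule intervene_asg_eq[OF F t(2)])
  have "Eq X (t X) \<in> after \<Delta> E" if X: "X \<in> Dom \<sigma>" for X
  proof (rule CO_mem_by_states[OF ctE])
    fix t' \<Delta>'
    assume *: "t' \<in> states" "complete_theory \<Delta>'" "CO \<sigma> \<inter> after \<Delta> E \<subseteq> \<Delta>'" "\<forall>X\<in>Dom \<sigma>. Eq X (t' X) \<in> \<Delta>'"
    have "t' = t" using solves_unique[OF F after_solves[OF ct fits E *(2,3,1,4)] t(2)] .
    then show "Eq X (t X) \<in> \<Delta>'" using * X by simp
  qed (use X t states_Ran in simp)
  moreover have "Cf (eqs_of w (others \<sigma> Y)) (Eq Y (case (F |` (- fst ` E)) Y of None \<Rightarrow> t Y | Some f \<Rightarrow> f w)) \<in> after \<Delta> E"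
    if Y: "Y \<in> Dom \<sigma>" and w: "w \<in> assigns \<sigma> (others \<sigma> Y)" for Y w
  proof (cases "Y \<in> fst ` E")
    case True
    let ?D = "eqs_of w (others \<sigma> Y)"
    \<comment> \<open>\<open>eqs_of w\<close> does not mention Y, so the equation that E imposes on
      Y survives the merging; it is the constant response of a variable made exogenous.\<close>
    let ?E = "{(X, x) \<in> E. X \<notin> fst ` ?D} \<union> ?D"
    have D: "is_eqs \<sigma> ?D" using w by (rule is_eqs_eqs_of) auto
    have "is_eqs \<sigma> {(X, x) \<in> E. X \<notin> fst ` ?D}" using E(1) by (rule is_eqs_subset) auto
    then have "is_eqs \<sigma> ?E" using D by simp
    moreover obtain x where "(Y, x) \<in> E" using True by auto
    then have "(Y, t Y) \<in> ?E" using t(2) by (auto simp: solves_def)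
    ultimately have "Cf ?E (Eq Y (t Y)) \<in> \<Delta>" by (rule Cf_Eq[OF ct])
    then have "Cf E (Cf ?D (Eq Y (t Y))) \<in> \<Delta>"
      using ct_axiom_iff[OF ct axiom.C4[OF E(1) D _ E(2)], of "Eq Y (t Y)"] Y t states_Ran by simp
    then show ?thesis using True by (simp add: after_def restrict_map_def)
  next
    case False
    have "t Y = (case F Y of None \<Rightarrow> s Y | Some f \<Rightarrow> f (restrict t (others \<sigma> Y)))"
      using t(2) Y False by (simp add: solves_def)
    then show ?thesis
      using after_others[OF ct fits E Y False w] False by (auto simp: restrict_map_def split: option.splits)
  qed
  ultimately show ?thesis unfolding int fits_def using t(1) by blast
qed

lemma sat_empty: "fst T = {#} \<Longrightarrow> sat \<sigma> \<phi> T"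
  by (induction \<phi> arbitrary: T) (auto simp: observe_def intervene_def)

text \<open>The induction generalises over state, functions and theory because a counterfactual
  moves to the intervened triple. Both halves are proved together: truth of \<open>Imp\<close> may
  rest on \<open>neg\<close> of its antecedent, and falsity of a compound on \<open>neg\<close> of a
  component.\<close>

lemma CO_decided:
  assumes "\<beta> \<in> CO \<sigma>" "complete_theory \<Delta>" "fits s F \<Delta>" "recursive_func F"
  shows "(sat \<sigma> \<beta> ({#s#}, F) \<longrightarrow> \<beta> \<in> \<Delta>) \<and> (\<not> sat \<sigma> \<beta> ({#s#}, F) \<longrightarrow> neg \<sigma> \<beta> \<in> \<Delta>)"
  using assms
proof (induction \<beta> arbitrary: s F \<Delta>)
  case (1 X x)
  then have Eq: "Eq X (s X) \<in> \<Delta>" by (simp add: fits_def)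
  show ?case
  proof (cases "s X = x")
    case False
    then have "Neq X x \<in> \<Delta>" using Neq_mem[OF 1(3) Eq] 1 by auto
    then show ?thesis using ct_axiom_iff[OF 1(3) axiom.A2] 1 False by (simp add: neg_def)
  qed (use Eq in auto)
next
  case (2 X x)
  then have Eq: "Eq X (s X) \<in> \<Delta>" by (simp add: fits_def)
  have N: "Neq X x \<in> CO \<sigma>" using 2 by simp
  show ?case
  proof (cases "s X = x")
    case False
    then show ?thesis using Neq_mem[OF 2(3) Eq] 2 by auto
  next
    case True
    have "neg \<sigma> (Neq X x) \<in> \<Delta>"
    proof (rule neg_memI[OF 2(3) N])
      assume ct': "complete_theory (cond \<Delta> (Neq X x))"
      have "Neq X x \<in> cond \<Delta> (Neq X x)" by (rule cond_self[OF 2(3) N])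
      then have "neg \<sigma> (Eq X x) \<in> cond \<Delta> (Neq X x)"
        using ct_axiom_iff[OF ct' axiom.A2] 2 by (simp add: neg_def)
      moreover have "Eq X x \<in> cond \<Delta> (Neq X x)" using Eq True 2 by (intro cond_CO[OF 2(3) N]) auto
      ultimately show False using ct_neg[OF ct'] by blast
    qed
    then show ?thesis using True by simp
  qed
next
  case (3 \<alpha> \<beta>)
  note ct = 3(5)
  note IH = 3(3)[OF 3(5-7)] 3(4)[OF 3(5-7)]
  have CO: "And \<alpha> \<beta> \<in> CO \<sigma>" using 3 by simp
  have "neg \<sigma> (And \<alpha> \<beta>) \<in> \<Delta>" if n: "neg \<sigma> \<alpha> \<in> \<Delta> \<or> neg \<sigma> \<beta> \<in> \<Delta>"
  proof (rule neg_memI[OF ct CO])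
    assume ct': "complete_theory (cond \<Delta> (And \<alpha> \<beta>))"
    have "\<alpha> \<in> cond \<Delta> (And \<alpha> \<beta>)" "\<beta> \<in> cond \<Delta> (And \<alpha> \<beta>)"
      using cond_self[OF ct CO] by (auto simp: ct_And[OF ct'])
    moreover have "neg \<sigma> \<alpha> \<in> cond \<Delta> (And \<alpha> \<beta>) \<or> neg \<sigma> \<beta> \<in> cond \<Delta> (And \<alpha> \<beta>)"
      using n cond_CO[OF ct CO] 3(1,2) neg_CO by blast
    ultimately show False using ct_neg[OF ct'] by blast
  qed
  then show ?case using IH by (auto simp: ct_And[OF ct])
next
  case (4 \<alpha> \<beta>)
  note ct = 4(5)
  note IH = 4(3)[OF 4(5-7)] 4(4)[OF 4(5-7)]
  have CO: "Imp \<alpha> \<beta> \<in> CO \<sigma>" using 4 by simp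
  have sat: "sat \<sigma> (Imp \<alpha> \<beta>) ({#s#}, F) \<longleftrightarrow> (sat \<sigma> \<alpha> ({#s#}, F) \<longrightarrow> sat \<sigma> \<beta> ({#s#}, F))"
    by (simp add: observe_def sat_empty)
  have I1: "Imp \<beta> (Imp \<alpha> \<beta>) \<in> \<Delta>"
    using ct_taut_CO[OF ct, of "PImp (PVar 1) (PImp (PVar 0) (PVar 1))" "[\<alpha>, \<beta>]"] 4
    by (simp add: tautology_def nthd_def)
  have I2: "Imp (neg \<sigma> \<alpha>) (Imp \<alpha> \<beta>) \<in> \<Delta>"
    using ct_taut_CO[OF ct, of "PImp (PNot (PVar 0)) (PImp (PVar 0) (PVar 1))" "[\<alpha>, \<beta>]"] 4
    by (simp add: tautology_def nthd_def)
  have I3: "neg \<sigma> (Imp \<alpha> \<beta>) \<in> \<Delta>" if n: "\<alpha> \<in> \<Delta>" "neg \<sigma> \<beta> \<in> \<Delta>"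
  proof (rule neg_memI[OF ct CO])
    assume ct': "complete_theory (cond \<Delta> (Imp \<alpha> \<beta>))"
    have "\<alpha> \<in> cond \<Delta> (Imp \<alpha> \<beta>)" "neg \<sigma> \<beta> \<in> cond \<Delta> (Imp \<alpha> \<beta>)"
      using n 4(1,2) by (auto intro: cond_CO[OF ct CO])
    then show False using ct_neg[OF ct'] ct_Imp_MP[OF ct' cond_self[OF ct CO]] by blast
  qed
  show ?case unfolding sat using IH I1 I2 I3 ct_Imp_MP[OF ct] by blast
next
  case (5 E \<beta>)
  note ct = 5(4)
  show ?case
  proof (cases "consistent E")
    case False
    then show ?thesis using Cf_inconsistent[OF ct 5(1)] 5(2) by (simp add: CO_subset_PCO)
  next
    case True
    let ?s = "intervene_asg \<sigma> F E s" and ?F = "F |` (- fst ` E)"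
    have CO: "Cf E \<beta> \<in> CO \<sigma>" using 5 by simp
    have sat: "sat \<sigma> (Cf E \<beta>) ({#s#}, F) \<longleftrightarrow> sat \<sigma> \<beta> ({#?s#}, ?F)"
      using True by (simp add: intervene_def)
    have IH: "(sat \<sigma> \<beta> ({#?s#}, ?F) \<longrightarrow> \<beta> \<in> after \<Delta> E) \<and> (\<not> sat \<sigma> \<beta> ({#?s#}, ?F) \<longrightarrow> neg \<sigma> \<beta> \<in> after \<Delta> E)"
      using after_complete[OF ct 5(1) True] fits_after[OF ct 5(5,6,1) True] recursive_func_restrict[OF 5(6)]
      by (rule 5(3))
    have "neg \<sigma> (Cf E \<beta>) \<in> \<Delta>" if n: "neg \<sigma> \<beta> \<in> after \<Delta> E"
    proof (rule neg_memI[OF ct CO])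
      let ?\<Delta> = "cond \<Delta> (Cf E \<beta>)"
      assume ct': "complete_theory ?\<Delta>"
      \<comment> \<open>\<open>Cf E (neg \<beta>)\<close> belongs to \<open>CO\<close> and so
        survives the conditioning; then \<beta> and \<open>neg \<beta>\<close> meet in the theory
        after E.\<close>
      have "Cf E (neg \<sigma> \<beta>) \<in> ?\<Delta>"
        using n 5(1,2) by (intro cond_CO[OF ct CO]) (auto simp: after_def)
      then have "\<beta> \<in> after ?\<Delta> E" "neg \<sigma> \<beta> \<in> after ?\<Delta> E"
        using cond_self[OF ct CO] by (auto simp: after_def)
      then show False using ct_neg[OF after_complete[OF ct' 5(1) True]] by blast
    qed
    then show ?thesis unfolding sat using IH by (auto simp: after_def)
  qed
qed

section \<open>The canonical model\<close>

text \<open>\<open>C11\<close> applies to lists of at least two distinct variables. A closed walk of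
  least length visits distinct points, since a repetition would cut out a shorter one, and
  irreflexivity rules out length 1.\<close>

lemma exists_cycle:
  assumes "(x, x) \<in> R\<^sup>+" "irrefl R"
  shows "\<exists>xs. distinct xs \<and> 1 < length xs \<and> set xs \<subseteq> Field R \<and>
    (\<forall>i. Suc i < length xs \<longrightarrow> (xs ! i, xs ! Suc i) \<in> R) \<and> (last xs, hd xs) \<in> R"
proof -
  let ?P = "\<lambda>n. n > 0 \<and> (\<exists>x. (x, x) \<in> R ^^ n)"
  define n where "n = (LEAST n. ?P n)"
  have "\<exists>n. ?P n" using assms(1) by (auto simp: trancl_power)
  then have n: "?P n" unfolding n_def by (rule LeastI_ex)
  have least: "n \<le> m" if "?P m" for m using that unfolding n_def by (rule Least_le)
  obtain x f where f: "f 0 = x" "f n = x" "\<forall>i<n. (f i, f (Suc i)) \<in> R"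
    using n by (auto simp: relpow_fun_conv)
  have inj: "f i \<noteq> f j" if ij: "i < j" "j < n" for i j
  proof
    assume "f i = f j"
    then have "(f i, f i) \<in> R ^^ (j - i)"
      using ij f(3) unfolding relpow_fun_conv by (intro exI[of _ "\<lambda>k. f (i + k)"]) auto
    then have "?P (j - i)" using ij by auto
    then have "n \<le> j - i" by (rule least)
    then show False using ij by simp
  qed
  have "n \<noteq> 1" using f assms(2) by (auto simp: irrefl_def)
  then have n1: "1 < n" using n by linarith
  let ?xs = "map f [0..<n]"
  have "distinct ?xs"
    using linorder_inj_onI'[of "{0..<n}" f] inj by (simp add: distinct_map)
  moreover have "set ?xs \<subseteq> Field R" using f(3) by (auto simp: Field_def)
  moreover have "last ?xs = f (n - 1)" "hd ?xs = f n"
    using n1 f by (auto simp: last_map hd_map)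
  moreover have "(f (n - 1), f n) \<in> R" using f(3) n1 by (metis Suc_diff_1 diff_less less_one n)
  ultimately show ?thesis using f(3) n1 by (intro exI[of _ ?xs]) auto
qed

context
  fixes \<Delta> :: "('v, 'a) fm set"
  assumes ct: "complete_theory \<Delta>"
begin

text \<open>\<Delta> itself settles which variables are endogenous, for all states at once. The
  choice is harmless: \<open>C9\<close> puts an \<open>Or\<close> of equations under the
  intervention, so primeness makes one value certain, and \<open>Cf_Eq_unique\<close> leaves no
  other.\<close>

definition model_func :: "('v, 'a) func" where
  "model_func Y = (if Y \<in> Dom \<sigma> \<and> phi_End \<sigma> Y \<in> \<Delta>
     then Some (\<lambda>w. SOME y. Cf (eqs_of w (others \<sigma> Y)) (Eq Y y) \<in> \<Delta>) else None)"

lemma model_func_Cf: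
  assumes f: "model_func Y = Some f" and w: "w \<in> assigns \<sigma> (others \<sigma> Y)"
  shows "Cf (eqs_of w (others \<sigma> Y)) (Eq Y (f w)) \<in> \<Delta>" "f w \<in> Ran \<sigma> Y"
proof -
  let ?E = "eqs_of w (others \<sigma> Y)"
  have Y: "Y \<in> Dom \<sigma>" "phi_End \<sigma> Y \<in> \<Delta>"
    and fw: "f w = (SOME y. Cf ?E (Eq Y y) \<in> \<Delta>)"
    using f by (auto simp: model_func_def split: if_splits)
  have E: "is_eqs \<sigma> ?E" using w by (rule is_eqs_eqs_of) auto
  have "Cf ?E (big Or (falsum \<sigma>) [Eq Y y. y \<leftarrow> vals \<sigma> Y]) \<in> \<Delta>"
    by (rule ct_axiom_imp[OF ct axiom.C9[OF Y(1) w] Y(2)])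
  then have "big Or (falsum \<sigma>) [Eq Y y. y \<leftarrow> vals \<sigma> Y] \<in> after \<Delta> ?E" by (simp add: after_def)
  then obtain x where "x \<in> set [Eq Y y. y \<leftarrow> vals \<sigma> Y]" "x \<in> after \<Delta> ?E"
    using ct_big_Or[OF after_complete[OF ct E consistent_eqs_of]] Y by fastforce
  then have "\<exists>y. Cf ?E (Eq Y y) \<in> \<Delta>" by (auto simp: after_def)
  then show *: "Cf ?E (Eq Y (f w)) \<in> \<Delta>" unfolding fw by (rule someI_ex)
  show "f w \<in> Ran \<sigma> Y" using ct_PCO[OF ct *] by simp
qed

text \<open>A change of the structural function at X is witnessed by one disjunct of
  \<open>affects\<close>, the one whose context consists of all variables but X and Y.\<close>

lemma affects_mem:
  assumes "(X, Y) \<in> parent_rel \<sigma> model_func"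
  shows "affects \<sigma> X Y \<in> \<Delta>" "X \<in> Dom \<sigma>" "Y \<in> Dom \<sigma>" "X \<noteq> Y"
proof -
  obtain f w x where f: "model_func Y = Some f" and X: "X \<in> others \<sigma> Y"
    and w: "w \<in> assigns \<sigma> (others \<sigma> Y)" and x: "x \<in> Ran \<sigma> X" and ne: "f (w(X := x)) \<noteq> f w"
    using assms by (auto simp: parent_rel_def)
  show Y: "Y \<in> Dom \<sigma>" using f by (auto simp: model_func_def split: if_splits)
  show "X \<in> Dom \<sigma>" "X \<noteq> Y" using X by auto
  have w': "w(X := x) \<in> assigns \<sigma> (others \<sigma> Y)"
    using w x X by (auto simp: assigns_def PiE_iff extensional_def)
  have wX: "w X \<in> Ran \<sigma> X" using w X by (auto simp: assigns_def)
  have wne: "x \<noteq> w X" using ne fun_upd_triv[of w X] by metis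
  have "Dom \<sigma> - {X, Y} \<in> set ` set (subseqs [Z\<leftarrow>vars \<sigma>. Z \<noteq> X])"
    unfolding subseqs_powset by auto
  then obtain Zs where Zs: "set Zs = Dom \<sigma> - {X, Y}" "Zs \<in> set (subseqs [Z\<leftarrow>vars \<sigma>. Z \<noteq> X])"
    by (elim imageE) simp
  let ?zs = "map w Zs"
  have zs: "?zs \<in> set (tuples \<sigma> Zs)"
    using w Zs(1) nth_mem[of _ Zs] by (subst set_tuples) (auto simp: assigns_def)
  have E: "set (zip Zs ?zs) \<union> {(X, v)} = eqs_of (w(X := v)) (others \<sigma> Y)" for v
  proof -
    have "others \<sigma> Y = insert X (set Zs)" "X \<notin> set Zs" using X Zs(1) by auto
    moreover from this have "(\<lambda>Z. (Z, (w(X := v)) Z)) ` set Zs = (\<lambda>Z. (Z, w Z)) ` set Zs"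
      by (intro image_cong) auto
    ultimately show ?thesis unfolding zip_map_same eqs_of_def by simp
  qed
  let ?\<theta> = "And (Cf (set (zip Zs ?zs) \<union> {(X, x)}) (Eq Y (f (w(X := x)))))
    (Cf (set (zip Zs ?zs) \<union> {(X, w X)}) (Eq Y (f w)))"
  have "?\<theta> \<in> set (dep \<sigma> Zs X Y)"
    using zs x wX wne ne Y X model_func_Cf(2)[OF f w] model_func_Cf(2)[OF f w'] by (auto simp: dep_def)
  moreover have "?\<theta> \<in> \<Delta>"
    unfolding ct_And[OF ct] E using model_func_Cf(1)[OF f w] model_func_Cf(1)[OF f w'] by simp
  moreover have "set (concat (map (\<lambda>Zs. dep \<sigma> Zs X Y) (subseqs [Z\<leftarrow>vars \<sigma>. Z \<noteq> X]))) \<subseteq> CO \<sigma>"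
  proof -
    have "set Zs \<subseteq> Dom \<sigma>" if "Zs \<in> set (subseqs [Z\<leftarrow>vars \<sigma>. Z \<noteq> X])" for Zs
      using that subseqs_powset[of "[Z\<leftarrow>vars \<sigma>. Z \<noteq> X]"] by (auto simp: image_subset_iff)
    then show ?thesis using dep_CO X Y by force
  qed
  ultimately show "affects \<sigma> X Y \<in> \<Delta>"
    unfolding affects_def using Zs(2) by (intro ct_big_disjI[OF ct, where x = ?\<theta>]) auto
qed

lemma recursive_model_func: "recursive_func model_func"
  unfolding recursive_func_def
proof
  show "dom model_func \<subseteq> Dom \<sigma>" by (auto simp: model_func_def split: if_splits)
  let ?R = "parent_rel \<sigma> model_func"
  show "acyclic ?R"
    unfolding acyclic_def
  proof (intro allI notI)
    fix x assume "(x, x) \<in> ?R\<^sup>+"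
    moreover have "irrefl ?R" using affects_mem(4) by (auto simp: irrefl_def)
    ultimately obtain Xs where Xs: "distinct Xs" "1 < length Xs" "set Xs \<subseteq> Field ?R"
      "\<And>i. Suc i < length Xs \<Longrightarrow> (Xs ! i, Xs ! Suc i) \<in> ?R" "(last Xs, hd Xs) \<in> ?R"
      using exists_cycle by metis
    have "Field ?R \<subseteq> Dom \<sigma>" using affects_mem(2,3) by (auto simp: Field_def)
    then have Dom: "set Xs \<subseteq> Dom \<sigma>" using Xs(3) by blast
    have "big And (verum \<sigma>) [affects \<sigma> (Xs ! i) (Xs ! Suc i). i \<leftarrow> [0..<length Xs - 1]] \<in> \<Delta>"
      using affects_mem(1)[OF Xs(4)] by (intro ct_big_And[OF ct]) auto
    then have "wneg \<sigma> (affects \<sigma> (last Xs) (hd Xs)) \<in> \<Delta>"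
      by (rule ct_axiom_imp[OF ct axiom.C11[OF Dom Xs(1,2)]])
    then show False
      using affects_mem[OF Xs(5)] ct_wneg[OF ct, of "affects \<sigma> (last Xs) (hd Xs)"]
      by (simp add: CO_subset_PCO)
  qed
qed

context
  fixes s :: "'v \<Rightarrow> 'a"
  assumes s: "s \<in> states" and pos: "val \<Delta> (state_fm s) \<noteq> 0"
begin

abbreviation state_theory :: "('v, 'a) fm set" where
  "state_theory \<equiv> cond \<Delta> (state_fm s)"

lemma state_theory_complete: "complete_theory state_theory"
  using s by (intro cond_complete[OF ct _ pos]) simp

lemma state_theory_CO: "\<beta> \<in> CO \<sigma> \<Longrightarrow> \<beta> \<in> \<Delta> \<Longrightarrow> \<beta> \<in> state_theory"
  using s by (intro cond_CO[OF ct]) auto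

lemma state_theory_Eq: "\<forall>X\<in>Dom \<sigma>. Eq X (s X) \<in> state_theory"
  using s by (auto intro!: state_fm_Eq[OF state_theory_complete] cond_self[OF ct])

text \<open>Responses of endogenous variables are certain in \<Delta> and persist under conditioning
  on the state. For an exogenous Y, \<open>C10\<close> gives an implication from
  \<open>Eq Y (s Y)\<close>, and this antecedent holds in the state.\<close>

lemma fits_state: "fits s model_func state_theory"
  unfolding fits_def
proof (intro conjI ballI s state_theory_Eq[rule_format])
  fix Y w assume Y: "Y \<in> Dom \<sigma>" and w: "w \<in> assigns \<sigma> (others \<sigma> Y)"
  let ?E = "eqs_of w (others \<sigma> Y)"
  have E: "is_eqs \<sigma> ?E" using w by (rule is_eqs_eqs_of) auto
  show "Cf ?E (Eq Y (case model_func Y of None \<Rightarrow> s Y | Some f \<Rightarrow> f w)) \<in> state_theory"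
  proof (cases "model_func Y")
    case None
    then have "wneg \<sigma> (phi_End \<sigma> Y) \<in> \<Delta>"
      using Y ct_wneg[OF ct, of "phi_End \<sigma> Y"] by (auto simp: model_func_def split: if_splits)
    then have "Imp (Eq Y (s Y)) (Cf ?E (Eq Y (s Y))) \<in> \<Delta>"
      by (rule ct_axiom_imp[OF ct axiom.C10[OF Y states_Ran[OF s Y] w]])
    then have "Imp (Eq Y (s Y)) (Cf ?E (Eq Y (s Y))) \<in> state_theory"
      using Y E states_Ran[OF s Y] by (intro state_theory_CO) auto
    then have "Cf ?E (Eq Y (s Y)) \<in> state_theory"
      using state_theory_Eq Y by (blast intro: ct_Imp_MP[OF state_theory_complete])
    then show ?thesis using None by simp
  next
    case (Some f)
    have "Cf ?E (Eq Y (f w)) \<in> state_theory"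
      using model_func_Cf[OF Some w] Y E by (intro state_theory_CO) auto
    then show ?thesis using Some by simp
  qed
qed

lemma state_decided:
  assumes "\<beta> \<in> CO \<sigma>"
  shows "sat \<sigma> \<beta> ({#s#}, model_func) \<Longrightarrow> \<beta> \<in> state_theory"
    "\<not> sat \<sigma> \<beta> ({#s#}, model_func) \<Longrightarrow> neg \<sigma> \<beta> \<in> state_theory"
  using CO_decided[OF assms state_theory_complete fits_state recursive_model_func] by auto

text \<open>In the theory of a single state every formula of \<open>CO\<close> is decided, so a
  disjunct that is absent has its \<open>neg\<close> present, and disjunctive syllogism moves on to
  the rest.\<close>

lemma state_theory_big_disj:
  assumes "set xs \<subseteq> CO \<sigma>" "big (disj \<sigma>) (falsum \<sigma>) xs \<in> state_theory"
  shows "\<exists>x\<in>set xs. x \<in> state_theory"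
  using assms
proof (induction xs rule: induct_list012)
  case 1 then show ?case using ct_falsum[OF state_theory_complete] by simp
next
  case (3 a b xs)
  let ?B = "big (disj \<sigma>) (falsum \<sigma>) (b # xs)"
  have CO: "a \<in> CO \<sigma>" "?B \<in> CO \<sigma>" using 3 big_disj_CO[of "b # xs"] by auto
  show ?case
  proof (cases "a \<in> state_theory")
    case False
    then have n: "neg \<sigma> a \<in> state_theory" using state_decided[OF CO(1)] by blast
    have "Imp (disj \<sigma> a ?B) (Imp (neg \<sigma> a) ?B) \<in> state_theory"
      using ct_taut_CO[OF state_theory_complete,
        of "PImp (POr (PVar 0) (PVar 1)) (PImp (PNot (PVar 0)) (PVar 1))" "[a, ?B]"] CO
      by (auto simp: tautology_def nthd_def)
    then have "Imp (neg \<sigma> a) ?B \<in> state_theory"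
      using 3(4) ct_Imp_MP[OF state_theory_complete] by simp
    then have "?B \<in> state_theory" using n by (rule ct_Imp_MP[OF state_theory_complete])
    then show ?thesis using 3 by auto
  qed simp
qed simp

text \<open>\<open>phi_End\<close> is an \<open>Or\<close>, so \<Delta> selects a cause X; but
  \<open>phi_DC\<close> is a \<open>disj\<close>, whose disjuncts can be told apart only in the
  theory of a possible state. The responses given by f are certain in \<Delta>, hence the same
  there, and the selected disjunct exhibits two different ones.\<close>

lemma model_func_nonconstant:
  assumes f: "model_func Y = Some f"
  shows "\<exists>w\<in>assigns \<sigma> (others \<sigma> Y). \<exists>w'\<in>assigns \<sigma> (others \<sigma> Y). f w \<noteq> f w'"
proof (rule ccontr)
  assume const: "\<not> ?thesis"
  have Y: "Y \<in> Dom \<sigma>" "phi_End \<sigma> Y \<in> \<Delta>" using f by (auto simp: model_func_def split: if_splits)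
  have sub: "set [phi_DC \<sigma> X Y. X \<leftarrow> vars \<sigma>, X \<noteq> Y] \<subseteq> PCO \<sigma>" using Y by (auto simp: CO_subset_PCO)
  obtain X where X: "X \<in> Dom \<sigma>" "X \<noteq> Y" "phi_DC \<sigma> X Y \<in> \<Delta>"
    using ct_big_Or[OF ct sub] Y(2) unfolding phi_End_def by auto
  let ?Zs = "[Z \<leftarrow> vars \<sigma>. Z \<noteq> X \<and> Z \<noteq> Y]"
  have "phi_DC \<sigma> X Y \<in> state_theory" using X Y by (intro state_theory_CO) auto
  then obtain \<theta> where \<theta>: "\<theta> \<in> set (dep \<sigma> ?Zs X Y)" "\<theta> \<in> state_theory"
    using state_theory_big_disj[of "dep \<sigma> ?Zs X Y"] dep_CO[of ?Zs X Y] X Y unfolding phi_DC_def by auto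
  obtain zs x x' y y' where zs: "zs \<in> set (tuples \<sigma> ?Zs)" and x: "x \<in> Ran \<sigma> X" "x' \<in> Ran \<sigma> X" and y: "y \<noteq> y'"
    and eq: "\<theta> = And (Cf (set (zip ?Zs zs) \<union> {(X, x)}) (Eq Y y)) (Cf (set (zip ?Zs zs) \<union> {(X, x')}) (Eq Y y'))"
    using \<theta>(1) X Y by (auto simp: dep_def)
  have len: "length zs = length ?Zs" and Ran: "\<And>i. i < length ?Zs \<Longrightarrow> zs ! i \<in> Ran \<sigma> (?Zs ! i)"
    using zs by (auto simp: set_tuples)
  define w where "w v = restrict ((\<lambda>Z. the (map_of (zip ?Zs zs) Z))(X := v)) (others \<sigma> Y)" for v
  have nth: "w v (?Zs ! i) = zs ! i" if i: "i < length ?Zs" for v i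
  proof -
    have "map_of (zip ?Zs zs) (?Zs ! i) = Some (zs ! i)"
      using i len by (intro map_of_zip_nth) auto
    moreover have "?Zs ! i \<in> set ?Zs" using i by (rule nth_mem)
    ultimately show ?thesis by (simp add: w_def)
  qed
  have wX: "w v X = v" for v using X by (simp add: w_def)
  have others: "others \<sigma> Y = insert X (set ?Zs)" using X by auto
  have w: "w v \<in> assigns \<sigma> (others \<sigma> Y)" if "v \<in> Ran \<sigma> X" for v
    unfolding assigns_def
  proof (rule PiE_I)
    fix Z assume "Z \<in> others \<sigma> Y"
    then consider "Z = X" | "Z \<in> set ?Zs" unfolding others by blast
    then show "w v Z \<in> Ran \<sigma> Z"
    proof cases
      case 1 then show ?thesis using that wX by simp
    next
      case 2
      then obtain i where "i < length ?Zs" "?Zs ! i = Z" unfolding in_set_conv_nth by blast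
      then show ?thesis using nth[of i v] Ran[of i] by metis
    qed
  next
    show "w v Z = undefined" if "Z \<notin> others \<sigma> Y" for Z
      using that unfolding w_def restrict_def by (rule if_not_P)
  qed
  have "set (zip ?Zs zs) = eqs_of (w v) (set ?Zs)" for v
  proof -
    have "zs = map (w v) ?Zs" using len nth by (intro nth_equalityI) auto
    then show ?thesis by (simp add: zip_map_same eqs_of_def)
  qed
  then have E: "set (zip ?Zs zs) \<union> {(X, v)} = eqs_of (w v) (others \<sigma> Y)" for v
    unfolding others by (auto simp: eqs_of_def wX)
  have det: "u = f (w v)" if v: "v \<in> Ran \<sigma> X" and "Cf (eqs_of (w v) (others \<sigma> Y)) (Eq Y u) \<in> state_theory" for u v
  proof (rule Cf_Eq_unique[OF state_theory_complete _ consistent_eqs_of that(2)])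
    show eqs: "is_eqs \<sigma> (eqs_of (w v) (others \<sigma> Y))" using w[OF v] by (rule is_eqs_eqs_of) auto
    show "Cf (eqs_of (w v) (others \<sigma> Y)) (Eq Y (f (w v))) \<in> state_theory"
      using model_func_Cf[OF f w[OF v]] Y eqs by (intro state_theory_CO) auto
  qed
  have "Cf (eqs_of (w x) (others \<sigma> Y)) (Eq Y y) \<in> state_theory"
    "Cf (eqs_of (w x') (others \<sigma> Y)) (Eq Y y') \<in> state_theory"
    using \<theta>(2) unfolding eq E ct_And[OF state_theory_complete] by auto
  then have "y = f (w x)" "y' = f (w x')" using det x by blast+
  then show False using const w x y by metis
qed

lemma model_func_actual:
  assumes f: "model_func Y = Some f"
  shows "f (restrict s (others \<sigma> Y)) = s Y"
proof (rule Cf_actual[OF state_theory_complete s state_theory_Eq])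
  show Y: "Y \<in> Dom \<sigma>" using f by (auto simp: model_func_def split: if_splits)
  have w: "restrict s (others \<sigma> Y) \<in> assigns \<sigma> (others \<sigma> Y)"
    using s by (intro restrict_assigns) auto
  then have "is_eqs \<sigma> (eqs_of (restrict s (others \<sigma> Y)) (others \<sigma> Y))" by (rule is_eqs_eqs_of) auto
  then show "Cf (eqs_of (restrict s (others \<sigma> Y)) (others \<sigma> Y)) (Eq Y (f (restrict s (others \<sigma> Y)))) \<in> state_theory"
    using model_func_Cf[OF f w] Y by (intro state_theory_CO) auto
qed

end

text \<open>Within a state of positive probability \<alpha> has conditional probability 1 or 0,
  according to its truth there; a null state contributes nothing.\<close>

lemma val_And_state:
  assumes \<alpha>: "\<alpha> \<in> CO \<sigma>" and s: "s \<in> states"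
  shows "val \<Delta> (And \<alpha> (state_fm s)) = (if sat \<sigma> \<alpha> ({#s#}, model_func) then val \<Delta> (state_fm s) else 0)"
proof (cases "val \<Delta> (state_fm s) = 0")
  case True
  have CO: "state_fm s \<in> CO \<sigma>" "And \<alpha> (state_fm s) \<in> CO \<sigma>" using s \<alpha> by auto
  have "val \<Delta> (And \<alpha> (state_fm s)) = 0"
  proof (rule val_zeroI[OF ct CO(2)])
    let ?\<Delta> = "cond \<Delta> (And \<alpha> (state_fm s))"
    assume ct': "complete_theory ?\<Delta>"
    have "state_fm s \<in> ?\<Delta>" using cond_self[OF ct CO(2)] by (simp add: ct_And[OF ct'])
    moreover have "neg \<sigma> (state_fm s) \<in> ?\<Delta>"
      using True neg_mem_iff_val[OF ct CO(1)] CO(1) by (intro cond_CO[OF ct CO(2)]) auto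
    ultimately show False using ct_neg[OF ct'] by blast
  qed
  then show ?thesis using True by simp
next
  case False
  have CO: "state_fm s \<in> CO \<sigma>" using s by simp
  have "val \<Delta> (And \<alpha> (state_fm s)) = val \<Delta> (And (state_fm s) \<alpha>)"
  proof (rule val_cong[OF ct])
    show "equi (And \<alpha> (state_fm s)) (And (state_fm s) \<alpha>) \<in> \<Delta>"
      using ct_taut_CO[OF ct, of "PAnd (PImp (PAnd (PVar 0) (PVar 1)) (PAnd (PVar 1) (PVar 0)))
        (PImp (PAnd (PVar 1) (PVar 0)) (PAnd (PVar 0) (PVar 1)))" "[\<alpha>, state_fm s]"] \<alpha> CO
      by (simp add: tautology_def nthd_def equi_def)
  qed (use \<alpha> CO in auto)
  also have "\<dots> = val (state_theory s) \<alpha> * val \<Delta> (state_fm s)"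
    using val_cond[OF ct CO False \<alpha>] False by simp
  also have "val (state_theory s) \<alpha> = (if sat \<sigma> \<alpha> ({#s#}, model_func) then 1 else 0)"
    using state_decided[OF s False \<alpha>] mem_iff_val[OF state_theory_complete[OF s False] \<alpha>]
      neg_mem_iff_val[OF state_theory_complete[OF s False] \<alpha>] by auto
  finally show ?thesis by auto
qed

end

section \<open>From rational probabilities to a finite multiset\<close>

lemma common_denominator:
  fixes p :: "'b \<Rightarrow> rat"
  assumes "finite A" "\<And>x. x \<in> A \<Longrightarrow> 0 \<le> p x"
  shows "\<exists>N::nat. 0 < N \<and> (\<forall>x\<in>A. \<exists>k::nat. p x * of_nat N = of_nat k)"
  using assms
proof (induction A)
  case empty then show ?case by auto
next
  case (insert x A)
  then obtain N :: nat where N: "0 < N" "\<forall>y\<in>A. \<exists>k::nat. p y * of_nat N = of_nat k" by auto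
  obtain a b where ab: "p x = Fract a b" "0 < b" by (rule Rat_cases)
  have "0 \<le> Fract a b" using insert.prems[of x] ab(1) by simp
  then have a: "0 \<le> a" using ab(2) by (simp add: zero_le_Fract_iff)
  have b: "(of_nat (nat b) :: rat) = of_int b" "(of_nat (nat a) :: rat) = of_int a" using ab a by simp_all
  have "p x * of_nat (N * nat b) = of_nat (N * nat a)"
    using ab b by (simp add: Fract_of_int_quotient)
  moreover have "\<exists>k::nat. p y * of_nat (N * nat b) = of_nat k" if "y \<in> A" for y
  proof -
    obtain k :: nat where "p y * of_nat N = of_nat k" using N(2) \<open>y \<in> A\<close> by blast
    then have "p y * of_nat (N * nat b) = of_nat (k * nat b)" by (simp flip: mult.assoc)
    then show ?thesis by blast
  qed
  moreover have "0 < N * nat b" using N ab by simp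
  ultimately show ?case by (intro exI[of _ "N * nat b"]) blast
qed

lemma size_filter_sum_replicate:
  "finite A \<Longrightarrow> size (filter_mset P (\<Sum>x\<in>A. replicate_mset (n x) x)) = (\<Sum>x\<in>A. if P x then n x else 0)"
proof (induction A rule: finite_induct)
  case (insert x A)
  have "filter_mset P (replicate_mset k x) = (if P x then replicate_mset k x else {#})" for k
    by (induction k) auto
  then show ?case using insert by simp
qed simp

text \<open>Flatness: in the absence of probability atoms and \<open>Or\<close>, truth reduces to
  single assignments, because observation and intervention act on each assignment
  separately.\<close>

lemma sat_CO_flat: "\<alpha> \<in> CO \<sigma> \<Longrightarrow> sat \<sigma> \<alpha> T \<longleftrightarrow> (\<forall>s\<in>#fst T. sat \<sigma> \<alpha> ({#s#}, snd T))"
proof (induction \<alpha> arbitrary: T rule: CO.induct)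
  case (3 \<alpha> \<beta>)
  show ?case unfolding sat.simps 3(3)[of T] 3(4)[of T] by blast
next
  case (4 \<alpha> \<beta>)
  have "sat \<sigma> (Imp \<alpha> \<beta>) T \<longleftrightarrow> (\<forall>s\<in>#fst T. sat \<sigma> \<alpha> ({#s#}, snd T) \<longrightarrow> sat \<sigma> \<beta> ({#s#}, snd T))"
    using 4(4)[of "observe (sat \<sigma> \<alpha>) T"] by (auto simp: observe_def)
  then show ?case by (simp add: observe_def sat_empty)
next
  case (5 E \<alpha>)
  have IH: "sat \<sigma> \<alpha> (intervene \<sigma> E T) \<longleftrightarrow>
      (\<forall>s\<in>#fst (intervene \<sigma> E T). sat \<sigma> \<alpha> ({#s#}, snd (intervene \<sigma> E T)))"
    by (rule 5(3))
  show ?case unfolding sat.simps IH by (auto simp: intervene_def)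
qed simp_all

text \<open>Agreement is asked of \<open>CO\<close> probabilities, as this is what observation and
  intervention preserve directly; it determines the truth of all formulas by
  \<open>truth_lemma\<close>.\<close>

definition represents :: "('v, 'a) cmt \<Rightarrow> ('v, 'a) fm set \<Rightarrow> bool" where
  "represents T \<Delta> \<longleftrightarrow> fst T \<noteq> {#} \<and> (\<forall>\<alpha>\<in>CO \<sigma>. prob (sat \<sigma> \<alpha>) T = val \<Delta> \<alpha>)"

lemma exists_model:
  assumes ct: "complete_theory \<Delta>"
  shows "\<exists>T. causal_multiteam \<sigma> T \<and> represents T \<Delta>"
proof -
  let ?F = "model_func \<Delta>" and ?p = "\<lambda>s. val \<Delta> (state_fm s)"
  have p: "0 \<le> ?p s" if "s \<in> states" for s using val_bounds[OF ct] that by simp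
  obtain N :: nat where N: "0 < N" "\<forall>s\<in>states. \<exists>k::nat. ?p s * of_nat N = of_nat k"
    using common_denominator[OF finite_states, of ?p] p by blast
  from bchoice[OF N(2)] obtain n :: "('v \<Rightarrow> 'a) \<Rightarrow> nat"
    where n: "\<And>s. s \<in> states \<Longrightarrow> ?p s * of_nat N = of_nat (n s)" by blast
  \<comment> \<open>\<open>n s\<close> is the probability of s scaled by a common denominator N; the
    multiplicities add up to N.\<close>
  define M where "M = (\<Sum>s\<in>states. replicate_mset (n s) s)"
  have M: "s \<in># M \<longleftrightarrow> s \<in> states \<and> n s \<noteq> 0" for s
    unfolding M_def set_mset_sum[OF finite_states] by (auto simp: in_replicate_mset)
  have pos: "s \<in> states" "?p s \<noteq> 0" if "s \<in># M" for s
    using that M[of s] n[of s] by auto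
  have size: "of_nat (size (filter_mset (\<lambda>s. sat \<sigma> \<alpha> ({#s#}, ?F)) M)) = val \<Delta> \<alpha> * of_nat N"
    if \<alpha>: "\<alpha> \<in> CO \<sigma>" for \<alpha>
  proof -
    have "(of_nat (size (filter_mset (\<lambda>s. sat \<sigma> \<alpha> ({#s#}, ?F)) M)) :: rat) =
      (\<Sum>s\<in>states. if sat \<sigma> \<alpha> ({#s#}, ?F) then of_nat (n s) else 0)"
      unfolding M_def by (simp add: size_filter_sum_replicate[OF finite_states] of_nat_sum if_distrib cong: if_cong)
    also have "\<dots> = (\<Sum>s\<in>states. val \<Delta> (And \<alpha> (state_fm s)) * of_nat N)"
      using val_And_state[OF ct \<alpha>] n by (intro sum.cong) auto
    also have "\<dots> = val \<Delta> \<alpha> * of_nat N"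
      using sum_states[OF ct \<alpha>] by (simp flip: sum_distrib_right)
    finally show ?thesis .
  qed
  have v: "verum \<sigma> \<in> \<Delta>" by (rule ct_thm[OF ct provable_verum])
  \<comment> \<open>Truth of \<open>verum\<close> at a state is read off its state theory instead of
    computing an intervention. Taking \<open>verum\<close> for \<alpha> in \<open>size\<close> then
    yields the total number N.\<close>
  have "sat \<sigma> (verum \<sigma>) ({#s#}, ?F)" if "s \<in># M" for s
  proof (rule ccontr)
    assume "\<not> sat \<sigma> (verum \<sigma>) ({#s#}, ?F)"
    then have "neg \<sigma> (verum \<sigma>) \<in> state_theory \<Delta> s"
      using state_decided(2)[OF ct pos[OF that]] by simp
    then show False
      using ct_neg[OF state_theory_complete[OF ct pos[OF that]]]
        ct_thm[OF state_theory_complete[OF ct pos[OF that]] provable_verum] by blast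
  qed
  then have "filter_mset (\<lambda>s. sat \<sigma> (verum \<sigma>) ({#s#}, ?F)) M = M" by (simp add: filter_mset_eq_conv)
  then have sizeM: "size M = N"
    using size[of "verum \<sigma>"] v mem_iff_val[OF ct, of "verum \<sigma>"] by simp
  have "prob (sat \<sigma> \<alpha>) (M, ?F) = val \<Delta> \<alpha>" if "\<alpha> \<in> CO \<sigma>" for \<alpha>
    using size[OF that] N(1) sizeM by (simp add: prob_def observe_def)
  moreover have "M \<noteq> {#}" using sizeM N(1) by auto
  ultimately have rep: "represents (M, ?F) \<Delta>" by (simp add: represents_def)
  \<comment> \<open>Non-constancy of the structural functions is proved inside the theory of a
    possible state, so one such state has to be supplied.\<close>
  obtain s0 where s0: "s0 \<in># M" using \<open>M \<noteq> {#}\<close> by (meson multiset_nonemptyE)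
  have "causal_multiteam \<sigma> (M, ?F)"
    unfolding causal_multiteam_def fst_conv snd_conv
  proof (intro conjI allI impI)
    show "set_mset M \<subseteq> states" using pos by blast
    show "dom ?F \<subseteq> Dom \<sigma>" "acyclic (parent_rel \<sigma> ?F)"
      using recursive_model_func[OF ct] by (auto simp: recursive_func_def)
    fix V f assume f: "?F V = Some f"
    show "f \<in> assigns \<sigma> (others \<sigma> V) \<rightarrow> Ran \<sigma> V" using model_func_Cf(2)[OF ct f] by blast
    show "\<exists>w\<in>assigns \<sigma> (others \<sigma> V). \<exists>w'\<in>assigns \<sigma> (others \<sigma> V). f w \<noteq> f w'"
      by (rule model_func_nonconstant[OF ct pos[OF s0] f])
    show "\<forall>s\<in>#M. f (restrict s (others \<sigma> V)) = s V"
      using model_func_actual[OF ct pos f] by blast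
  qed
  then show ?thesis using rep by blast
qed

section \<open>Truth and completeness\<close>

lemma size_filter_eq_size: "size (filter_mset P M) = size M \<longleftrightarrow> (\<forall>x\<in>#M. P x)"
proof -
  have "size M = size (filter_mset P M) + size (filter_mset (\<lambda>x. \<not> P x) M)"
    by (metis multiset_partition size_union)
  then have "size (filter_mset P M) = size M \<longleftrightarrow> filter_mset (\<lambda>x. \<not> P x) M = {#}" by simp
  then show ?thesis by auto
qed

lemma prob_eq_1:
  assumes "fst T \<noteq> {#}" "\<alpha> \<in> CO \<sigma>"
  shows "prob (sat \<sigma> \<alpha>) T = 1 \<longleftrightarrow> sat \<sigma> \<alpha> T"
proof -
  have "prob (sat \<sigma> \<alpha>) T = 1 \<longleftrightarrow> size (filter_mset (\<lambda>s. sat \<sigma> \<alpha> ({#s#}, snd T)) (fst T)) = size (fst T)"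
    using assms(1) by (auto simp: prob_def observe_def)
  then show ?thesis unfolding size_filter_eq_size sat_CO_flat[OF assms(2), of T] .
qed

lemma represents_cond:
  assumes ct: "complete_theory \<Delta>" and rep: "represents T \<Delta>" and \<alpha>: "\<alpha> \<in> CO \<sigma>" "val \<Delta> \<alpha> \<noteq> 0"
  shows "represents (observe (sat \<sigma> \<alpha>) T) (cond \<Delta> \<alpha>)"
  unfolding represents_def
proof (intro conjI ballI)
  have ne: "fst T \<noteq> {#}" and pr: "prob (sat \<sigma> \<beta>) T = val \<Delta> \<beta>" if "\<beta> \<in> CO \<sigma>" for \<beta>
    using rep that by (auto simp: represents_def)
  show "fst (observe (sat \<sigma> \<alpha>) T) \<noteq> {#}" using pr[OF \<alpha>(1)] \<alpha>(2) by (auto simp: prob_def)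
  fix \<beta> assume \<beta>: "\<beta> \<in> CO \<sigma>"
  let ?A = "\<lambda>s. sat \<sigma> \<alpha> ({#s#}, snd T)" and ?B = "\<lambda>s. sat \<sigma> \<beta> ({#s#}, snd T)"
  have "prob (sat \<sigma> \<beta>) (observe (sat \<sigma> \<alpha>) T) =
    of_nat (size (filter_mset (\<lambda>s. ?A s \<and> ?B s) (fst T))) / of_nat (size (filter_mset ?A (fst T)))"
    by (simp add: prob_def observe_def filter_filter_mset conj_commute)
  also have "\<dots> = prob (sat \<sigma> (And \<alpha> \<beta>)) T / prob (sat \<sigma> \<alpha>) T"
    using ne[OF \<alpha>(1)] by (simp add: prob_def observe_def)
  also have "\<dots> = val (cond \<Delta> \<alpha>) \<beta>"
    using val_cond[OF ct \<alpha>(1,2) \<beta>] pr \<alpha> \<beta> by simp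
  finally show "prob (sat \<sigma> \<beta>) (observe (sat \<sigma> \<alpha>) T) = val (cond \<Delta> \<alpha>) \<beta>" .
qed

lemma represents_after:
  assumes ct: "complete_theory \<Delta>" and rep: "represents T \<Delta>" and E: "is_eqs \<sigma> E" "consistent E"
  shows "represents (intervene \<sigma> E T) (after \<Delta> E)"
  unfolding represents_def
proof (intro conjI ballI)
  show "fst (intervene \<sigma> E T) \<noteq> {#}" using rep by (auto simp: represents_def intervene_def)
  fix \<beta> assume \<beta>: "\<beta> \<in> CO \<sigma>"
  \<comment> \<open>An assignment counts for \<beta> after the intervention iff it counts for
    \<open>Cf E \<beta>\<close> before, and the size of the multiteam is unchanged.\<close>
  have "prob (sat \<sigma> \<beta>) (intervene \<sigma> E T) = prob (sat \<sigma> (Cf E \<beta>)) T"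
    using E(2) by (simp add: prob_def observe_def intervene_def filter_mset_image_mset)
  also have "\<dots> = val (after \<Delta> E) \<beta>"
    using val_after[OF ct E \<beta>] rep E \<beta> by (simp add: represents_def)
  finally show "prob (sat \<sigma> \<beta>) (intervene \<sigma> E T) = val (after \<Delta> E) \<beta>" .
qed

text \<open>The induction runs over all pairs of a multiteam and a theory it represents, since
  \<open>Imp\<close> leads to the observed and conditioned pair and \<open>Cf\<close> to the
  intervened one. Two vacuous cases stand apart: a null antecedent, where observation leaves the
  empty multiteam and \<open>O1\<close> applies, and an inconsistent intervention.\<close>

lemma truth_lemma:
  assumes "\<phi> \<in> PCO \<sigma>" "complete_theory \<Delta>" "represents T \<Delta>"
  shows "\<phi> \<in> \<Delta> \<longleftrightarrow> sat \<sigma> \<phi> T"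
  using assms
proof (induction \<phi> arbitrary: T \<Delta>)
  case (1 X x)
  then have "Eq X x \<in> CO \<sigma>" by simp
  then show ?case using prob_eq_1 mem_iff_val 1 unfolding represents_def by metis
next
  case (2 X x)
  then have "Neq X x \<in> CO \<sigma>" by simp
  then show ?case using prob_eq_1 mem_iff_val 2 unfolding represents_def by metis
next
  case (3 \<alpha> \<epsilon>)
  then show ?case using PrGe_iff[OF 3(4,1,2,3)] by (simp add: represents_def)
next
  case (4 \<alpha> \<epsilon>)
  then show ?case using PrGt_iff[OF 4(4,1,2,3)] by (simp add: represents_def)
next
  case (5 \<alpha> \<beta>)
  then show ?case using PrGeP_iff(1)[OF 5(3,1,2)] by (simp add: represents_def)
next
  case (6 \<alpha> \<beta>)
  then show ?case using PrGeP_iff(2)[OF 6(3,2,1)] by (simp add: represents_def)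
next
  case (7 \<phi> \<psi>)
  then show ?case by (simp add: ct_And)
next
  case (8 \<phi> \<psi>)
  then show ?case by (simp add: ct_Or)
next
  case (9 \<alpha> \<phi>)
  show ?case
  proof (cases "val \<Delta> \<alpha> = 0")
    case True
    then have "PrEq \<sigma> \<alpha> 0 \<in> \<Delta>" using PrEq_iff 9 by simp
    then have "Imp \<alpha> \<phi> \<in> \<Delta>" by (rule ct_axiom_imp[OF 9(4) axiom.O1[OF 9(1,2)]])
    moreover have "prob (sat \<sigma> \<alpha>) T = 0" "fst T \<noteq> {#}" using True 9 by (auto simp: represents_def)
    then have "fst (observe (sat \<sigma> \<alpha>) T) = {#}" by (simp add: prob_def)
    ultimately show ?thesis by (simp add: sat_empty)
  next
    case False
    have "\<phi> \<in> cond \<Delta> \<alpha> \<longleftrightarrow> sat \<sigma> \<phi> (observe (sat \<sigma> \<alpha>) T)"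
      using cond_complete[OF 9(4,1) False] represents_cond[OF 9(4,5,1) False] by (rule 9(3))
    then show ?thesis by (simp add: cond_def)
  qed
next
  case (10 E \<phi>)
  show ?case
  proof (cases "consistent E")
    case True
    have "\<phi> \<in> after \<Delta> E \<longleftrightarrow> sat \<sigma> \<phi> (intervene \<sigma> E T)"
      using after_complete[OF 10(4,1) True] represents_after[OF 10(4,5,1) True] by (rule 10(3))
    then show ?thesis using True by (simp add: after_def)
  next
    case False
    then show ?thesis using Cf_inconsistent[OF 10(4,1) False 10(2)] by simp
  qed
qed

lemma entails_imp_derivable:
  assumes "\<Gamma> \<subseteq> PCO \<sigma>" "\<phi> \<in> PCO \<sigma>" "entails \<sigma> \<Gamma> \<phi>"
  shows "derivable \<sigma> \<Gamma> \<phi>"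
proof (rule ccontr)
  assume "\<not> derivable \<sigma> \<Gamma> \<phi>"
  then obtain \<Delta> where \<Delta>: "insert (wneg \<sigma> \<phi>) \<Gamma> \<subseteq> \<Delta>" and ct: "complete_theory \<Delta>"
    using not_derivable_complete[OF assms(1,2)] by blast
  obtain T where T: "causal_multiteam \<sigma> T" "represents T \<Delta>" using exists_model[OF ct] by blast
  have "\<forall>\<gamma>\<in>\<Gamma>. sat \<sigma> \<gamma> T" using truth_lemma[OF _ ct T(2)] assms(1) \<Delta> by blast
  then have "sat \<sigma> \<phi> T" using assms(3) T(1) unfolding entails_def by blast
  then have "\<phi> \<in> \<Delta>" using truth_lemma[OF assms(2) ct T(2)] by simp
  then show False using ct_wneg[OF ct assms(2)] \<Delta> by simp
qed

end

theorem mainTheorem1: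
  fixes \<sigma> :: "('v, 'a) signature" and \<Gamma> :: "('v, 'a) fm set" and \<phi> :: "('v, 'a) fm"
  assumes "is_signature \<sigma>"
    and "\<Gamma> \<subseteq> PCO \<sigma>" and "\<phi> \<in> PCO \<sigma>"
    and "entails \<sigma> \<Gamma> \<phi>"
  shows "derivable \<sigma> \<Gamma> \<phi>"
proof -
  interpret signature_context \<sigma> by unfold_locales (rule assms(1))
  show ?thesis using assms(2-4) by (rule entails_imp_derivable)
qed

end
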